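(* In the setting of the context (Laguerre systems of the first kind with $s\ge2$ derivative rows and moving parameters, a fixed Laguerre-admissible index $\boldsymbol\lambda=(\boldsymbol n,\boldsymbol\eta)\in\mathbb N_0^r\times\mathbb N_0^s$, $R=|\boldsymbol\eta|$, $N=|\boldsymbol n|+R$, and $\boldsymbol m\in\mathbb N_0^p$ with $|\boldsymbol m|=N-1$), suppose $R>s$ and that $$c_{\boldsymbol\lambda}(\tau)=\prod_{1\le h<j\le r}(b_j(\tau)-b_h(\tau))^{\min(n_h,n_j)}\prod_{\substack{1\le j\le r\\1\le\nu\le q\\0\le u<n_j}}(b_j(\tau)+1-a_\nu(\tau))_u$$ is nonzero for all sufficiently large $\tau$. Then (for all sufficiently large $\tau$) the finite Rodrigues function $\mathcal B_\tau^{\mathrm L}$ has unique polynomial components of the prescribed degrees, i.e. a unique decomposition $\mathcal B_\tau^{\mathrm L}=\sum_{h=1}^rB_\tau^{(h),\mathrm L}w_{h,\tau}+\sum_{\ell=1}^sD_\tau^{(\ell),\mathrm L}v_{\ell,\tau}$ with $\deg B_\tau^{(h),\mathrm L}<n_h$, $\deg D_\tau^{(\ell),\mathrm L}<\eta_\ell$, and the coefficient vector $\mathbf b_\tau$ of the scaled components satisfies $$\|\mathbf b_\tau\|\xrightarrow[\tau\to+\infty]{}+\infty.$$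
   Context: Moving parameters. $p\ge1$, $r\ge0$, $s\ge2$, $q=r+s$. For all large $\tau$, $a_\nu(\tau)>-1$ ($1\le\nu\le q$) and $b_h(\tau)>a_h(\tau)$ ($1\le h\le r$). As $\tau\to+\infty$: $a_{r+j}(\tau)+1=\tau+\sqrt{2\tau}\,\widehat a_j+\mathrm O(1)$ ($1\le j\le s$); with $\varepsilon_\tau=\sqrt{2s/\tau}$, $\varepsilon_\tau(a_h(\tau)+1)\to\rho_h>0$, $b_h(\tau)-a_h(\tau)\to d_h\ge0$ ($1\le h\le r$), $\varepsilon_\tau\beta_i(\tau)\to\xi_i$ ($1\le i\le p$) with $\xi_1,\dots,\xi_p$ pairwise distinct and $\xi_i+\rho_h>0$ for all $i,h$. Put $c_\tau=\tau^s$, $x_\tau(t)=c_\tau(1+\varepsilon_\tau t)$. Weights. $\mathcal B_{a,b}(x)=\frac{x^a(1-x)^{b-a-1}}{\Gamma(b-a)}\mathbf 1_{(0,1)}(x)$, $\mathcal G_a(x)=x^a\mathrm e^{-x}\mathbf 1_{(0,\infty)}(x)$, $(f*g)(x)=\int_0^\infty f(u)g(x/u)\frac{\mathrm du}u$; $w_{0,\tau}=\mathcal B_{a_1,b_1}*\cdots*\mathcal B_{a_r,b_r}*\mathcal G_{a_{r+1}}*\cdots*\mathcal G_{a_q}$ (parameters at $\tau$); $w_{h,\tau}$ is the same with $b_h$ replaced by $b_h+1$; $v_{\ell,\tau}=(-x\,\mathrm d/\mathrm dx)^{\ell-1}w_{0,\tau}$, $1\le\ell\le s$. Laguerre admissible: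 any two entries of $(n_1,\dots,n_r,\eta_1,\dots,\eta_s)$ differ by at most one, and, writing $R=sQ+R_0$ with $0\le R_0<s$, $\eta_\ell=Q+1$ for $\ell\le R_0$, $\eta_\ell=Q$ for $\ell>R_0$. Finite Rodrigues function: $\mathcal B_\tau^{\mathrm L}$ is the function on $(0,\infty)$ with Mellin transform $\int_0^\infty x^{z-1}\mathcal B_\tau^{\mathrm L}(x)\,\mathrm dx=\frac{\prod_{\nu=1}^q\Gamma(z+a_\nu(\tau))}{\prod_{h=1}^r\Gamma(z+b_h(\tau)+n_h)}\prod_{i=1}^p(\beta_i(\tau)+1-z)_{m_i}$, where $(a)_k=a(a+1)\cdots(a+k-1)$. Scaled components: $\widetilde B_{h,\tau}(t)=\frac{\varepsilon_\tau^{R-1}}{b_h(\tau)+1}B_\tau^{(h),\mathrm L}(x_\tau(t))$, $\widetilde D_{\ell,\tau}(t)=(-1)^{\ell-1}\varepsilon_\tau^{R-\ell}D_\tau^{(\ell),\mathrm L}(x_\tau(t))$. $\mathbf b_\tau$ collects the coefficients of all $\widetilde B_{h,\tau}$, $\widetilde D_{\ell,\tau}$ in the fixed basis of monic Hermite polynomials $H_k$ ($\mathrm e^{uz-z^2/4}=\sum_kH_k(u)z^k/k!$), and $\|\cdot\|$ is any fixed norm on this finite-dimensional coefficient space. *)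

theory Defs
  imports
    "HOL-Analysis.Analysis"
    "HOL-Computational_Algebra.Polynomial"
    "HOL-Library.Landau_Symbols"
begin

section \<open>Weights\<close>

text \<open>Parameter families are functions on \<open>nat\<close> of which only the entries with index in
  \<open>{1..r}\<close>, \<open>{1..r+s}\<close>, \<dots> are used; indices start at 1 throughout.\<close>

definition jacobi_weight :: "real \<Rightarrow> real \<Rightarrow> real \<Rightarrow> real" where
  "jacobi_weight a b x =
     indicator {0<..<1} x * (x powr a * (1 - x) powr (b - a - 1) / Gamma (b - a))"

definition gamma_weight :: "real \<Rightarrow> real \<Rightarrow> real" where
  "gamma_weight a x = indicator {0<..} x * (x powr a * exp (- x))"

definition mconv :: "(real \<Rightarrow> real) \<Rightarrow> (real \<Rightarrow> real) \<Rightarrow> real \<Rightarrow> real" where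
  "mconv f g x = (LINT u:{0<..}|lborel. f u * g (x / u) / u)"

text \<open>The value on the empty list is irrelevant.\<close>

fun mconv_list :: "(real \<Rightarrow> real) list \<Rightarrow> real \<Rightarrow> real" where
  "mconv_list [] = (\<lambda>_. 0)"
| "mconv_list (f # fs) = foldl mconv f fs"

definition weight0 :: "nat \<Rightarrow> nat \<Rightarrow> (nat \<Rightarrow> real) \<Rightarrow> (nat \<Rightarrow> real) \<Rightarrow> real \<Rightarrow> real" where
  "weight0 r s a b = mconv_list
     (map (\<lambda>h. jacobi_weight (a h) (b h)) [1..<Suc r] @
      map (\<lambda>j. gamma_weight (a (r + j))) [1..<Suc s])"

definition weight_w :: "nat \<Rightarrow> nat \<Rightarrow> (nat \<Rightarrow> real) \<Rightarrow> (nat \<Rightarrow> real) \<Rightarrow> nat \<Rightarrow> real \<Rightarrow> real" where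
  "weight_w r s a b h = weight0 r s a (b(h := b h + 1))"

definition weight_v :: "nat \<Rightarrow> nat \<Rightarrow> (nat \<Rightarrow> real) \<Rightarrow> (nat \<Rightarrow> real) \<Rightarrow> nat \<Rightarrow> real \<Rightarrow> real" where
  "weight_v r s a b l = ((\<lambda>f x. - x * deriv f x) ^^ (l - 1)) (weight0 r s a b)"


section \<open>Finite Rodrigues function and its components\<close>

definition has_mellin :: "(real \<Rightarrow> real) \<Rightarrow> complex \<Rightarrow> complex \<Rightarrow> bool" where
  "has_mellin f z M \<longleftrightarrow>
     set_integrable lborel {0<..} (\<lambda>x. complex_of_real x powr (z - 1) * complex_of_real (f x)) \<and>
     (LINT x:{0<..}|lborel. complex_of_real x powr (z - 1) * complex_of_real (f x)) = M"

text \<open>A Mellin transform fixes a function on \<open>(0,\<infinity>)\<close> only almost everywhere; the function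
  meant here is the continuous one. It is extended by zero to the whole line. The half-plane is
  the one on which no factor \<open>\<Gamma>(z+a\<^sub>\<nu>)\<close> has a pole.\<close>

definition rodrigues_function ::
  "nat \<Rightarrow> nat \<Rightarrow> nat \<Rightarrow> (nat \<Rightarrow> real) \<Rightarrow> (nat \<Rightarrow> real) \<Rightarrow> (nat \<Rightarrow> real) \<Rightarrow>
   (nat \<Rightarrow> nat) \<Rightarrow> (nat \<Rightarrow> nat) \<Rightarrow> real \<Rightarrow> real" where
  "rodrigues_function p r s a b \<beta> n m = (THE f.
     continuous_on {0<..} f \<and> (\<forall>x\<le>0. f x = 0) \<and>
     (\<forall>z::complex. (\<forall>\<nu>\<in>{1..r+s}. Re z > - a \<nu>) \<longrightarrow>
        has_mellin f z
          ((\<Prod>\<nu>=1..r+s. Gamma (z + of_real (a \<nu>)))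
            / (\<Prod>h=1..r. Gamma (z + of_real (b h) + of_nat (n h)))
            * (\<Prod>i=1..p. pochhammer (of_real (\<beta> i) + 1 - z) (m i)))))"

text \<open>\<open>deg P < k\<close> with the convention \<open>deg 0 = -\<infinity>\<close>.\<close>

definition deg_less :: "real poly \<Rightarrow> nat \<Rightarrow> bool" where
  "deg_less P k \<longleftrightarrow> P = 0 \<or> degree P < k"

text \<open>The components are the pair \<open>(B, D)\<close>; entries outside the index ranges are set to zero so
  that uniqueness is meaningful.\<close>

definition is_components ::
  "nat \<Rightarrow> nat \<Rightarrow> (nat \<Rightarrow> real) \<Rightarrow> (nat \<Rightarrow> real) \<Rightarrow> (nat \<Rightarrow> nat) \<Rightarrow> (nat \<Rightarrow> nat) \<Rightarrow> (real \<Rightarrow> real) \<Rightarrow>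
   (nat \<Rightarrow> real poly) \<times> (nat \<Rightarrow> real poly) \<Rightarrow> bool" where
  "is_components r s a b n \<eta> f = (\<lambda>(B, D).
     (\<forall>h\<in>{1..r}. deg_less (B h) (n h)) \<and> (\<forall>h. h \<notin> {1..r} \<longrightarrow> B h = 0) \<and>
     (\<forall>l\<in>{1..s}. deg_less (D l) (\<eta> l)) \<and> (\<forall>l. l \<notin> {1..s} \<longrightarrow> D l = 0) \<and>
     (\<forall>x>0. f x = (\<Sum>h=1..r. poly (B h) x * weight_w r s a b h x)
                + (\<Sum>l=1..s. poly (D l) x * weight_v r s a b l x)))"

definition rodrigues_components ::
  "nat \<Rightarrow> nat \<Rightarrow> (nat \<Rightarrow> real) \<Rightarrow> (nat \<Rightarrow> real) \<Rightarrow> (nat \<Rightarrow> nat) \<Rightarrow> (nat \<Rightarrow> nat) \<Rightarrow> (real \<Rightarrow> real) \<Rightarrow>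
   (nat \<Rightarrow> real poly) \<times> (nat \<Rightarrow> real poly)" where
  "rodrigues_components r s a b n \<eta> f = (THE C. is_components r s a b n \<eta> f C)"


section \<open>Laguerre admissibility and the determinant factor\<close>

definition laguerre_admissible :: "nat \<Rightarrow> nat \<Rightarrow> (nat \<Rightarrow> nat) \<Rightarrow> (nat \<Rightarrow> nat) \<Rightarrow> bool" where
  "laguerre_admissible r s n \<eta> \<longleftrightarrow>
     (\<forall>u \<in> n ` {1..r} \<union> \<eta> ` {1..s}. \<forall>v \<in> n ` {1..r} \<union> \<eta> ` {1..s}. u \<le> v + 1) \<and>
     (let R = (\<Sum>l=1..s. \<eta> l); Q = R div s; R\<^sub>0 = R mod s
      in \<forall>l\<in>{1..s}. \<eta> l = (if l \<le> R\<^sub>0 then Q + 1 else Q))"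

definition c_index ::
  "nat \<Rightarrow> nat \<Rightarrow> (nat \<Rightarrow> real) \<Rightarrow> (nat \<Rightarrow> real) \<Rightarrow> (nat \<Rightarrow> nat) \<Rightarrow> real" where
  "c_index r s a b n =
     (\<Prod>j=1..r. \<Prod>h=1..<j. (b j - b h) ^ min (n h) (n j)) *
     (\<Prod>j=1..r. \<Prod>\<nu>=1..r+s. \<Prod>u<n j. pochhammer (b j + 1 - a \<nu>) u)"


section \<open>Monic Hermite polynomials\<close>

text \<open>Coefficientwise Cauchy product of the series of \<open>exp (u z)\<close> and \<open>exp (-z\<^sup>2/4)\<close>;
  see \<open>monic_hermite_generating_function\<close>.\<close>

definition monic_hermite :: "nat \<Rightarrow> real poly" where
  "monic_hermite k = (\<Sum>i\<le>k. monom
     (if even (k - i)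
      then fact k * (- 1 / 4) ^ ((k - i) div 2) / (fact i * fact ((k - i) div 2)) else 0) i)"

lemma monic_hermite_generating_function:
  "(\<lambda>k. poly (monic_hermite k) u * z ^ k / fact k) sums exp (u * z - z\<^sup>2 / 4)"
proof -
  define f where "f = (\<lambda>k. (u * z) ^ k / fact k)"
  define g where "g = (\<lambda>k. if even k then (- z\<^sup>2 / 4) ^ (k div 2) / fact (k div 2) else 0)"
  define G where "G = (\<lambda>k. if even k then (z\<^sup>2 / 4) ^ (k div 2) / fact (k div 2) else 0)"
  have E: "(\<lambda>k. x ^ k / fact k) sums exp x" for x :: real
    using exp_converges[of x] by (simp add: scaleR_conv_of_real divide_inverse mult.commute)
  have ev: "strict_mono (\<lambda>k::nat. 2 * k)"
    by (rule strict_monoI) simp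
  have re: "(\<lambda>k. if even k then h (k div 2) else 0) sums c \<longleftrightarrow> h sums c"
    for h :: "nat \<Rightarrow> real" and c
  proof -
    define q where "q = (\<lambda>k. if even k then h (k div 2) else 0)"
    have "q k = 0" if "k \<notin> range (\<lambda>k. 2 * k)" for k
      using that by (auto simp: q_def elim: evenE)
    from sums_mono_reindex[of "\<lambda>k. 2 * k" q c, OF ev this] show ?thesis by (simp add: q_def)
  qed
  have f: "f sums exp (u * z)"
    unfolding f_def by (rule E)
  have g: "g sums exp (- z\<^sup>2 / 4)"
    unfolding g_def by (subst re) (rule E)
  have G: "G sums exp (z\<^sup>2 / 4)"
    unfolding G_def by (subst re) (rule E)
  have "summable (\<lambda>k. norm (f k))"
  proof -
    have "(\<lambda>k. norm (f k)) = (\<lambda>k. \<bar>u * z\<bar> ^ k / fact k)"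
      by (auto simp: f_def power_abs)
    then show ?thesis
      using E[of "\<bar>u * z\<bar>"] sums_summable by metis
  qed
  moreover have "summable (\<lambda>k. norm (g k))"
  proof -
    have "(\<lambda>k. norm (g k)) = G"
      by (auto simp: g_def G_def power_abs)
    then show ?thesis
      using G sums_summable by metis
  qed
  ultimately have "(\<lambda>k. \<Sum>i\<le>k. f i * g (k - i)) sums (exp (u * z) * exp (- z\<^sup>2 / 4))"
    using Cauchy_product_sums[of f g] f g by (simp add: sums_unique[symmetric])
  moreover have "(\<Sum>i\<le>k. f i * g (k - i)) = poly (monic_hermite k) u * z ^ k / fact k" for k
  proof -
    have "f i * g (k - i) = poly (monom
       (if even (k - i)
        then fact k * (- 1 / 4) ^ ((k - i) div 2) / (fact i * fact ((k - i) div 2)) else 0) i) u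
        * z ^ k / fact k" if "i \<le> k" for i
    proof (cases "even (k - i)")
      case True
      then obtain j where j: "k - i = 2 * j" by blast
      have k: "z ^ k = z ^ i * (z\<^sup>2) ^ j"
        using j that by (metis le_add_diff_inverse power_add power_mult)
      have m: "(- z\<^sup>2 / 4) ^ j = (- 1 / 4) ^ j * (z\<^sup>2) ^ j"
        by (subst power_mult_distrib[symmetric]) simp
      show ?thesis
        unfolding f_def g_def k using j m
        by (simp add: poly_monom power_mult_distrib)
    qed (simp add: g_def)
    then show ?thesis
      by (simp add: monic_hermite_def poly_sum sum_distrib_right sum_divide_distrib)
  qed
  ultimately show ?thesis
    by (simp add: exp_add[symmetric])
qed

text \<open>Coordinates in the basis \<open>(H\<^sub>k)\<close>.\<close>

definition hermite_coeff :: "real poly \<Rightarrow> nat \<Rightarrow> real" where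
  "hermite_coeff P = (THE c. (\<forall>k>degree P. c k = 0) \<and>
     P = (\<Sum>k\<le>degree P. smult (c k) (monic_hermite k)))"


section \<open>Scaling\<close>

definition eps :: "nat \<Rightarrow> real \<Rightarrow> real" where
  "eps s \<tau> = sqrt (2 * real s / \<tau>)"

text \<open>\<open>x\<^sub>\<tau>(t) = c\<^sub>\<tau> (1 + \<epsilon>\<^sub>\<tau> t)\<close> with \<open>c\<^sub>\<tau> = \<tau>\<^sup>s\<close>, as a polynomial in \<open>t\<close>.\<close>

definition x_poly :: "nat \<Rightarrow> real \<Rightarrow> real poly" where
  "x_poly s \<tau> = [: \<tau> ^ s, \<tau> ^ s * eps s \<tau> :]"

text \<open>Natural-number subtraction in \<open>R - l\<close> is harmless for \<open>1 \<le> l \<le> s \<le> R\<close>.\<close>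

definition scaled_B :: "nat \<Rightarrow> nat \<Rightarrow> real \<Rightarrow> (nat \<Rightarrow> real) \<Rightarrow> (nat \<Rightarrow> real poly) \<Rightarrow> nat \<Rightarrow> real poly" where
  "scaled_B s R \<tau> b B h =
     smult (eps s \<tau> ^ (R - 1) / (b h + 1)) (pcompose (B h) (x_poly s \<tau>))"

definition scaled_D :: "nat \<Rightarrow> nat \<Rightarrow> real \<Rightarrow> (nat \<Rightarrow> real poly) \<Rightarrow> nat \<Rightarrow> real poly" where
  "scaled_D s R \<tau> D l =
     smult ((-1) ^ (l - 1) * eps s \<tau> ^ (R - l)) (pcompose (D l) (x_poly s \<tau>))"

text \<open>\<open>Inl (h, k)\<close> is the slot of the coefficient of \<open>H\<^sub>k\<close> in the \<open>h\<close>-th scaled \<open>B\<close>-component,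
  \<open>Inr (l, k)\<close> that of \<open>H\<^sub>k\<close> in the \<open>l\<close>-th scaled \<open>D\<close>-component.\<close>

type_synonym slot = "(nat \<times> nat) + (nat \<times> nat)"

definition slots :: "nat \<Rightarrow> nat \<Rightarrow> (nat \<Rightarrow> nat) \<Rightarrow> (nat \<Rightarrow> nat) \<Rightarrow> slot set" where
  "slots r s n \<eta> = (SIGMA h:{1..r}. {..<n h}) <+> (SIGMA l:{1..s}. {..<\<eta> l})"

definition coeff_vector ::
  "nat \<Rightarrow> nat \<Rightarrow> (nat \<Rightarrow> nat) \<Rightarrow> (nat \<Rightarrow> nat) \<Rightarrow> real \<Rightarrow> (nat \<Rightarrow> real) \<Rightarrow>
   (nat \<Rightarrow> real poly) \<times> (nat \<Rightarrow> real poly) \<Rightarrow> slot \<Rightarrow> real" where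
  "coeff_vector r s n \<eta> \<tau> b C i =
     (let R = (\<Sum>l=1..s. \<eta> l) in
      if i \<in> slots r s n \<eta> then
        (case i of
           Inl (h, k) \<Rightarrow> hermite_coeff (scaled_B s R \<tau> b (fst C) h) k
         | Inr (l, k) \<Rightarrow> hermite_coeff (scaled_D s R \<tau> (snd C) l) k)
      else 0)"

text \<open>Norms on the space \<open>\<real>\<^sup>I\<close>, represented as the functions vanishing outside \<open>I\<close>.\<close>

definition is_norm_on :: "'i set \<Rightarrow> (('i \<Rightarrow> real) \<Rightarrow> real) \<Rightarrow> bool" where
  "is_norm_on I \<N> \<longleftrightarrow>
     (let V = {v. \<forall>i. i \<notin> I \<longrightarrow> v i = 0} in
       (\<forall>v\<in>V. 0 \<le> \<N> v \<and> (\<N> v = 0 \<longleftrightarrow> v = (\<lambda>_. 0))) \<and>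
       (\<forall>v\<in>V. \<forall>c. \<N> (\<lambda>i. c * v i) = \<bar>c\<bar> * \<N> v) \<and>
       (\<forall>v\<in>V. \<forall>w\<in>V. \<N> (\<lambda>i. v i + w i) \<le> \<N> v + \<N> w))"

end

theory Submission
  imports Defs "HOL-Probability.Probability"
    "HOL-Computational_Algebra.Field_as_Ring" "HOL-Computational_Algebra.Polynomial_Factorial"
begin

text \<open>On the Mellin side \<open>x\<^sup>k w\<^sub>h\<close> and \<open>x\<^sup>k v\<^sub>l\<close> become a common meromorphic factor times monic polynomials
  of degree less than \<open>N\<close>. If \<open>c\<^sub>\<lambda> \<noteq> 0\<close>, these \<open>N\<close> polynomials are linearly independent, hence a basis of
  the polynomials of degree less than \<open>N\<close>. Expanding \<open>\<Prod>\<^sub>i (\<beta>\<^sub>i + 1 - z)\<^sub>m\<close> in this basis and using injectivity of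
  the Mellin transform gives existence and uniqueness of the components.

  Comparing the coefficients of \<open>z\<close> to the power \<open>N - 1\<close> shows that the unscaled coefficients belonging to
  polynomials of the maximal degree add up to \<open>\<plusminus>1\<close>. As \<open>R > s\<close>, each of them is the leading coefficient, of some
  degree \<open>k \<ge> 1\<close>, of its component. Up to sign it is the scaled coefficient times a bounded factor times
  the \<open>k\<close>-th power of the inverse of \<open>\<tau>\<^sup>s \<epsilon>\<^sup>s\<^sup>+\<^sup>1\<close>, and \<open>\<tau>\<^sup>s \<epsilon>\<^sup>s\<^sup>+\<^sup>1 \<rightarrow> \<infinity>\<close> because \<open>s \<ge> 2\<close>. So the scaled
  coefficients cannot stay bounded.\<close>

section \<open>Linear independence of the Mellin rows\<close>

text \<open>The exponent s + 1 arises as follows. In a slot of maximal degree the prefactor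
  contributes \<epsilon>^(s k) (for a B-slot once a factor \<epsilon> is paired with b_h + 1), and
  the substitution x_\<tau> contributes (\<tau>^s \<epsilon>)^k. Together this is the k-th power of
  G = \<tau>^s \<epsilon>^(s+1), which has order \<tau>^((s-1)/2). The two products in c_\<lambda>
  have separate tasks. The rows are sorted by the power k of x; the differences b_j - b_h separate
  rows with the same k, the Pochhammer factors separate different values of k. The decomposition is
  required at every x > 0 and the v_l are defined by \<open>deriv\<close>, whereas a Mellin
  transform sees a function only up to null sets. Hence each weight is also shown to be continuous,
  and the derivatives to exist. Both come from isolating the last gamma weight: there x enters only
  through x^a exp(-x/u), and iterating -x d/dx stays within finite combinations of such
  convolutions.\<close>

lemma prod_eq_zeroI: "finite A \<Longrightarrow> x \<in> A \<Longrightarrow> f x = (0 :: 'a :: comm_semiring_1) \<Longrightarrow> prod f A = 0"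
  by (meson prod_zero)

text \<open>Strong induction on k. Terms below k vanish and all later ones contain
  \<open>P k\<close>, so after cancelling the earlier factors \<open>P k\<close> divides
  \<open>G k * E k\<close>. By coprimality it divides \<open>E k\<close>, whose degree is too
  small.\<close>

lemma triangular_sum_zero:
  fixes E G P :: "nat \<Rightarrow> real poly"
  assumes sum: "(\<Sum>k<K. (\<Prod>u<k. P u) * (G k * E k)) = 0"
    and coprime: "\<And>k. k < K \<Longrightarrow> coprime (P k) (G k)"
    and degree: "\<And>k. k < K \<Longrightarrow> degree (E k) < degree (P k)"
    and "k < K"
  shows "E k = 0"
  using \<open>k < K\<close>
proof (induction k rule: less_induct)
  case (less k)
  have P0: "P u \<noteq> 0" if "u < K" for u
    using degree[OF that] by auto
  define S where "S = (\<Sum>k'\<in>{Suc k..<K}. (\<Prod>u\<in>{Suc k..<k'}. P u) * (G k' * E k'))"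
  have "(\<Prod>u<k. P u) * (G k * E k + P k * S) = 0"
  proof -
    have "(\<Sum>k'<K. (\<Prod>u<k'. P u) * (G k' * E k')) =
      (\<Sum>k'\<in>{..<k} \<union> {k} \<union> {Suc k..<K}. (\<Prod>u<k'. P u) * (G k' * E k'))"
      using less.prems by (intro sum.cong) auto
    also have "\<dots> = (\<Sum>k'<k. (\<Prod>u<k'. P u) * (G k' * E k')) + (\<Prod>u<k. P u) * (G k * E k)
       + (\<Sum>k'\<in>{Suc k..<K}. (\<Prod>u<k'. P u) * (G k' * E k'))"
      by (subst sum.union_disjoint; (subst sum.union_disjoint)?) auto
    also have "(\<Sum>k'<k. (\<Prod>u<k'. P u) * (G k' * E k')) = 0"
      using less by (intro sum.neutral) auto
    also have "(\<Sum>k'\<in>{Suc k..<K}. (\<Prod>u<k'. P u) * (G k' * E k')) = (\<Prod>u<k. P u) * (P k * S)"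
      unfolding S_def sum_distrib_left
    proof (rule sum.cong[OF refl])
      fix k' assume k': "k' \<in> {Suc k..<K}"
      have "(\<Prod>u<k'. P u) = (\<Prod>u<k. P u) * (\<Prod>u\<in>{k..<k'}. P u)"
        using k' by (simp add: lessThan_atLeast0 prod.atLeastLessThan_concat)
      also have "(\<Prod>u\<in>{k..<k'}. P u) = P k * (\<Prod>u\<in>{Suc k..<k'}. P u)"
        using k' by (intro prod.atLeast_Suc_lessThan) auto
      finally have "(\<Prod>u<k'. P u) = (\<Prod>u<k. P u) * P k * (\<Prod>u\<in>{Suc k..<k'}. P u)"
        by (simp only: mult.assoc)
      then show "(\<Prod>u<k'. P u) * (G k' * E k') =
        (\<Prod>u<k. P u) * (P k * ((\<Prod>u\<in>{Suc k..<k'}. P u) * (G k' * E k')))"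
        by (simp add: mult_ac)
    qed
    finally show ?thesis using sum by (simp add: algebra_simps)
  qed
  moreover have "(\<Prod>u<k. P u) \<noteq> 0" using P0 less.prems by auto
  ultimately have "G k * E k = P k * (- S)"
    by (simp add: eq_neg_iff_add_eq_0)
  then have "P k dvd G k * E k" by (metis dvd_triv_left)
  then have "P k dvd E k"
    using coprime[OF less.prems] by (simp add: coprime_dvd_mult_right_iff)
  then show ?case
    using degree[OF less.prems] dvd_imp_degree_le[of "P k" "E k"] by linarith
qed

lemma coprime_linear_poly:
  fixes x y :: real
  assumes "x \<noteq> y"
  shows "coprime [:x, 1:] [:y, 1:]"
proof (rule coprimeI)
  fix c :: "real poly" assume "c dvd [:x, 1:]" "c dvd [:y, 1:]"
  then have "c dvd [:x, 1:] - [:y, 1:]" by (rule dvd_diff)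
  also have "[:x, 1:] - [:y, 1:] = [:x - y:]" by simp
  also have "[:x - y:] dvd 1" using assms by (simp add: is_unit_pCons_iff)
  finally show "is_unit c" .
qed

text \<open>For i \<le> j this is the Pochhammer quotient (z + c)_j / (z + c)_i as a polynomial in
  z, that is, Gamma(z + c + j) / Gamma(z + c + i). For j \<le> i it is 1.\<close>

definition shift_poly :: "real \<Rightarrow> nat \<Rightarrow> nat \<Rightarrow> real poly" where
  "shift_poly c i j = (\<Prod>u\<in>{i..<j}. [:c + real u, 1:])"

lemma degree_shift_poly: "degree (shift_poly c i j) = j - i"
  unfolding shift_poly_def by (subst degree_prod_eq_sum_degree) auto

lemma lead_coeff_shift_poly: "lead_coeff (shift_poly c i j) = 1"
  unfolding shift_poly_def lead_coeff_prod by simp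

lemma shift_poly_nonzero [simp]: "shift_poly c i j \<noteq> 0"
  using lead_coeff_shift_poly[of c i j] by fastforce

text \<open>Up to the common factor \<open>rodrigues_mellin\<close> below, \<open>Inl (h, k)\<close> is the Mellin transform of \<open>x\<^sup>k w\<^sub>h\<close>
  and \<open>Inr (l, k)\<close> that of \<open>x\<^sup>k v\<^sub>l\<close>.\<close>

fun mellin_row ::
  "nat \<Rightarrow> nat \<Rightarrow> (nat \<Rightarrow> real) \<Rightarrow> (nat \<Rightarrow> real) \<Rightarrow> (nat \<Rightarrow> nat) \<Rightarrow> slot \<Rightarrow> real poly" where
  "mellin_row r s a b n (Inl (h, k)) =
     (\<Prod>\<nu>=1..r+s. shift_poly (a \<nu>) 0 k) *
     (\<Prod>j=1..r. shift_poly (b j) (if j = h then Suc k else k) (n j))"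
| "mellin_row r s a b n (Inr (l, k)) =
     [:real k, 1:] ^ (l - 1) * (\<Prod>\<nu>=1..r+s. shift_poly (a \<nu>) 0 k) *
     (\<Prod>j=1..r. shift_poly (b j) k (n j))"

lemma lead_coeff_mellin_row: "lead_coeff (mellin_row r s a b n i) = 1"
proof (cases i)
  case (Inl q)
  then show ?thesis
    by (cases q) (simp add: lead_coeff_mult lead_coeff_prod lead_coeff_shift_poly)
next
  case (Inr q)
  then show ?thesis
    by (cases q) (simp add: lead_coeff_mult lead_coeff_prod lead_coeff_shift_poly lead_coeff_power)
qed

lemma mellin_row_nonzero [simp]: "mellin_row r s a b n i \<noteq> 0"
  using lead_coeff_mellin_row[of r s a b n i] by fastforce

lemma shift_poly_split:
  "k < m \<Longrightarrow> shift_poly c k m = [:c + real k, 1:] * shift_poly c (Suc k) m"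
  unfolding shift_poly_def by (simp add: prod.atLeast_Suc_lessThan)

lemma shift_poly_empty: "m \<le> k \<Longrightarrow> shift_poly c k m = 1"
  unfolding shift_poly_def by simp

lemma finite_slots [simp]: "finite (slots r s n \<eta>)"
  unfolding slots_def by (intro finite_Plus finite_SigmaI) auto

lemma card_slots: "card (slots r s n \<eta>) = (\<Sum>h=1..r. n h) + (\<Sum>l=1..s. \<eta> l)"
  unfolding slots_def by (subst card_Plus) (auto simp: card_SigmaI intro!: finite_SigmaI)

lemma sum_slots:
  fixes f :: "slot \<Rightarrow> 'a :: comm_monoid_add"
  shows "(\<Sum>i\<in>slots r s n \<eta>. f i) =
    (\<Sum>h=1..r. \<Sum>k<n h. f (Inl (h, k))) + (\<Sum>l=1..s. \<Sum>k<\<eta> l. f (Inr (l, k)))"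
  unfolding slots_def
  by (subst sum.Plus) (auto intro!: finite_SigmaI simp: sum.Sigma comp_def split_def)

context
  fixes r s :: nat and a b :: "nat \<Rightarrow> real" and n :: "nat \<Rightarrow> nat"
  assumes c: "c_index r s a b n \<noteq> 0"
begin

text \<open>The exponent \<open>min (n h) (n j)\<close> is positive exactly when both
  \<open>n h\<close> and \<open>n j\<close> are; otherwise the factor is 1 even for b_h =
  b_j.\<close>

lemma c_index_b_distinct:
  assumes "h \<in> {1..r}" "j \<in> {1..r}" "h \<noteq> j" "0 < n h" "0 < n j"
  shows "b h \<noteq> b j"
proof -
  have *: "b h \<noteq> b j" if "j \<in> {1..r}" "h \<in> {1..<j}" "0 < n h" "0 < n j" for h j
  proof
    assume "b h = b j"
    then have "(\<Prod>h=1..<j. (b j - b h) ^ min (n h) (n j)) = 0"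
      using that by (intro prod_eq_zeroI[of _ h]) auto
    with that(1) have "(\<Prod>j=1..r. \<Prod>h=1..<j. (b j - b h) ^ min (n h) (n j)) = 0"
      by (rule prod_eq_zeroI[rotated]) simp
    then show False using c unfolding c_index_def by simp
  qed
  show ?thesis
    using *[of j h] *[of h j] assms by (cases "h < j") auto
qed

text \<open>If b_j + u = a_\<nu> + k with k < u, the last factor of the Pochhammer symbol of b_j + 1
  - a_\<nu> of length u - k is zero. These are the coincidences of roots that would spoil the
  coprimality between levels.\<close>

lemma c_index_a_b:
  assumes "j \<in> {1..r}" "\<nu> \<in> {1..r+s}" "k < u" "u < n j"
  shows "b j + real u \<noteq> a \<nu> + real k"
proof
  assume eq: "b j + real u = a \<nu> + real k"
  have "pochhammer (b j + 1 - a \<nu>) (u - k) = 0"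
    unfolding pochhammer_eq_0_iff
  proof (intro exI conjI)
    show "u - k - 1 < u - k" using assms by simp
    show "b j + 1 - a \<nu> = - of_nat (u - k - 1)"
      using eq assms by (simp add: of_nat_diff)
  qed
  moreover have "u - k \<in> {..<n j}" using assms by auto
  ultimately have "(\<Prod>u<n j. pochhammer (b j + 1 - a \<nu>) u) = 0"
    by (intro prod_eq_zeroI[of _ "u - k"] finite_lessThan)
  with assms(2) have "(\<Prod>\<nu>=1..r+s. \<Prod>u<n j. pochhammer (b j + 1 - a \<nu>) u) = 0"
    by (rule prod_eq_zeroI[rotated]) simp
  with assms(1) have "(\<Prod>j=1..r. \<Prod>\<nu>=1..r+s. \<Prod>u<n j. pochhammer (b j + 1 - a \<nu>) u) = 0"
    by (rule prod_eq_zeroI[rotated]) simp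
  then show False using c unfolding c_index_def by simp
qed

text \<open>What remains of the rows with second index \<open>k\<close> after cancelling their common factors. Its degree is
  smaller than that of \<open>\<Prod>\<^sub>\<nu> (z + a\<^sub>\<nu> + k)\<close>, which divides all rows with larger second index.\<close>

definition level_poly :: "(nat \<Rightarrow> nat \<Rightarrow> real) \<Rightarrow> (nat \<Rightarrow> nat \<Rightarrow> real) \<Rightarrow> nat \<Rightarrow> real poly" where
  "level_poly B D k = (let J = {j\<in>{1..r}. k < n j} in
     (\<Sum>h=1..r. smult (B h k) (\<Prod>j\<in>J - {h}. [:b j + real k, 1:])) +
     (\<Sum>l=1..s. smult (D l k) ([:real k, 1:] ^ (l - 1))) * (\<Prod>j\<in>J. [:b j + real k, 1:]))"

text \<open>The second summand has degree at most r + (s - 1). The first has no powers of z + k and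
  degree at most r, which fits below r + s because s > 0.\<close>

lemma degree_level_poly:
  assumes "s > 0"
  shows "degree (level_poly B D k) < r + s"
proof -
  define J where "J = {j\<in>{1..r}. k < n j}"
  have J: "finite J" "J \<subseteq> {1..r}" "card J \<le> r"
    unfolding J_def by (auto intro: order_trans[OF card_mono[of "{1..r}"]])
  have pd: "degree (\<Prod>j\<in>X. [:b j + real k, 1:]) = card X" for X
    by (subst degree_prod_eq_sum_degree) auto
  have 1: "degree (\<Sum>h=1..r. smult (B h k) (\<Prod>j\<in>J - {h}. [:b j + real k, 1:])) \<le> r + s - 1"
  proof (rule degree_sum_le)
    fix h assume "h \<in> {1..r}"
    have "card (J - {h}) \<le> r + s - 1"
      using J(3) card_mono[of J "J - {h}"] J(1) \<open>s > 0\<close> by force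
    then show "degree (smult (B h k) (\<Prod>j\<in>J - {h}. [:b j + real k, 1:])) \<le> r + s - 1"
      by (simp only: pd[symmetric]) (meson degree_smult_le order_trans)
  qed simp
  have "degree (\<Sum>l=1..s. smult (D l k) ([:real k, 1:] ^ (l - 1))) \<le> s - 1"
  proof (rule degree_sum_le)
    fix l assume "l \<in> {1..s}"
    then have "degree ([:real k, 1:] ^ (l - 1)) \<le> s - 1"
      by (simp add: degree_linear_power diff_le_mono)
    then show "degree (smult (D l k) ([:real k, 1:] ^ (l - 1))) \<le> s - 1"
      by (meson degree_smult_le order_trans)
  qed simp
  then have 2: "degree ((\<Sum>l=1..s. smult (D l k) ([:real k, 1:] ^ (l - 1))) * (\<Prod>j\<in>J. [:b j + real k, 1:]))
     \<le> r + s - 1"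
    using degree_mult_le[of "\<Sum>l=1..s. smult (D l k) ([:real k, 1:] ^ (l - 1))" "\<Prod>j\<in>J. [:b j + real k, 1:]"]
      pd[of J] J \<open>s > 0\<close> by linarith
  have "degree (level_poly B D k) \<le> r + s - 1"
    unfolding level_poly_def Let_def J_def[symmetric] using degree_add_le[OF 1 2] .
  then show ?thesis using \<open>s > 0\<close> by linarith
qed

text \<open>As with partial fractions: at z = - b_h - k only the summand with index h survives,
  multiplied by nonzero differences of the b_j in J. Once all B vanish, the product over J cancels.
  The second claim assumes B = 0 for n_h \<le> k, since all indices outside J come with the same
  product over J and could not be told apart.\<close>

lemma level_poly_zero:
  assumes "level_poly B D k = 0"
  shows "\<And>h. h \<in> {1..r} \<Longrightarrow> k < n h \<Longrightarrow> B h k = 0"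
    and "(\<And>h k. n h \<le> k \<Longrightarrow> B h k = 0) \<Longrightarrow> l \<in> {1..s} \<Longrightarrow> D l k = 0"
proof -
  define J where "J = {j\<in>{1..r}. k < n j}"
  have J: "finite J" unfolding J_def by auto
  have lp: "(\<Sum>h=1..r. smult (B h k) (\<Prod>j\<in>J - {h}. [:b j + real k, 1:])) +
     (\<Sum>l=1..s. smult (D l k) ([:real k, 1:] ^ (l - 1))) * (\<Prod>j\<in>J. [:b j + real k, 1:]) = 0"
    using assms unfolding level_poly_def Let_def J_def .
  show B0: "B h k = 0" if h: "h \<in> {1..r}" "k < n h" for h
  proof -
    have hJ: "h \<in> J" using h unfolding J_def by auto
    have "poly (\<Prod>j\<in>X. [:b j + real k, 1:]) (- b h - real k) = (\<Prod>j\<in>X. b j - b h)" for X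
      by (simp add: poly_prod)
    moreover have "(\<Prod>j\<in>J - {h'}. b j - b h) = 0" if "h' \<noteq> h" for h'
      using hJ that J by (intro prod_zero) auto
    moreover have "(\<Prod>j\<in>J. b j - b h) = 0"
      using hJ J by (intro prod_zero) auto
    ultimately have *: "B h' k * poly (\<Prod>j\<in>J - {h'}. [:b j + real k, 1:]) (- b h - real k)
       = (if h' = h then B h k * (\<Prod>j\<in>J - {h}. b j - b h) else 0)"
      and "poly (\<Prod>j\<in>J. [:b j + real k, 1:]) (- b h - real k) = 0" for h'
      by auto
    moreover have "poly (\<Sum>h'=1..r. smult (B h' k) (\<Prod>j\<in>J - {h'}. [:b j + real k, 1:])) (- b h - real k)
       = (\<Sum>h'=1..r. if h' = h then B h k * (\<Prod>j\<in>J - {h}. b j - b h) else 0)"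
      unfolding poly_sum poly_smult * ..
    ultimately have "B h k * (\<Prod>j\<in>J - {h}. b j - b h) = 0"
      using arg_cong[OF lp, of "\<lambda>p. poly p (- b h - real k)"] h by simp
    moreover have "(\<Prod>j\<in>J - {h}. b j - b h) \<noteq> 0"
      using c_index_b_distinct[of _ h] h J by (auto simp: J_def prod_zero_iff)
    ultimately show ?thesis by simp
  qed
  show "D l k = 0" if Bz: "\<And>h k. n h \<le> k \<Longrightarrow> B h k = 0" and l: "l \<in> {1..s}"
  proof -
    have "B h k = 0" if "h \<in> {1..r}" for h
      using B0 Bz that by (cases "k < n h") auto
    then have "(\<Sum>l=1..s. smult (D l k) ([:real k, 1:] ^ (l - 1))) * (\<Prod>j\<in>J. [:b j + real k, 1:]) = 0"
      using lp by simp
    moreover have "(\<Prod>j\<in>J. [:b j + real k, 1:]) \<noteq> 0"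
      using J by auto
    ultimately have "(\<Sum>l=1..s. smult (D l k) ([:real k, 1:] ^ (l - 1))) = 0"
      by simp
    \<comment> \<open>Shifting z by k turns the powers of z + k into monomials, whose coefficients
      can be read off.\<close>
    then have "pcompose (\<Sum>l=1..s. smult (D l k) ([:real k, 1:] ^ (l - 1))) [:- real k, 1:] = 0"
      by simp
    moreover have "pcompose (\<Sum>l=1..s. smult (D l k) ([:real k, 1:] ^ (l - 1))) [:- real k, 1:]
       = (\<Sum>l=1..s. monom (D l k) (l - 1))"
    proof -
      have "pcompose ([:real k, 1:] ^ i) [:- real k, 1:] = monom 1 i" for i
      proof (induction i)
        case 0
        then show ?case by (simp add: pcompose_1)
      next
        case (Suc i)
        then show ?case
          by (simp only: power_Suc pcompose_mult) (simp add: pcompose_pCons monom_Suc)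
      qed
      then show ?thesis
        by (simp add: pcompose_sum pcompose_smult smult_monom)
    qed
    ultimately have "coeff (\<Sum>l=1..s. monom (D l k) (l - 1)) (l - 1) = 0" by simp
    moreover have "coeff (\<Sum>l=1..s. monom (D l k) (l - 1)) (l - 1) = (\<Sum>i=1..s. if i = l then D l k else 0)"
      unfolding coeff_sum coeff_monom using l by (intro sum.cong refl) auto
    ultimately show ?thesis using l by simp
  qed
qed

text \<open>All rows of level k share the factors \<open>P u\<close> with u < k and the factor
  \<open>G k\<close>; what remains of their combination is \<open>level_poly\<close>. A linear
  relation therefore has the triangular form treated above.\<close>

theorem mellin_row_independent:
  assumes "s > 0" and z: "(\<Sum>i\<in>slots r s n \<eta>. smult (x i) (mellin_row r s a b n i)) = 0"
    and i: "i \<in> slots r s n \<eta>"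
  shows "x i = 0"
proof -
  \<comment> \<open>Extension by zero lets all components run over the same levels k < K, whatever
    their degree bounds.\<close>
  define B where "B h k = (if k < n h then x (Inl (h, k)) else 0)" for h k
  define D where "D l k = (if k < \<eta> l then x (Inr (l, k)) else 0)" for l k
  define K where "K = (\<Sum>h=1..r. n h) + (\<Sum>l=1..s. \<eta> l)"
  have nK: "n h \<le> K" if "h \<in> {1..r}" for h
    unfolding K_def using member_le_sum[of h "{1..r}" n] that by auto
  have eK: "\<eta> l \<le> K" if "l \<in> {1..s}" for l
    unfolding K_def using member_le_sum[of l "{1..s}" \<eta>] that by auto
  define P where "P k = (\<Prod>\<nu>=1..r+s. [:a \<nu> + real k, 1:])" for k
  define G where "G k = (\<Prod>j=1..r. shift_poly (b j) (Suc k) (n j))" for k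
  have PP: "(\<Prod>\<nu>=1..r+s. shift_poly (a \<nu>) 0 k) = (\<Prod>u<k. P u)" for k
    unfolding P_def shift_poly_def by (subst prod.swap) (simp add: lessThan_atLeast0)
  have fac: "shift_poly (b j) k (n j) = (if k < n j then [:b j + real k, 1:] else 1) * shift_poly (b j) (Suc k) (n j)"
    for j k by (simp add: shift_poly_split shift_poly_empty)
  have GD: "(\<Prod>j=1..r. shift_poly (b j) k (n j)) = G k * (\<Prod>j\<in>{j\<in>{1..r}. k < n j}. [:b j + real k, 1:])" for k
    unfolding G_def fac[of _ k] prod.distrib by (simp add: prod.If_cases Int_def mult.commute)
  have GB: "(\<Prod>j=1..r. shift_poly (b j) (if j = h then Suc k else k) (n j)) =
     G k * (\<Prod>j\<in>{j\<in>{1..r}. k < n j} - {h}. [:b j + real k, 1:])" if "h \<in> {1..r}" for h k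
  proof -
    have "shift_poly (b j) (if j = h then Suc k else k) (n j) =
      (if k < n j \<and> j \<noteq> h then [:b j + real k, 1:] else 1) * shift_poly (b j) (Suc k) (n j)" for j
      using fac[of j k] by auto
    then have "(\<Prod>j=1..r. shift_poly (b j) (if j = h then Suc k else k) (n j)) =
      (\<Prod>j=1..r. if k < n j \<and> j \<noteq> h then [:b j + real k, 1:] else 1) * G k"
      unfolding G_def by (simp only: prod.distrib)
    also have "(\<Prod>j=1..r. if k < n j \<and> j \<noteq> h then [:b j + real k, 1:] else 1) =
       (\<Prod>j\<in>{j\<in>{1..r}. k < n j} - {h}. [:b j + real k, 1:])"
      by (rule prod.mono_neutral_cong_right) auto
    finally show ?thesis by (simp add: mult.commute)
  qed
  have "(\<Sum>k<K. (\<Prod>u<k. P u) * (G k * level_poly B D k)) = 0"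
  proof -
    have ext: "(\<Sum>k<m. g k) = (\<Sum>k<K. if k < m then g k else 0)" if "m \<le> K" for m and g :: "nat \<Rightarrow> real poly"
      using that by (intro sum.mono_neutral_cong_left) auto
    have "0 = (\<Sum>h=1..r. \<Sum>k<n h. smult (x (Inl (h, k))) (mellin_row r s a b n (Inl (h, k)))) +
       (\<Sum>l=1..s. \<Sum>k<\<eta> l. smult (x (Inr (l, k))) (mellin_row r s a b n (Inr (l, k))))"
      using z[symmetric] unfolding sum_slots .
    also have "(\<Sum>h=1..r. \<Sum>k<n h. smult (x (Inl (h, k))) (mellin_row r s a b n (Inl (h, k)))) =
       (\<Sum>h=1..r. \<Sum>k<K. smult (B h k) (mellin_row r s a b n (Inl (h, k))))"
      by (rule sum.cong[OF refl], subst ext[OF nK], assumption, rule sum.cong[OF refl])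
        (simp add: B_def del: mellin_row.simps)
    also have "\<dots> = (\<Sum>k<K. \<Sum>h=1..r. smult (B h k) (mellin_row r s a b n (Inl (h, k))))"
      by (rule sum.swap)
    also have "(\<Sum>l=1..s. \<Sum>k<\<eta> l. smult (x (Inr (l, k))) (mellin_row r s a b n (Inr (l, k)))) =
       (\<Sum>l=1..s. \<Sum>k<K. smult (D l k) (mellin_row r s a b n (Inr (l, k))))"
      by (rule sum.cong[OF refl], subst ext[OF eK], assumption, rule sum.cong[OF refl])
        (simp add: D_def del: mellin_row.simps)
    also have "\<dots> = (\<Sum>k<K. \<Sum>l=1..s. smult (D l k) (mellin_row r s a b n (Inr (l, k))))"
      by (rule sum.swap)
    finally have "0 = (\<Sum>k<K. (\<Sum>h=1..r. smult (B h k) (mellin_row r s a b n (Inl (h, k)))) +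
        (\<Sum>l=1..s. smult (D l k) (mellin_row r s a b n (Inr (l, k)))))"
      by (simp only: sum.distrib)
    also have "\<dots> = (\<Sum>k<K. (\<Prod>u<k. P u) * (G k * level_poly B D k))"
    proof (rule sum.cong[OF refl])
      fix k
      have "(\<Sum>h=1..r. smult (B h k) (mellin_row r s a b n (Inl (h, k)))) =
        (\<Prod>u<k. P u) * (G k * (\<Sum>h=1..r. smult (B h k) (\<Prod>j\<in>{j\<in>{1..r}. k < n j} - {h}. [:b j + real k, 1:])))"
        unfolding sum_distrib_left mellin_row.simps PP
        by (rule sum.cong[OF refl]) (simp only: GB mult_smult_left mult_smult_right)
      moreover have "(\<Sum>l=1..s. smult (D l k) (mellin_row r s a b n (Inr (l, k)))) =
        (\<Prod>u<k. P u) * (G k * ((\<Sum>l=1..s. smult (D l k) ([:real k, 1:] ^ (l - 1))) *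
          (\<Prod>j\<in>{j\<in>{1..r}. k < n j}. [:b j + real k, 1:])))"
        unfolding mellin_row.simps PP GD sum_distrib_right sum_distrib_left
        by (rule sum.cong[OF refl]) (simp add: mult_ac)
      ultimately show "(\<Sum>h=1..r. smult (B h k) (mellin_row r s a b n (Inl (h, k)))) +
        (\<Sum>l=1..s. smult (D l k) (mellin_row r s a b n (Inr (l, k)))) =
        (\<Prod>u<k. P u) * (G k * level_poly B D k)"
        unfolding level_poly_def Let_def by (simp only: distrib_left)
    qed
    finally show ?thesis by simp
  qed
  \<comment> \<open>The factors of \<open>G k\<close> start at u = k + 1, so only coincidences with
    u > k have to be excluded.\<close>
  moreover have "coprime (P k) (G k)" for k
  proof -
    have "coprime [:a \<nu> + real k, 1:] [:b j + real u, 1:]"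
      if "\<nu> \<in> {1..r+s}" "j \<in> {1..r}" "u \<in> {Suc k..<n j}" for \<nu> j u
      using c_index_a_b[of j \<nu> k u] that by (intro coprime_linear_poly) auto
    then show ?thesis
      unfolding P_def G_def shift_poly_def
      by (auto intro!: prod_coprime_left prod_coprime_right)
  qed
  moreover have "degree (level_poly B D k) < degree (P k)" for k
    unfolding P_def using degree_level_poly[OF \<open>s > 0\<close>, of B D k]
    by (subst degree_prod_eq_sum_degree) auto
  ultimately have L: "level_poly B D k = 0" if "k < K" for k
    using triangular_sum_zero[of P G "level_poly B D" K k] that by simp
  show ?thesis
    using i
  proof (cases i)
    case (Inl q)
    obtain h k where q: "q = (h, k)" by force
    from i Inl q have "h \<in> {1..r}" "k < n h" unfolding slots_def by auto
    moreover from this have "k < K" using nK[of h] by linarith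
    ultimately show ?thesis using level_poly_zero(1)[OF L] Inl q by (force simp: B_def)
  next
    case (Inr q)
    obtain l k where q: "q = (l, k)" by force
    from i Inr q have "l \<in> {1..s}" "k < \<eta> l" unfolding slots_def by auto
    moreover from this have "k < K" using eK[of l] by linarith
    ultimately have "D l k = 0" by (intro level_poly_zero(2)[OF L]) (auto simp: B_def)
    with \<open>k < \<eta> l\<close> show ?thesis using Inr q by (simp add: D_def)
  qed
qed

end

text \<open>Dimension count: otherwise T would enlarge the v_i to \<open>card I + 1\<close>
  independent vectors inside the span of \<open>card I\<close> monomials.\<close>

lemma poly_in_span_of_independent:
  fixes v :: "'i \<Rightarrow> real poly"
  assumes fin: "finite I"
    and ind: "\<And>x i. (\<Sum>i\<in>I. smult (x i) (v i)) = 0 \<Longrightarrow> i \<in> I \<Longrightarrow> x i = 0"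
    and deg: "\<And>i. i \<in> I \<Longrightarrow> degree (v i) < card I"
    and T: "degree T < card I"
  shows "\<exists>x. T = (\<Sum>i\<in>I. smult (x i) (v i))"
proof -
  interpret V: vector_space "smult :: real \<Rightarrow> real poly \<Rightarrow> real poly"
    by standard (simp_all add: smult_add_left smult_add_right)
  \<comment> \<open>\<open>V.independent\<close> speaks about sets, the hypothesis about families. A
    repeated vector would give the relation with coefficients 1 and -1.\<close>
  have inj: "inj_on v I"
  proof (rule inj_onI, rule ccontr)
    fix i j assume ij: "i \<in> I" "j \<in> I" "v i = v j" "i \<noteq> j"
    let ?x = "\<lambda>k. if k = i then 1 else if k = j then - 1 else (0::real)"
    have "(\<Sum>k\<in>I. smult (?x k) (v k)) = (\<Sum>k\<in>I. (if k = i then v i else 0) - (if k = j then v j else 0))"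
      using ij by (intro sum.cong) auto
    also have "\<dots> = 0"
      using ij fin by (simp add: sum_subtractf)
    finally have "?x i = 0"
      using ind[of ?x i] ij by blast
    then show False by simp
  qed
  define S where "S = v ` I"
  define M where "M = (monom 1 ` {..<card I} :: real poly set)"
  have S: "finite S" "card S = card I"
    using fin inj by (auto simp: S_def card_image)
  have "V.independent S"
  proof (rule V.independent_if_scalars_zero[OF S(1)])
    fix f x assume "(\<Sum>x\<in>S. smult (f x) x) = 0" and x: "x \<in> S"
    then have "(\<Sum>i\<in>I. smult (f (v i)) (v i)) = 0"
      unfolding S_def by (subst (asm) sum.reindex[OF inj]) (simp add: comp_def)
    then show "f x = 0"
      using ind[of "\<lambda>i. f (v i)"] x unfolding S_def by auto
  qed
  moreover have in_M: "p \<in> V.span M" if "degree p < card I" for p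
  proof -
    have "p = (\<Sum>i<card I. smult (coeff p i) (monom 1 i))"
      using that by (intro poly_eqI) (auto simp: coeff_sum coeff_eq_0 if_distrib cong: if_cong)
    also have "\<dots> \<in> V.span M"
      unfolding M_def by (intro V.span_sum V.span_scale V.span_base) auto
    finally show ?thesis .
  qed
  moreover have "T \<in> V.span S"
  proof (rule ccontr)
    assume T': "T \<notin> V.span S"
    then have "V.independent (insert T S)"
      using \<open>V.independent S\<close> by (simp add: V.independent_insert)
    moreover have "insert T S \<subseteq> V.span M"
      using in_M T deg by (auto simp: S_def)
    ultimately have "card (insert T S) \<le> card M"
      using V.independent_span_bound[of M "insert T S"] by (auto simp: M_def)
    also have "card M \<le> card I"
      unfolding M_def using card_image_le[of "{..<card I}"] by fastforce
    finally have "card (insert T S) \<le> card I" .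
    moreover have "T \<notin> S"
      using T' V.span_base by blast
    ultimately show False
      using S by simp
  qed
  then obtain u where "T = (\<Sum>x\<in>S. smult (u x) x)"
    using V.span_finite[OF S(1)] by auto
  then have "T = (\<Sum>i\<in>I. smult (u (v i)) (v i))"
    unfolding S_def by (subst (asm) sum.reindex[OF inj]) (simp add: comp_def)
  then show ?thesis by (intro exI[of _ "\<lambda>i. u (v i)"])
qed

section \<open>Degrees of the Mellin rows under Laguerre admissibility\<close>

lemma degree_prod_shift_poly: "degree (\<Prod>x\<in>X. shift_poly (c x) (i x) (j x)) = (\<Sum>x\<in>X. j x - i x)"
  by (subst degree_prod_eq_sum_degree) (auto simp: degree_shift_poly)

lemma prod_shift_poly_nonzero: "(\<Prod>x\<in>X. shift_poly (c x) (i x) (j x)) \<noteq> 0"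
  by (cases "finite X") auto

text \<open>The a-factors contribute (r + s) k; each of the r b-factors loses k, and the one with j
  = h one more. Since k \<le> n_j the natural subtractions are exact, and r k cancels.\<close>

lemma degree_mellin_row_Inl:
  assumes "h \<in> {1..r}" "k < n h" "\<forall>j\<in>{1..r}. k \<le> n j"
  shows "degree (mellin_row r s a b n (Inl (h, k))) + 1 = s * k + (\<Sum>j=1..r. n j)"
proof -
  have "(\<Sum>j=1..r. n j) = (\<Sum>j=1..r. (n j - (if j = h then Suc k else k)) + k + (if j = h then 1 else 0))"
    using assms by (intro sum.cong) auto
  also have "\<dots> = (\<Sum>j=1..r. n j - (if j = h then Suc k else k)) + r * k + 1"
    unfolding sum.distrib using assms(1) by simp
  finally show ?thesis
    by (simp add: degree_mult_eq prod_shift_poly_nonzero degree_prod_shift_poly algebra_simps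
        del: One_nat_def)
qed

lemma degree_mellin_row_Inr:
  assumes "l \<ge> 1" "\<forall>j\<in>{1..r}. k \<le> n j"
  shows "degree (mellin_row r s a b n (Inr (l, k))) + 1 = s * k + l + (\<Sum>j=1..r. n j)"
proof -
  have "(\<Sum>j=1..r. n j) = (\<Sum>j=1..r. (n j - k) + k)"
    using assms by (intro sum.cong) auto
  also have "\<dots> = (\<Sum>j=1..r. n j - k) + r * k"
    by (simp add: sum.distrib)
  finally show ?thesis
    using assms
    by (simp add: degree_mult_eq prod_shift_poly_nonzero degree_prod_shift_poly degree_linear_power
        degree_power_eq algebra_simps del: One_nat_def)
qed

context
  fixes r s R :: nat and n \<eta> :: "nat \<Rightarrow> nat"
  assumes adm: "laguerre_admissible r s n \<eta>" and s: "s > 0"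
  defines "R \<equiv> \<Sum>l=1..s. \<eta> l"
begin

lemma admissible_diff:
  assumes "u \<in> n ` {1..r} \<union> \<eta> ` {1..s}" "v \<in> n ` {1..r} \<union> \<eta> ` {1..s}"
  shows "u \<le> v + 1"
  using adm assms unfolding laguerre_admissible_def by blast

lemma admissible_eta:
  assumes "l \<in> {1..s}"
  shows "\<eta> l = (if l \<le> R mod s then R div s + 1 else R div s)"
  using adm assms unfolding laguerre_admissible_def R_def Let_def by blast

lemma admissible_Inl:
  assumes "Inl (h, k) \<in> slots r s n \<eta>"
  shows "h \<in> {1..r}" "k < n h" "\<forall>j\<in>{1..r}. k \<le> n j" "s * k \<le> R"
proof -
  show h: "h \<in> {1..r}" "k < n h"
    using assms unfolding slots_def by auto
  show "\<forall>j\<in>{1..r}. k \<le> n j"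
  proof
    fix j assume "j \<in> {1..r}"
    then show "k \<le> n j"
      using admissible_diff[of "n h" "n j"] h by auto
  qed
  have "s * k = (\<Sum>l=1..s. k)" by simp
  also have "\<dots> \<le> R"
    unfolding R_def
  proof (rule sum_mono)
    fix l assume "l \<in> {1..s}"
    then show "k \<le> \<eta> l"
      using admissible_diff[of "n h" "\<eta> l"] h by auto
  qed
  finally show "s * k \<le> R" .
qed

text \<open>Near-equality of the entries alone would not account for l. The staircase form of \<eta>
  does: \<open>l \<le> R mod s\<close> gives \<open>k \<le> R div s\<close>, and for larger l even
  \<open>k + 1 \<le> R div s\<close>, which leaves room for l \<le> s.\<close>

lemma admissible_Inr:
  assumes "Inr (l, k) \<in> slots r s n \<eta>"
  shows "l \<in> {1..s}" "k < \<eta> l" "\<forall>j\<in>{1..r}. k \<le> n j" "s * k + l \<le> R"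
proof -
  show l: "l \<in> {1..s}" "k < \<eta> l"
    using assms unfolding slots_def by auto
  show "\<forall>j\<in>{1..r}. k \<le> n j"
  proof
    fix j assume "j \<in> {1..r}"
    then show "k \<le> n j"
      using admissible_diff[of "\<eta> l" "n j"] l by auto
  qed
  have R: "R = s * (R div s) + R mod s" by simp
  show "s * k + l \<le> R"
  proof (cases "l \<le> R mod s")
    case True
    then have "k \<le> R div s" using admissible_eta[OF l(1)] l by auto
    then have "s * k \<le> s * (R div s)" by simp
    then show ?thesis using R True by linarith
  next
    case False
    then have "k + 1 \<le> R div s" using admissible_eta[OF l(1)] l by auto
    then have "s * (k + 1) \<le> s * (R div s)" by (rule mult_le_mono2)
    then have "s * k + s \<le> s * (R div s)" by simp
    with R have "s * k + s \<le> R" by linarith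
    then show ?thesis using l by auto
  qed
qed

lemma degree_mellin_row_less:
  assumes "i \<in> slots r s n \<eta>"
  shows "degree (mellin_row r s a b n i) < (\<Sum>h=1..r. n h) + R"
proof (cases i)
  case (Inl q)
  obtain h k where q: "q = (h, k)" by force
  show ?thesis
    using degree_mellin_row_Inl[of h r k n s a b] admissible_Inl[of h k] assms Inl q by force
next
  case (Inr q)
  obtain l k where q: "q = (l, k)" by force
  show ?thesis
    using degree_mellin_row_Inr[of l r k n s a b] admissible_Inr[of l k] assms Inr q by force
qed

text \<open>The slots whose rows reach the maximal degree, described by indices only and hence
  independent of the moving parameters.\<close>

definition top_slot :: "slot \<Rightarrow> bool" where
  "top_slot i = (case i of Inl (h, k) \<Rightarrow> s * k = R | Inr (l, k) \<Rightarrow> s * k + l = R)"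

lemma coeff_mellin_row_top:
  assumes "i \<in> slots r s n \<eta>"
  shows "coeff (mellin_row r s a b n i) ((\<Sum>h=1..r. n h) + R - 1) = (if top_slot i then 1 else 0)"
proof -
  have "top_slot i \<longleftrightarrow> degree (mellin_row r s a b n i) + 1 = (\<Sum>h=1..r. n h) + R"
  proof (cases i)
    case (Inl q)
    obtain h k where q: "q = (h, k)" by force
    show ?thesis
      using degree_mellin_row_Inl[of h r k n s a b] admissible_Inl[of h k] assms Inl q
      by (auto simp: top_slot_def simp del: mellin_row.simps)
  next
    case (Inr q)
    obtain l k where q: "q = (l, k)" by force
    show ?thesis
      using degree_mellin_row_Inr[of l r k n s a b] admissible_Inr[of l k] assms Inr q
      by (auto simp: top_slot_def simp del: mellin_row.simps)
  qed
  then have top: "top_slot i \<longleftrightarrow> degree (mellin_row r s a b n i) = (\<Sum>h=1..r. n h) + R - 1"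
    and le: "degree (mellin_row r s a b n i) \<le> (\<Sum>h=1..r. n h) + R - 1"
    using degree_mellin_row_less[OF assms, of a b] by linarith+
  show ?thesis
  proof (cases "top_slot i")
    case True
    then show ?thesis using lead_coeff_mellin_row[of r s a b n i] top by simp
  next
    case False
    then show ?thesis using top le by (simp add: coeff_eq_0)
  qed
qed

text \<open>R = s k makes every \<eta>_l equal to k, so n_h \<le> k + 1 by near-equality: the slot
  holds the leading coefficient of its component.\<close>

lemma top_slot_Inl:
  assumes "Inl (h, k) \<in> slots r s n \<eta>" "top_slot (Inl (h, k))" "R > s"
  shows "k \<ge> 1" "n h = k + 1"
proof -
  have sk: "s * k = R" using assms(2) by (simp add: top_slot_def)
  then show "k \<ge> 1" using assms(3) by (cases k) auto
  have "R div s = k" "R mod s = 0" using sk s by auto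
  then have "\<eta> s = k" using admissible_eta[of s] s by auto
  then have "n h \<le> k + 1"
    using admissible_diff[of "n h" "\<eta> s"] admissible_Inl(1)[OF assms(1)] s by auto
  then show "n h = k + 1" using admissible_Inl(2)[OF assms(1)] by simp
qed

text \<open>Here R > s is decisive: k = 0 would give R = l \<le> s. Division of R by s gives
  quotient k + 1 and remainder 0 for l = s, and quotient k and remainder l for l < s; both yield
  \<eta>_l = k + 1.\<close>

lemma top_slot_Inr:
  assumes "Inr (l, k) \<in> slots r s n \<eta>" "top_slot (Inr (l, k))" "R > s"
  shows "k \<ge> 1" "\<eta> l = k + 1"
proof -
  have sk: "s * k + l = R" using assms(2) by (simp add: top_slot_def)
  then show "k \<ge> 1" using assms(3) admissible_Inr(1)[OF assms(1)] by (cases k) auto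
  have l: "l \<in> {1..s}" using admissible_Inr(1)[OF assms(1)] .
  show "\<eta> l = k + 1"
  proof (cases "l = s")
    case True
    then have "R = s * (k + 1)" using sk by simp
    then have "R div s = k + 1" "R mod s = 0" using s by auto
    then show ?thesis using admissible_eta[OF l] l by auto
  next
    case False
    then have "R div s = k" "R mod s = l" using sk l by auto
    then show ?thesis using admissible_eta[OF l] by auto
  qed
qed

end

theorem mellin_row_expansion:
  fixes T :: "real poly"
  assumes adm: "laguerre_admissible r s n \<eta>" and s: "s > 0"
    and c: "c_index r s a b n \<noteq> 0"
    and T: "degree T < (\<Sum>h=1..r. n h) + (\<Sum>l=1..s. \<eta> l)"
  shows "\<exists>x. T = (\<Sum>i\<in>slots r s n \<eta>. smult (x i) (mellin_row r s a b n i))"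
proof (rule poly_in_span_of_independent)
  show "degree (mellin_row r s a b n i) < card (slots r s n \<eta>)" if "i \<in> slots r s n \<eta>" for i
    using degree_mellin_row_less[OF adm s that] by (simp add: card_slots)
qed (use mellin_row_independent[OF c s] T in \<open>auto simp: card_slots\<close>)

section \<open>Mellin transforms\<close>

lemma notin_nonpos_Ints_of_Re_pos:
  fixes w :: complex
  assumes "Re w > 0"
  shows "w \<notin> \<int>\<^sub>\<le>\<^sub>0"
  using assms by (auto elim!: nonpos_Ints_cases)

text \<open>Extending x^z by zero turns integrals over the half-line into integrals over the line,
  and using the real logarithm keeps branch cuts out of the product rules.\<close>

definition cpow :: "complex \<Rightarrow> real \<Rightarrow> complex" where
  "cpow z x = (if x > 0 then exp (z * of_real (ln x)) else 0)"

lemma cpow_powr: "x > 0 \<Longrightarrow> cpow z x = of_real x powr z"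
  by (simp add: cpow_def powr_def Ln_of_real)

lemma cpow_nonpos [simp]: "x \<le> 0 \<Longrightarrow> cpow z x = 0"
  by (simp add: cpow_def)

lemma cpow_measurable [measurable]: "cpow z \<in> borel_measurable borel"
  unfolding cpow_def by measurable

lemma cpow_mult: "u > 0 \<Longrightarrow> cpow z (u * y) = cpow z u * cpow z y"
  by (auto simp: cpow_def zero_less_mult_iff ln_mult exp_add[symmetric] algebra_simps)

lemma cpow_add: "cpow (z + w) x = cpow z x * cpow w x"
  by (simp add: cpow_def exp_add algebra_simps)

lemma cpow_of_real: "x > 0 \<Longrightarrow> cpow (of_real c) x = of_real (x powr c)"
  by (simp add: cpow_def powr_def exp_of_real[symmetric])

lemma cpow_of_nat: "x > 0 \<Longrightarrow> cpow (of_nat k) x = of_real (x ^ k)"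
  using cpow_of_real[of x "real k"] by (simp add: powr_realpow)

lemma norm_cpow: "x > 0 \<Longrightarrow> norm (cpow z x) = x powr Re z"
  by (simp add: cpow_def powr_def)

lemma has_mellin_iff:
  "has_mellin f z M \<longleftrightarrow> has_bochner_integral lborel (\<lambda>x. cpow (z - 1) x * of_real (f x)) M"
proof -
  have "(\<lambda>x. indicator {0<..} x *\<^sub>R (complex_of_real x powr (z - 1) * complex_of_real (f x)))
      = (\<lambda>x. cpow (z - 1) x * of_real (f x))"
    by (auto simp: fun_eq_iff indicator_def cpow_powr)
  then show ?thesis
    unfolding has_mellin_def has_bochner_integral_iff set_integrable_def set_lebesgue_integral_def
    by simp
qed

lemma has_bochner_integral_rescale:
  fixes k :: "real \<Rightarrow> 'a :: {banach, second_countable_topology, real_normed_algebra}"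
  assumes "has_bochner_integral lborel \<phi> c" "u > 0" "\<And>y. k (u * y) = m * \<phi> y"
  shows "has_bochner_integral lborel k (u *\<^sub>R (m * c))"
proof -
  have "has_bochner_integral lborel (\<lambda>y. k (0 + u * y)) (m * c)"
    using has_bochner_integral_mult_right[OF assms(1), of m] assms(3) by simp
  then have "has_bochner_integral lborel (\<lambda>y. k (0 + u * y)) ((u *\<^sub>R (m * c)) /\<^sub>R \<bar>u\<bar>)"
    using assms(2) by simp
  then show ?thesis
    using lborel_has_bochner_integral_real_affine_iff[of u k "u *\<^sub>R (m * c)" 0] assms(2) by simp
qed

text \<open>The inner integrals \<open>p\<close> of h and \<open>q\<close> of its norm are given as
  data: in the applications they are constant multiples of a known integrable function or of its
  norm, so integrability on the product reduces to that of \<open>q\<close>.\<close>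

lemma has_bochner_integral_Fubini:
  fixes h :: "real \<Rightarrow> real \<Rightarrow> complex"
  assumes [measurable]: "case_prod h \<in> borel_measurable (lborel \<Otimes>\<^sub>M lborel)"
    and p: "\<And>u. has_bochner_integral lborel (h u) (p u)"
    and q: "\<And>u. has_bochner_integral lborel (\<lambda>x. norm (h u x)) (q u)"
    and I: "has_bochner_integral lborel p I" and Q: "integrable lborel q"
  shows "has_bochner_integral lborel (\<lambda>x. \<integral>u. h u x \<partial>lborel) I"
proof -
  have "integrable (lborel \<Otimes>\<^sub>M lborel) (case_prod h)"
  proof (rule lborel_pair.Fubini_integrable)
    show "integrable lborel (\<lambda>x. LINT y|lborel. norm (case_prod h (x, y)))"
      using Q has_bochner_integral_integral_eq[OF q] by simp
    show "AE x in lborel. integrable lborel (\<lambda>y. case_prod h (x, y))"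
      using p by (auto simp: has_bochner_integral_iff)
  qed measurable
  from lborel_pair.integrable_snd[OF this] lborel_pair.integral_snd[OF this]
    lborel_pair.integral_fst[OF this]
  show ?thesis
    using I has_bochner_integral_integral_eq[OF p] by (simp add: has_bochner_integral_iff)
qed

text \<open>Measurability and vanishing on the nonpositive axis are carried along because the Fubini
  argument for convolutions uses them. \<open>M\<close> is constrained only on the
  half-plane.\<close>

definition mellin_on :: "real \<Rightarrow> (real \<Rightarrow> real) \<Rightarrow> (complex \<Rightarrow> complex) \<Rightarrow> bool" where
  "mellin_on A f M \<longleftrightarrow> f \<in> borel_measurable borel \<and> (\<forall>x\<le>0. f x = 0) \<and>
     (\<forall>z. Re z > A \<longrightarrow> has_mellin f z (M z))"

lemma mellin_onI:
  assumes "f \<in> borel_measurable borel" "\<And>x. x \<le> 0 \<Longrightarrow> f x = 0"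
    "\<And>z. Re z > A \<Longrightarrow> has_bochner_integral lborel (\<lambda>x. cpow (z - 1) x * of_real (f x)) (M z)"
  shows "mellin_on A f M"
  using assms unfolding mellin_on_def has_mellin_iff by auto

lemma mellin_onD:
  assumes "mellin_on A f M"
  shows "f \<in> borel_measurable borel" "\<And>x. x \<le> 0 \<Longrightarrow> f x = 0"
    "\<And>z. Re z > A \<Longrightarrow> has_bochner_integral lborel (\<lambda>x. cpow (z - 1) x * of_real (f x)) (M z)"
  using assms unfolding mellin_on_def has_mellin_iff by auto

lemma mellin_on_cong:
  assumes "mellin_on A f M" "\<And>z. Re z > A \<Longrightarrow> M z = M' z"
  shows "mellin_on A f M'"
  using assms unfolding mellin_on_def by auto

lemma mellin_on_zero: "mellin_on A (\<lambda>_. 0) (\<lambda>_. 0)"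
  by (rule mellin_onI) auto

lemma mellin_on_add:
  assumes "mellin_on A f F" "mellin_on A g G"
  shows "mellin_on A (\<lambda>x. f x + g x) (\<lambda>z. F z + G z)"
  using mellin_onD[OF assms(1)] mellin_onD[OF assms(2)]
  by (intro mellin_onI)
     (auto simp: distrib_left intro!: has_bochner_integral_add borel_measurable_add)

lemma mellin_on_cmult:
  assumes "mellin_on A f F"
  shows "mellin_on A (\<lambda>x. c * f x) (\<lambda>z. of_real c * F z)"
proof (rule mellin_onI)
  show "has_bochner_integral lborel (\<lambda>x. cpow (z - 1) x * of_real (c * f x)) (of_real c * F z)"
    if "Re z > A" for z
    using has_bochner_integral_mult_right[OF mellin_onD(3)[OF assms that], of "of_real c"]
    by (simp add: mult_ac)
qed (use mellin_onD[OF assms] in \<open>auto intro!: borel_measurable_times\<close>)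

lemma mellin_on_sum:
  assumes "\<And>i. i \<in> I \<Longrightarrow> mellin_on A (f i) (F i)"
  shows "mellin_on A (\<lambda>x. \<Sum>i\<in>I. f i x) (\<lambda>z. \<Sum>i\<in>I. F i z)"
  using assms by (induction I rule: infinite_finite_induct)
    (auto intro: mellin_on_zero mellin_on_add)

lemma mellin_on_power:
  assumes "mellin_on A f F"
  shows "mellin_on A (\<lambda>x. x ^ k * f x) (\<lambda>z. F (z + of_nat k))"
proof (rule mellin_onI)
  fix z assume "Re z > A"
  then have "Re (z + of_nat k) > A" by simp
  from mellin_onD(3)[OF assms this]
  have "has_bochner_integral lborel (\<lambda>x. cpow ((z - 1) + of_nat k) x * of_real (f x)) (F (z + of_nat k))"
    by (simp add: algebra_simps)
  also have "(\<lambda>x. cpow ((z - 1) + of_nat k) x * of_real (f x)) =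
      (\<lambda>x. cpow (z - 1) x * of_real (x ^ k * f x))"
  proof
    fix x :: real
    show "cpow ((z - 1) + of_nat k) x * of_real (f x) = cpow (z - 1) x * of_real (x ^ k * f x)"
      by (cases "x > 0") (auto simp: cpow_add cpow_of_nat)
  qed
  finally show "has_bochner_integral lborel (\<lambda>x. cpow (z - 1) x * of_real (x ^ k * f x)) (F (z + of_nat k))" .
qed (use mellin_onD[OF assms] in \<open>auto intro!: borel_measurable_times\<close>)

lemma mconv_eq:
  assumes "\<And>x. x \<le> 0 \<Longrightarrow> f x = 0"
  shows "mconv f g x = (\<integral>u. f u * g (x / u) / u \<partial>lborel)"
  unfolding mconv_def set_lebesgue_integral_def
  by (rule Bochner_Integration.integral_cong) (use assms in \<open>auto simp: indicator_def\<close>)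

text \<open>The substitution x = u y in the inner integral separates the variables, since x^(z-1) =
  u^(z-1) y^(z-1), and the factor 1/u of the convolution cancels the Jacobian.\<close>

lemma mellin_on_mconv:
  assumes f: "mellin_on A f F" and g: "mellin_on A g G"
  shows "mellin_on A (mconv f g) (\<lambda>z. F z * G z)"
proof (rule mellin_onI)
  note [measurable] = mellin_onD(1)[OF f] mellin_onD(1)[OF g]
  have conv: "mconv f g = (\<lambda>x. \<integral>u. f u * g (x / u) / u \<partial>lborel)"
    using mconv_eq mellin_onD(2)[OF f] by blast
  show "mconv f g \<in> borel_measurable borel"
    unfolding conv by measurable
  show "mconv f g x = 0" if "x \<le> 0" for x
  proof -
    have "(\<lambda>u. f u * g (x / u) / u) = (\<lambda>_. 0)"
    proof
      fix u
      show "f u * g (x / u) / u = 0"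
        using mellin_onD(2)[OF f, of u] mellin_onD(2)[OF g, of "x / u"] that
        by (cases "u \<le> 0") (auto simp: divide_le_0_iff)
    qed
    then show ?thesis unfolding conv by simp
  qed
  fix z assume z: "Re z > A"
  note Fz = mellin_onD(3)[OF f z] and Gz = mellin_onD(3)[OF g z]
  have Fn: "integrable lborel (\<lambda>x. norm (cpow (z - 1) x * of_real (f x)))"
    using Fz by (auto simp: has_bochner_integral_iff)
  have "has_bochner_integral lborel (\<lambda>x. norm (cpow (z - 1) x * of_real (g x)))
      (\<integral>x. norm (cpow (z - 1) x * of_real (g x)) \<partial>lborel)"
    using Gz by (auto simp: has_bochner_integral_iff)
  then obtain C where C: "has_bochner_integral lborel (\<lambda>x. norm (cpow (z - 1) x * of_real (g x))) C"
    by blast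
  define h where "h u x = cpow (z - 1) x * of_real (f u * g (x / u) / u)" for u x
  have "has_bochner_integral lborel (\<lambda>x. \<integral>u. h u x \<partial>lborel) (F z * G z)"
  proof (rule has_bochner_integral_Fubini)
    show "case_prod h \<in> borel_measurable (lborel \<Otimes>\<^sub>M lborel)"
      unfolding h_def by measurable
    show "has_bochner_integral lborel (h u) (cpow (z - 1) u * of_real (f u) * G z)" for u
    proof (cases "u > 0")
      case True
      have "has_bochner_integral lborel (h u)
         (u *\<^sub>R ((cpow (z - 1) u * of_real (f u) / of_real u) * G z))"
        by (rule has_bochner_integral_rescale[OF Gz True])
           (unfold h_def cpow_mult[OF True], use True in \<open>simp add: field_simps\<close>)
      then show ?thesis using True by (simp add: scaleR_conv_of_real field_simps)
    next
      case False
      then show ?thesis using mellin_onD(2)[OF f, of u] by (simp add: h_def[abs_def] has_bochner_integral_zero)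
    qed
    show "has_bochner_integral lborel (\<lambda>x. norm (h u x)) (norm (cpow (z - 1) u * of_real (f u)) * C)" for u
    proof (cases "u > 0")
      case True
      have "has_bochner_integral lborel (\<lambda>x. norm (h u x))
         (u *\<^sub>R ((norm (cpow (z - 1) u * of_real (f u)) / u) * C))"
        by (rule has_bochner_integral_rescale[OF C True])
           (unfold h_def cpow_mult[OF True], use True in \<open>simp add: norm_mult norm_divide field_simps\<close>)
      then show ?thesis using True by (simp add: field_simps)
    next
      case False
      then show ?thesis using mellin_onD(2)[OF f, of u] by (simp add: h_def[abs_def] has_bochner_integral_zero)
    qed
    show "has_bochner_integral lborel (\<lambda>u. cpow (z - 1) u * of_real (f u) * G z) (F z * G z)"
      by (intro has_bochner_integral_mult_left Fz)
    show "integrable lborel (\<lambda>u. norm (cpow (z - 1) u * of_real (f u)) * C)"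
      by (intro integrable_mult_left Fn)
  qed
  also have "(\<lambda>x. \<integral>u. h u x \<partial>lborel) = (\<lambda>x. cpow (z - 1) x * of_real (mconv f g x))"
    unfolding h_def conv by (simp only: integral_mult_right_zero integral_complex_of_real)
  finally show "has_bochner_integral lborel (\<lambda>x. cpow (z - 1) x * of_real (mconv f g x)) (F z * G z)" .
qed

section \<open>Gamma and beta integrals as Mellin transforms\<close>

lemma has_bochner_integral_Gamma:
  assumes "Re w > 0"
  shows "has_bochner_integral lborel (\<lambda>x. cpow (w - 1) x * of_real (exp (- x))) (Gamma w)"
proof -
  let ?g = "\<lambda>t. complex_of_real t powr (w - 1) / of_real (exp t)"
  let ?h = "\<lambda>x. cpow (w - 1) x * of_real (exp (- x))"
  have eq: "(\<lambda>x. indicator {0<..} x *\<^sub>R ?g x) = ?h"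
    by (auto simp: fun_eq_iff indicator_def cpow_powr exp_minus divide_inverse exp_of_real)
  have "set_integrable lebesgue {0<..} ?g"
    using absolutely_integrable_Gamma_integral'[OF assms] .
  then have "integrable lebesgue ?h"
    unfolding set_integrable_def eq .
  then have int: "integrable lborel ?h"
    by (subst (asm) integrable_completion) measurable
  then have "set_integrable lborel {0<..} ?g"
    unfolding set_integrable_def eq .
  from set_borel_integral_eq_integral(2)[OF this]
  have "integral\<^sup>L lborel ?h = integral {0<..} ?g"
    unfolding set_lebesgue_integral_def eq .
  also have "\<dots> = Gamma w"
    using Gamma_integral_complex'[OF assms] by (rule integral_unique)
  finally show ?thesis
    using int by (simp add: has_bochner_integral_iff)
qed

lemma gamma_weight_measurable [measurable]: "gamma_weight a \<in> borel_measurable borel"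
  unfolding gamma_weight_def[abs_def] by measurable

lemma jacobi_weight_measurable [measurable]: "jacobi_weight a b \<in> borel_measurable borel"
  unfolding jacobi_weight_def[abs_def] by measurable

lemma mellin_on_gamma_weight:
  assumes "- a \<le> A"
  shows "mellin_on A (gamma_weight a) (\<lambda>z. Gamma (z + of_real a))"
proof (rule mellin_onI)
  fix z assume "Re z > A"
  then have "Re (z + of_real a) > 0" using assms by simp
  from has_bochner_integral_Gamma[OF this]
  have "has_bochner_integral lborel (\<lambda>x. cpow ((z - 1) + of_real a) x * of_real (exp (- x))) (Gamma (z + of_real a))"
    by (simp add: algebra_simps)
  also have "(\<lambda>x. cpow ((z - 1) + of_real a) x * of_real (exp (- x))) =
    (\<lambda>x. cpow (z - 1) x * of_real (gamma_weight a x))"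
  proof
    fix x :: real
    show "cpow ((z - 1) + of_real a) x * of_real (exp (- x)) = cpow (z - 1) x * of_real (gamma_weight a x)"
      by (cases "x > 0") (auto simp: gamma_weight_def cpow_add cpow_of_real)
  qed
  finally show "has_bochner_integral lborel (\<lambda>x. cpow (z - 1) x * of_real (gamma_weight a x)) (Gamma (z + of_real a))" .
qed (auto simp: gamma_weight_def)

text \<open>Integrating the convolution of the two Gamma integrands in both orders avoids nonlinear
  substitutions and analytic continuation in \<open>\<alpha>\<close>.\<close>

lemma Beta_integral_complex:
  assumes "Re \<alpha> > 0" "\<beta> > 0"
  shows "has_bochner_integral lborel (\<lambda>x. cpow (\<alpha> - 1) x * of_real (indicator {0<..<1} x * (1 - x) powr (\<beta> - 1)))
     (Gamma \<alpha> * of_real (Gamma \<beta>) / Gamma (\<alpha> + of_real \<beta>))"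
proof -
  define k where "k x = cpow (\<alpha> - 1) x * of_real (indicator {0<..<1} x * (1 - x) powr (\<beta> - 1))" for x
  have [measurable]: "k \<in> borel_measurable borel"
    unfolding k_def by measurable
  have "integrable lborel k"
  proof (rule Bochner_Integration.integrable_bound)
    show "integrable lborel (\<lambda>x. indicator {0..1} x *\<^sub>R (x powr (Re \<alpha> - 1) * (1 - x) powr (\<beta> - 1)))"
      using integrable_Beta[OF assms] unfolding set_integrable_def .
    show "AE x in lborel. norm (k x) \<le>
        norm (indicator {0..1} x *\<^sub>R (x powr (Re \<alpha> - 1) * (1 - x) powr (\<beta> - 1)))"
      by (auto simp: k_def indicator_def norm_mult norm_cpow)
  qed measurable
  \<comment> \<open>The value of the Beta integral, still unknown: it is found by comparing the two
    iterated integrals.\<close>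
  define J where "J = integral\<^sup>L lborel k"
  have J: "has_bochner_integral lborel k J"
    using \<open>integrable lborel k\<close> by (simp add: J_def has_bochner_integral_iff)
  define G1 where "G1 x = cpow (\<alpha> - 1) x * of_real (exp (- x))" for x
  define G2 where "G2 x = cpow (of_real \<beta> - 1) x * of_real (exp (- x))" for x
  have [measurable]: "G1 \<in> borel_measurable borel" "G2 \<in> borel_measurable borel"
    unfolding G1_def G2_def by measurable
  have G1: "has_bochner_integral lborel G1 (Gamma \<alpha>)"
    unfolding G1_def by (rule has_bochner_integral_Gamma) fact
  have G2: "has_bochner_integral lborel G2 (of_real (Gamma \<beta>))"
    unfolding G2_def Gamma_complex_of_real[symmetric]
    by (rule has_bochner_integral_Gamma) (use assms in simp)
  have G2n: "has_bochner_integral lborel (\<lambda>x. norm (G2 x)) (\<integral>x. norm (G2 x) \<partial>lborel)"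
    using G2 by (auto simp: has_bochner_integral_iff)
  define h where "h t u = G1 t * G2 (u - t)" for t u
  have shift: "has_bochner_integral lborel (\<lambda>u. \<phi> (u - t)) c" if "has_bochner_integral lborel \<phi> c"
    for \<phi> :: "real \<Rightarrow> 'a :: {banach, second_countable_topology}" and c t
    using lborel_has_bochner_integral_real_affine_iff[of 1 \<phi> c "- t"] that by simp
  have "has_bochner_integral lborel (\<lambda>u. \<integral>t. h t u \<partial>lborel) (Gamma \<alpha> * of_real (Gamma \<beta>))"
  proof (rule has_bochner_integral_Fubini)
    show "case_prod h \<in> borel_measurable (lborel \<Otimes>\<^sub>M lborel)"
      unfolding h_def by measurable
    show "has_bochner_integral lborel (h t) (G1 t * of_real (Gamma \<beta>))" for t
      unfolding h_def by (intro has_bochner_integral_mult_right shift G2)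
    show "has_bochner_integral lborel (\<lambda>u. norm (h t u)) (norm (G1 t) * (\<integral>x. norm (G2 x) \<partial>lborel))" for t
      unfolding h_def norm_mult by (intro has_bochner_integral_mult_right shift G2n)
    show "has_bochner_integral lborel (\<lambda>t. G1 t * of_real (Gamma \<beta>)) (Gamma \<alpha> * of_real (Gamma \<beta>))"
      by (intro has_bochner_integral_mult_left G1)
    show "integrable lborel (\<lambda>t. norm (G1 t) * (\<integral>x. norm (G2 x) \<partial>lborel))"
      using G1 by (auto simp: has_bochner_integral_iff)
  qed
  \<comment> \<open>For u > 0 and t = u y the two exponentials combine to exp(-u), free of y, and
    the powers of u leave u^(\<alpha>+\<beta>-1) J exp(-u).\<close>
  also have "(\<lambda>u. \<integral>t. h t u \<partial>lborel) = (\<lambda>u. cpow ((\<alpha> + of_real \<beta>) - 1) u * of_real (exp (- u)) * J)"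
  proof
    fix u :: real
    show "(\<integral>t. h t u \<partial>lborel) = cpow ((\<alpha> + of_real \<beta>) - 1) u * of_real (exp (- u)) * J"
    proof (cases "u > 0")
      case True
      have "has_bochner_integral lborel (\<lambda>t. h t u)
        (u *\<^sub>R ((cpow (\<alpha> - 1) u * cpow (of_real \<beta> - 1) u * of_real (exp (- u))) * J))"
      proof (rule has_bochner_integral_rescale[OF J True])
        fix y :: real
        show "h (u * y) u = cpow (\<alpha> - 1) u * cpow (of_real \<beta> - 1) u * of_real (exp (- u)) * k y"
        proof (cases "0 < y \<and> y < 1")
          case y: True
          have "G2 (u - u * y) = cpow (of_real \<beta> - 1) (u * (1 - y)) * of_real (exp (- (u - u * y)))"
            by (simp add: G2_def algebra_simps)
          also have "cpow (of_real \<beta> - 1) (u * (1 - y)) = cpow (of_real \<beta> - 1) u * of_real ((1 - y) powr (\<beta> - 1))"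
            using cpow_mult[OF True] cpow_of_real[of "1 - y" "\<beta> - 1"] y by simp
          finally show ?thesis
            using y cpow_mult[OF True, of "\<alpha> - 1" y]
            by (simp add: h_def k_def G1_def exp_add[symmetric] exp_diff exp_minus field_simps)
        next
          case False
          then have "u * y \<le> 0 \<or> u - u * y \<le> 0"
            using True by (auto simp: mult_le_0_iff not_less)
          then have "h (u * y) u = 0" by (auto simp: h_def G1_def G2_def)
          then show ?thesis using False by (auto simp: k_def)
        qed
      qed
      then have "(\<integral>t. h t u \<partial>lborel) = of_real u * (cpow (\<alpha> - 1) u * cpow (of_real \<beta> - 1) u) * of_real (exp (- u)) * J"
        by (simp add: has_bochner_integral_iff scaleR_conv_of_real mult_ac)
      also have "of_real u * (cpow (\<alpha> - 1) u * cpow (of_real \<beta> - 1) u) = cpow ((\<alpha> + of_real \<beta>) - 1) u"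
        using cpow_add[of 1 "\<alpha> - 1 + (of_real \<beta> - 1)" u] cpow_add[of "\<alpha> - 1" "of_real \<beta> - 1" u]
          cpow_of_nat[OF True, of 1] by (simp add: algebra_simps)
      finally show ?thesis .
    next
      case False
      then have "h t u = 0" for t
        by (cases "t > 0") (auto simp: h_def G1_def G2_def)
      then show ?thesis using False by simp
    qed
  qed
  finally have "has_bochner_integral lborel (\<lambda>u. cpow ((\<alpha> + of_real \<beta>) - 1) u * of_real (exp (- u)) * J)
    (Gamma \<alpha> * of_real (Gamma \<beta>))" .
  moreover have "has_bochner_integral lborel (\<lambda>u. cpow ((\<alpha> + of_real \<beta>) - 1) u * of_real (exp (- u)) * J)
    (Gamma (\<alpha> + of_real \<beta>) * J)"
    by (intro has_bochner_integral_mult_left has_bochner_integral_Gamma) (use assms in simp)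
  ultimately have "Gamma \<alpha> * of_real (Gamma \<beta>) = Gamma (\<alpha> + of_real \<beta>) * J"
    by (rule has_bochner_integral_eq)
  moreover have "Gamma (\<alpha> + of_real \<beta>) \<noteq> 0"
    using assms by (intro Gamma_nonzero notin_nonpos_Ints_of_Re_pos) simp
  ultimately have "J = Gamma \<alpha> * of_real (Gamma \<beta>) / Gamma (\<alpha> + of_real \<beta>)"
    by (simp add: field_simps)
  then show ?thesis using J unfolding k_def by simp
qed

lemma mellin_on_jacobi_weight:
  assumes "- a \<le> A" "a < b"
  shows "mellin_on A (jacobi_weight a b) (\<lambda>z. Gamma (z + of_real a) / Gamma (z + of_real b))"
proof (rule mellin_onI)
  fix z assume "Re z > A"
  then have 1: "Re (z + of_real a) > 0" and 2: "b - a > 0" using assms by auto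
  have G: "complex_of_real (Gamma (b - a)) \<noteq> 0"
    using Gamma_real_pos[OF 2] by simp
  have "has_bochner_integral lborel (\<lambda>x. cpow ((z + of_real a) - 1) x *
      of_real (indicator {0<..<1} x * (1 - x) powr ((b - a) - 1)) * (1 / of_real (Gamma (b - a))))
     (Gamma (z + of_real a) * of_real (Gamma (b - a)) / Gamma ((z + of_real a) + of_real (b - a)) *
       (1 / of_real (Gamma (b - a))))"
    by (intro has_bochner_integral_mult_left Beta_integral_complex 1 2)
  also have "Gamma (z + of_real a) * of_real (Gamma (b - a)) / Gamma ((z + of_real a) + of_real (b - a)) *
       (1 / of_real (Gamma (b - a))) = Gamma (z + of_real a) / Gamma (z + of_real b)"
    using G by simp
  also have "(\<lambda>x. cpow ((z + of_real a) - 1) x *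
      of_real (indicator {0<..<1} x * (1 - x) powr ((b - a) - 1)) * (1 / of_real (Gamma (b - a)))) =
      (\<lambda>x. cpow (z - 1) x * of_real (jacobi_weight a b x))"
  proof
    fix x :: real
    have "cpow ((z + of_real a) - 1) x = cpow (z - 1) x * cpow (of_real a) x"
      unfolding cpow_add[symmetric] by (simp add: algebra_simps)
    then show "cpow ((z + of_real a) - 1) x *
      of_real (indicator {0<..<1} x * (1 - x) powr ((b - a) - 1)) * (1 / of_real (Gamma (b - a))) =
      cpow (z - 1) x * of_real (jacobi_weight a b x)"
      by (cases "x > 0") (auto simp: jacobi_weight_def cpow_of_real indicator_def)
  qed
  finally show "has_bochner_integral lborel (\<lambda>x. cpow (z - 1) x * of_real (jacobi_weight a b x))
     (Gamma (z + of_real a) / Gamma (z + of_real b))" .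
qed (auto simp: jacobi_weight_def)

section \<open>Injectivity of the Mellin transform\<close>

text \<open>After the substitution \<open>y = ln x\<close> this is the uniqueness theorem for characteristic functions.\<close>

lemma AE_eq_of_cpow_integrals:
  fixes \<phi> \<psi> :: "real \<Rightarrow> real"
  assumes \<phi>: "integrable lborel \<phi>" "\<And>x. 0 \<le> \<phi> x" "\<And>x. x \<le> 0 \<Longrightarrow> \<phi> x = 0"
    and \<psi>: "integrable lborel \<psi>" "\<And>x. 0 \<le> \<psi> x" "\<And>x. x \<le> 0 \<Longrightarrow> \<psi> x = 0"
    and eq: "\<And>t. (\<integral>x. cpow (\<i> * of_real t) x * of_real (\<phi> x) \<partial>lborel) =
                  (\<integral>x. cpow (\<i> * of_real t) x * of_real (\<psi> x) \<partial>lborel)"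
  shows "AE x in lborel. \<phi> x = \<psi> x"
proof -
  define c where "c = integral\<^sup>L lborel \<phi>"
  have mass: "(\<integral>x. cpow (\<i> * of_real 0) x * of_real (g x) \<partial>lborel) = complex_of_real (integral\<^sup>L lborel g)"
    if "\<And>x. x \<le> 0 \<Longrightarrow> g x = 0" for g
  proof -
    have "(\<lambda>x. cpow (\<i> * of_real 0) x * of_real (g x)) = (\<lambda>x. complex_of_real (g x))"
    proof
      fix x show "cpow (\<i> * of_real 0) x * of_real (g x) = complex_of_real (g x)"
        using that[of x] by (cases "x > 0") (auto simp: cpow_def)
    qed
    then show ?thesis by simp
  qed
  have "complex_of_real (integral\<^sup>L lborel \<phi>) = complex_of_real (integral\<^sup>L lborel \<psi>)"
    by (rule box_equals[OF eq[of 0] mass mass]) (use \<phi>(3) \<psi>(3) in auto)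
  then have c': "integral\<^sup>L lborel \<psi> = c"
    unfolding c_def by simp
  have c0: "c \<ge> 0" unfolding c_def using \<phi> by simp
  show ?thesis
  proof (cases "c = 0")
    \<comment> \<open>Without mass nothing can be normalised to a probability measure, but then both
      nonnegative functions vanish almost everywhere.\<close>
    case True
    have "AE x in lborel. \<phi> x = 0"
      using integral_nonneg_eq_0_iff_AE[OF \<phi>(1)] \<phi>(2) True c_def by simp
    moreover have "AE x in lborel. \<psi> x = 0"
      using integral_nonneg_eq_0_iff_AE[OF \<psi>(1)] \<psi>(2) True c' by simp
    ultimately show ?thesis by eventually_elim simp
  next
    case False
    with c0 have c: "c > 0" by simp
    define D where "D g = density lborel (\<lambda>x. ennreal (g x / c))" for g :: "real \<Rightarrow> real"
    define P where "P g \<longleftrightarrow> integrable lborel g \<and> (\<forall>x. 0 \<le> g x) \<and> (\<forall>x\<le>0. g x = 0) \<and> integral\<^sup>L lborel g = c"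
      for g :: "real \<Rightarrow> real"
    have P: "P \<phi>" "P \<psi>"
      using \<phi> \<psi> c' by (auto simp: P_def c_def)
    have meas: "g \<in> borel_measurable borel" if "P g" for g
      using that by (auto simp: P_def dest: borel_measurable_integrable)
    have dist: "real_distribution (distr (D g) borel ln)" if "P g" for g
    proof -
      note [measurable] = meas[OF that]
      have "emeasure (D g) (space (D g)) = (\<integral>\<^sup>+x. ennreal (g x / c) \<partial>lborel)"
        unfolding D_def by (subst emeasure_density) auto
      also have "\<dots> = ennreal (\<integral>x. g x / c \<partial>lborel)"
        using that c by (intro nn_integral_eq_integral) (auto simp: P_def)
      also have "\<dots> = 1"
        using that c by (simp add: P_def)
      finally interpret prob_space "D g" by (rule prob_spaceI)
      show ?thesis
        by (rule real_distribution_distr) (auto simp: D_def)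
    qed
    have char: "char (distr (D g) borel ln) t = (\<integral>x. cpow (\<i> * of_real t) x * of_real (g x) \<partial>lborel) / of_real c"
      if "P g" for g t
    proof -
      note [measurable] = meas[OF that]
      have "char (distr (D g) borel ln) t = (\<integral>x. iexp (t * ln x) \<partial>D g)"
        unfolding char_def by (subst integral_distr) (auto simp: D_def)
      also have "\<dots> = (\<integral>x. (g x / c) *\<^sub>R iexp (t * ln x) \<partial>lborel)"
        unfolding D_def using that c by (subst integral_density) (auto simp: P_def)
      also have "\<dots> = (\<integral>x. (cpow (\<i> * of_real t) x * of_real (g x)) / of_real c \<partial>lborel)"
      proof (rule Bochner_Integration.integral_cong[OF refl])
        fix x
        show "(g x / c) *\<^sub>R iexp (t * ln x) = (cpow (\<i> * of_real t) x * of_real (g x)) / of_real c"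
          using that c by (cases "x > 0") (auto simp: cpow_def P_def scaleR_conv_of_real mult_ac)
      qed
      finally show ?thesis by simp
    qed
    have "distr (D \<phi>) borel ln = distr (D \<psi>) borel ln"
      using P eq by (intro Levy_uniqueness dist) (auto simp: char fun_eq_iff)
    \<comment> \<open>\<open>D g\<close> is recovered from its image under \<open>ln\<close> by
      pulling back along \<open>exp\<close>: the density vanishes for x \<le> 0, so
      \<open>exp (ln x) = x\<close> wherever it counts.\<close>
    have em: "emeasure (D g) X = emeasure (distr (D g) borel ln) (exp -` X)" if "P g" "X \<in> sets borel" for g X
    proof -
      note [measurable] = meas[OF that(1)] that(2)
      have "exp -` X \<inter> space borel \<in> sets borel" by measurable
      then have eX[measurable]: "exp -` X \<in> sets (borel :: real measure)" by simp
      have "ln -` exp -` X \<inter> space borel \<in> sets (borel :: real measure)"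
        by (rule measurable_sets[of ln borel borel]) (use eX in simp_all)
      then have [measurable]: "{x. exp (ln x) \<in> X} \<in> sets (borel :: real measure)"
        by (simp add: vimage_def)
      have "emeasure (distr (D g) borel ln) (exp -` X) = emeasure (D g) {x. exp (ln x) \<in> X}"
        by (subst emeasure_distr) (auto simp: D_def vimage_def)
      also have "\<dots> = (\<integral>\<^sup>+x. ennreal (g x / c) * indicator {x. exp (ln x) \<in> X} x \<partial>lborel)"
        unfolding D_def by (subst emeasure_density) auto
      also have "\<dots> = (\<integral>\<^sup>+x. ennreal (g x / c) * indicator X x \<partial>lborel)"
      proof (rule nn_integral_cong)
        fix x
        show "ennreal (g x / c) * indicator {x. exp (ln x) \<in> X} x = ennreal (g x / c) * indicator X x"
          using that by (cases "x > 0") (auto simp: P_def indicator_def)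
      qed
      also have "\<dots> = emeasure (D g) X"
        unfolding D_def by (subst emeasure_density) auto
      finally show ?thesis by simp
    qed
    have "D \<phi> = D \<psi>"
    proof (rule measure_eqI)
      show "emeasure (D \<phi>) X = emeasure (D \<psi>) X" if "X \<in> sets (D \<phi>)" for X
        using that em[OF P(1), of X] em[OF P(2), of X] \<open>distr (D \<phi>) borel ln = distr (D \<psi>) borel ln\<close>
        by (simp add: D_def)
    qed (simp add: D_def)
    then have "AE x in lborel. ennreal (\<phi> x / c) = ennreal (\<psi> x / c)"
      unfolding D_def using P \<phi>(1) \<psi>(1)
      by (intro sigma_finite_measure.density_unique sigma_finite_lborel) auto
    then show ?thesis
      by eventually_elim (use c \<phi>(2) \<psi>(2) in \<open>auto simp: ennreal_inj divide_nonneg_pos\<close>)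
  qed
qed

text \<open>The set of positive x with f x \<noteq> 0 is open and null, hence empty. This upgrades
  almost everywhere statements to every point.\<close>

lemma continuous_AE_zero:
  fixes f :: "real \<Rightarrow> real"
  assumes cont: "continuous_on {0<..} f" and AE: "AE x in lborel. x > 0 \<longrightarrow> f x = 0" and "x > 0"
  shows "f x = 0"
proof -
  define S where "S = {x\<in>{0<..}. f x \<noteq> 0}"
  have "S = {0<..} \<inter> f -` (- {0})" unfolding S_def by auto
  then have "open S"
    using continuous_open_preimage[OF cont, of "- {0}"] by auto
  then have [measurable]: "S \<in> sets borel" by auto
  have "AE x in lborel. x \<notin> S"
    using AE by eventually_elim (auto simp: S_def)
  then have "S \<in> null_sets lborel"
    by (subst AE_iff_null_sets) auto
  then have "negligible S"
    by (simp add: negligible_iff_null_sets null_sets_completionI)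
  then have "S = {}"
    using open_not_negligible[OF \<open>open S\<close>] by blast
  then show ?thesis using \<open>x > 0\<close> unfolding S_def by auto
qed

text \<open>One vertical line suffices: for Re z = A + 1 the kernel is x^A x^(it). The positive and
  negative parts of x^A f(x) are integrable with equal transforms, so the uniqueness result for
  nonnegative functions applies to them.\<close>

theorem mellin_injective:
  assumes f: "mellin_on A f (\<lambda>_. 0)" and cont: "continuous_on {0<..} f" and "x > 0"
  shows "f x = 0"
proof (rule continuous_AE_zero[OF cont _ \<open>x > 0\<close>])
  note [measurable] = mellin_onD(1)[OF f]
  define p where "p x = indicator {0<..} x * x powr A * max 0 (f x)" for x
  define n where "n x = indicator {0<..} x * x powr A * max 0 (- f x)" for x
  have pn: "p x - n x = indicator {0<..} x * x powr A * f x" for x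
    unfolding p_def n_def by (auto simp: max_def algebra_simps)
  have hbi: "has_bochner_integral lborel (\<lambda>x. cpow (\<i> * of_real t) x * of_real (p x - n x)) 0" for t
  proof -
    have "has_bochner_integral lborel (\<lambda>x. cpow ((of_real (A + 1) + \<i> * of_real t) - 1) x * of_real (f x)) 0"
      using mellin_onD(3)[OF f, of "of_real (A + 1) + \<i> * of_real t"] by simp
    also have "(\<lambda>x. cpow ((of_real (A + 1) + \<i> * of_real t) - 1) x * of_real (f x)) =
       (\<lambda>x. cpow (\<i> * of_real t) x * of_real (p x - n x))"
    proof
      fix x :: real
      have "cpow ((of_real (A + 1) + \<i> * of_real t) - 1) x = cpow (\<i> * of_real t) x * cpow (of_real A) x"
        unfolding cpow_add[symmetric] by (simp add: algebra_simps)
      then show "cpow ((of_real (A + 1) + \<i> * of_real t) - 1) x * of_real (f x) =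
         cpow (\<i> * of_real t) x * of_real (p x - n x)"
        unfolding pn by (cases "x > 0") (auto simp: cpow_of_real)
    qed
    finally show ?thesis .
  qed
  have cn: "norm (cpow (\<i> * of_real t) x * of_real (g x)) = norm (g x)" if "x > 0" for x t and g :: "real \<Rightarrow> real"
    using that by (simp add: norm_mult norm_cpow)
  have "integrable lborel (\<lambda>x. cpow (\<i> * of_real 0) x * of_real (p x - n x))"
    using hbi[of 0] by (auto simp: has_bochner_integral_iff)
  then have ip: "integrable lborel p" and in': "integrable lborel n"
  proof -
    assume I: "integrable lborel (\<lambda>x. cpow (\<i> * of_real 0) x * of_real (p x - n x))"
    show "integrable lborel p"
    proof (rule Bochner_Integration.integrable_bound[OF I])
      show "AE x in lborel. norm (p x) \<le> norm (cpow (\<i> * of_real 0) x * of_real (p x - n x))"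
      proof (rule AE_I2)
        fix x
        show "norm (p x) \<le> norm (cpow (\<i> * of_real 0) x * of_real (p x - n x))"
          using cn[of x 0 "\<lambda>x. p x - n x"]
          by (cases "x > 0") (auto simp: p_def n_def max_def)
      qed
    qed (unfold p_def, measurable)
    show "integrable lborel n"
    proof (rule Bochner_Integration.integrable_bound[OF I])
      show "AE x in lborel. norm (n x) \<le> norm (cpow (\<i> * of_real 0) x * of_real (p x - n x))"
      proof (rule AE_I2)
        fix x
        show "norm (n x) \<le> norm (cpow (\<i> * of_real 0) x * of_real (p x - n x))"
          using cn[of x 0 "\<lambda>x. p x - n x"]
          by (cases "x > 0") (auto simp: p_def n_def max_def)
      qed
    qed (unfold n_def, measurable)
  qed
  have int: "integrable lborel (\<lambda>x. cpow (\<i> * of_real t) x * of_real (g x))"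
    if "integrable lborel g" for t and g :: "real \<Rightarrow> real"
  proof (rule Bochner_Integration.integrable_bound[OF that])
    show "AE x in lborel. norm (cpow (\<i> * of_real t) x * of_real (g x)) \<le> norm (g x)"
    proof (rule AE_I2)
      fix x
      show "norm (cpow (\<i> * of_real t) x * of_real (g x)) \<le> norm (g x)"
        using cn[of x t g] by (cases "x > 0") auto
    qed
    show "(\<lambda>x. cpow (\<i> * of_real t) x * of_real (g x)) \<in> borel_measurable lborel"
      using borel_measurable_integrable[OF that] by measurable
  qed
  have "AE x in lborel. p x = n x"
  proof (rule AE_eq_of_cpow_integrals)
    fix t
    have "(\<integral>x. cpow (\<i> * of_real t) x * of_real (p x) \<partial>lborel) - (\<integral>x. cpow (\<i> * of_real t) x * of_real (n x) \<partial>lborel)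
      = (\<integral>x. cpow (\<i> * of_real t) x * of_real (p x - n x) \<partial>lborel)"
      using int[OF ip, of t] int[OF in', of t]
      by (subst Bochner_Integration.integral_diff[symmetric]) (auto simp: algebra_simps)
    also have "\<dots> = 0"
      using hbi[of t] by (simp add: has_bochner_integral_iff)
    finally show "(\<integral>x. cpow (\<i> * of_real t) x * of_real (p x) \<partial>lborel) =
       (\<integral>x. cpow (\<i> * of_real t) x * of_real (n x) \<partial>lborel)" by simp
  qed (rule ip in' | simp add: p_def n_def)+
  then show "AE x in lborel. x > 0 \<longrightarrow> f x = 0"
  proof eventually_elim
    fix x assume "p x = n x"
    then show "x > 0 \<longrightarrow> f x = 0"
      using pn[of x] by auto
  qed
qed

section \<open>Smoothness of Mellin convolutions with gamma weights\<close>

text \<open>The Taylor remainder is at most w^2 exp |w| / 2, and |w| \<le> v/2 costs only half of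
  the decay of exp(-v).\<close>

lemma exp_remainder_bound:
  fixes v w :: real
  assumes "\<bar>w\<bar> \<le> v / 2"
  shows "\<bar>exp (- v) * (exp w - 1 - w)\<bar> \<le> w\<^sup>2 * exp (- (v / 2))"
proof -
  obtain t where t: "\<bar>t\<bar> \<le> \<bar>w\<bar>" "exp w = (\<Sum>m<2. w ^ m / fact m) + exp t / fact 2 * w ^ 2"
    using Maclaurin_exp_le[of w 2] by blast
  have "exp w - 1 - w = exp t / 2 * w\<^sup>2"
    using t(2) by (simp add: numeral_2_eq_2)
  moreover have "exp (- v) * exp t = exp (t - v)"
    by (simp add: exp_add[symmetric])
  ultimately have "exp (- v) * (exp w - 1 - w) = exp (t - v) / 2 * w\<^sup>2"
    by (metis mult.assoc times_divide_eq_right)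
  then have "\<bar>exp (- v) * (exp w - 1 - w)\<bar> = exp (t - v) / 2 * w\<^sup>2"
    by (simp only: abs_of_nonneg zero_le_mult_iff zero_le_divide_iff exp_ge_zero zero_le_power2 zero_le_numeral simp_thms)
  also have "\<dots> \<le> exp (- (v / 2)) * w\<^sup>2"
  proof (rule mult_right_mono)
    have "exp (t - v) \<le> exp (- (v / 2))" using t(1) assms by simp
    then show "exp (t - v) / 2 \<le> exp (- (v / 2))"
      using exp_gt_zero[of "- (v/2)"] by linarith
  qed simp
  finally show ?thesis by (simp add: mult.commute)
qed

text \<open>Differentiation under the integral by a direct estimate: the remainder bound with v =
  x/u and w = -h/u makes the error of the linear approximation at most h^2 C. The constant C
  involves k u / u^2, whence the integrability up to i = 2.\<close>

lemma has_real_derivative_exp_kernel: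
  fixes k :: "real \<Rightarrow> real"
  assumes zero: "\<And>u. u \<le> 0 \<Longrightarrow> k u = 0"
    and int: "\<And>y i. y > 0 \<Longrightarrow> i \<le> 2 \<Longrightarrow> integrable lborel (\<lambda>u. k u / u ^ i * exp (- (y / u)))"
    and x: "x > 0"
  shows "((\<lambda>x. \<integral>u. k u * exp (- (x / u)) \<partial>lborel) has_real_derivative
           - (\<integral>u. k u / u * exp (- (x / u)) \<partial>lborel)) (at x)"
proof -
  define L where "L x = (\<integral>u. k u * exp (- (x / u)) \<partial>lborel)" for x
  define D where "D = - (\<integral>u. k u / u * exp (- (x / u)) \<partial>lborel)"
  define C where "C = (\<integral>u. \<bar>k u / u ^ 2 * exp (- ((x / 2) / u))\<bar> \<partial>lborel)"
  have i0: "integrable lborel (\<lambda>u. k u * exp (- (y / u)))" if "y > 0" for y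
    using int[OF that, of 0] by simp
  have i1: "integrable lborel (\<lambda>u. k u / u * exp (- (x / u)))"
    using int[OF x, of 1] by simp
  have i2: "integrable lborel (\<lambda>u. \<bar>k u / u ^ 2 * exp (- ((x / 2) / u))\<bar>)"
    using int[of "x / 2" 2] x by (intro integrable_abs) simp
  \<comment> \<open>|h| < x/2 gives the condition |w| \<le> v/2 of the remainder bound, and keeps x
    + h positive.\<close>
  have bound: "\<bar>L (x + h) - L x - h * D\<bar> \<le> h\<^sup>2 * C" if h: "\<bar>h\<bar> < x / 2" for h
  proof -
    have "x + h > 0" using h by linarith
    have "\<bar>L (x + h) - L x - h * D\<bar> =
       \<bar>\<integral>u. k u * exp (- ((x + h) / u)) - k u * exp (- (x / u)) + h * (k u / u * exp (- (x / u))) \<partial>lborel\<bar>"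
    proof -
      have "has_bochner_integral lborel
          (\<lambda>u. k u * exp (- ((x + h) / u)) - k u * exp (- (x / u)) + h * (k u / u * exp (- (x / u))))
          (L (x + h) - L x + h * (- D))"
        using i0[OF \<open>x + h > 0\<close>] i0[OF x] i1
        by (intro has_bochner_integral_add has_bochner_integral_diff has_bochner_integral_mult_right)
           (auto simp: has_bochner_integral_iff L_def D_def)
      from has_bochner_integral_integral_eq[OF this] show ?thesis by simp
    qed
    also have "\<dots> \<le> (\<integral>u. h\<^sup>2 * \<bar>k u / u ^ 2 * exp (- ((x / 2) / u))\<bar> \<partial>lborel)"
      unfolding real_norm_def[symmetric]
    proof (rule Bochner_Integration.integral_norm_bound_integral)
      show "integrable lborel (\<lambda>u. k u * exp (- ((x + h) / u)) - k u * exp (- (x / u)) + h * (k u / u * exp (- (x / u))))"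
        by (intro Bochner_Integration.integrable_add Bochner_Integration.integrable_diff integrable_mult_right
            i0[OF \<open>x + h > 0\<close>] i0[OF x] i1)
      show "integrable lborel (\<lambda>u. h\<^sup>2 * norm (k u / u ^ 2 * exp (- ((x / 2) / u))))"
        unfolding real_norm_def by (intro integrable_mult_right i2)
      fix u :: real
      show "norm (k u * exp (- ((x + h) / u)) - k u * exp (- (x / u)) + h * (k u / u * exp (- (x / u))))
         \<le> h\<^sup>2 * norm (k u / u ^ 2 * exp (- ((x / 2) / u)))"
      proof (cases "u > 0")
        case True
        have "\<bar>- h / u\<bar> \<le> (x / u) / 2"
          using True h by (simp add: abs_mult field_simps)
        from exp_remainder_bound[OF this]
        have "\<bar>k u\<bar> * \<bar>exp (- (x / u)) * (exp (- h / u) - 1 - (- h / u))\<bar> \<le>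
          \<bar>k u\<bar> * ((- h / u)\<^sup>2 * exp (- (x / u / 2)))"
          by (rule mult_left_mono) simp
        moreover have "exp (- ((x + h) / u)) = exp (- (x / u)) * exp (- h / u)"
          by (simp add: exp_add[symmetric] add_divide_distrib)
        then have "k u * exp (- ((x + h) / u)) - k u * exp (- (x / u)) + h * (k u / u * exp (- (x / u)))
           = k u * (exp (- (x / u)) * (exp (- h / u) - 1 - (- h / u)))"
          by (simp add: algebra_simps)
        moreover have "h\<^sup>2 * norm (k u / u ^ 2 * exp (- ((x / 2) / u))) = \<bar>k u\<bar> * ((- h / u)\<^sup>2 * exp (- (x / u / 2)))"
          using True by (simp add: abs_mult power_divide field_simps)
        ultimately show ?thesis by (simp add: abs_mult)
      qed (use zero in auto)
    qed
    also have "\<dots> = h\<^sup>2 * C"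
      unfolding C_def by (rule integral_mult_right_zero)
    finally show ?thesis .
  qed
  have "((\<lambda>h. (L (x + h) - L x) / h - D) \<longlongrightarrow> 0) (at 0)"
  proof (rule Lim_null_comparison)
    show "\<forall>\<^sub>F h in at 0. norm ((L (x + h) - L x) / h - D) \<le> \<bar>h\<bar> * C"
      unfolding eventually_at
    proof (intro exI[of _ "x / 2"] conjI ballI impI)
      fix h :: real assume h: "h \<noteq> 0 \<and> dist h 0 < x / 2"
      then have "\<bar>(L (x + h) - L x) / h - D\<bar> = \<bar>L (x + h) - L x - h * D\<bar> / \<bar>h\<bar>"
        by (simp add: diff_divide_distrib flip: abs_divide)
      also have "\<dots> \<le> h\<^sup>2 * C / \<bar>h\<bar>"
        using bound[of h] h by (intro divide_right_mono) auto
      also have "\<dots> = \<bar>h\<bar> * C"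
        using h by (simp add: power2_eq_square field_simps abs_if)
      finally show "norm ((L (x + h) - L x) / h - D) \<le> \<bar>h\<bar> * C" by simp
    qed (use x in simp)
    show "((\<lambda>h. \<bar>h\<bar> * C) \<longlongrightarrow> 0) (at 0)"
      by (auto intro!: tendsto_eq_intros)
  qed
  then have "((\<lambda>h. (L (x + h) - L x) / h) \<longlongrightarrow> D) (at 0)"
    by (rule LIM_zero_cancel)
  then show ?thesis
    unfolding DERIV_def L_def D_def .
qed

text \<open>The right-hand side is the maximum over u, attained at u = y / m; it comes from ln t
  \<le> t - 1 with t = y / (u m).\<close>

lemma powr_mult_exp_bounded:
  fixes m y u :: real
  assumes "m > 0" "y > 0" "u > 0"
  shows "u powr (- m) * exp (- (y / u)) \<le> exp (m * ln (m / y) - m)"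
proof -
  have "ln ((y / u) / m) \<le> (y / u) / m - 1"
    using assms by (intro ln_le_minus_one) simp
  then have "m * (ln y - ln u - ln m) \<le> m * ((y / u) / m - 1)"
    using assms by (intro mult_left_mono) (auto simp: ln_div ln_mult)
  then have "- m * ln u - y / u \<le> m * (ln m - ln y) - m"
    using assms by (simp add: algebra_simps)
  then show ?thesis
    using assms by (simp add: powr_def exp_add[symmetric] exp_diff[symmetric] ln_div)
qed

lemma mellin_on_integrable:
  assumes f: "mellin_on A f F" and "\<sigma> > A"
  shows "integrable lborel (\<lambda>u. u powr (\<sigma> - 1) * f u)"
proof (rule Bochner_Integration.integrable_bound)
  note [measurable] = mellin_onD(1)[OF f]
  show "integrable lborel (\<lambda>u. cpow (of_real \<sigma> - 1) u * of_real (f u))"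
    using mellin_onD(3)[OF f, of "of_real \<sigma>"] \<open>\<sigma> > A\<close> by (auto simp: has_bochner_integral_iff)
  show "AE u in lborel. norm (u powr (\<sigma> - 1) * f u) \<le> norm (cpow (of_real \<sigma> - 1) u * of_real (f u))"
  proof (rule AE_I2)
    fix u
    show "norm (u powr (\<sigma> - 1) * f u) \<le> norm (cpow (of_real \<sigma> - 1) u * of_real (f u))"
      using mellin_onD(2)[OF f, of u] by (cases "u > 0") (auto simp: norm_mult norm_cpow abs_mult)
  qed
qed (use mellin_onD(1)[OF f] in measurable)

lemma mellin_on_integrable_exp:
  assumes f: "mellin_on A f F" and y: "y > 0"
  shows "integrable lborel (\<lambda>u. f u * u powr c * exp (- (y / u)))"
proof (rule Bochner_Integration.integrable_bound)
  note [measurable] = mellin_onD(1)[OF f]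
  \<comment> \<open>Beyond A, so that u^(\<sigma>-1) f is integrable, and beyond c + 1, so that u^c
    = u^(\<sigma>-1) u^(-m) with m > 0. The exponential absorbs u^(-m) near 0.\<close>
  define \<sigma> where "\<sigma> = \<bar>A\<bar> + \<bar>c\<bar> + 3"
  define m where "m = \<sigma> - 1 - c"
  have m: "m > 0" unfolding m_def \<sigma>_def by (simp add: abs_if)
  define K where "K = exp (m * ln (m / y) - m)"
  show "integrable lborel (\<lambda>u. K * (u powr (\<sigma> - 1) * f u))"
    by (intro integrable_mult_right mellin_on_integrable[OF f]) (auto simp: \<sigma>_def)
  show "AE u in lborel. norm (f u * u powr c * exp (- (y / u))) \<le> norm (K * (u powr (\<sigma> - 1) * f u))"
  proof (rule AE_I2)
    fix u
    show "norm (f u * u powr c * exp (- (y / u))) \<le> norm (K * (u powr (\<sigma> - 1) * f u))"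
    proof (cases "u > 0")
      case True
      have "u powr c = u powr (\<sigma> - 1) * u powr (- m)"
        by (simp add: m_def powr_add[symmetric])
      then have "norm (f u * u powr c * exp (- (y / u))) =
          (u powr (\<sigma> - 1) * \<bar>f u\<bar>) * (u powr (- m) * exp (- (y / u)))"
        by (simp add: abs_mult mult_ac)
      also have "\<dots> \<le> (u powr (\<sigma> - 1) * \<bar>f u\<bar>) * K"
        unfolding K_def using powr_mult_exp_bounded[OF m y True] by (intro mult_left_mono) auto
      finally show ?thesis by (simp add: abs_mult mult_ac K_def)
    qed (use mellin_onD(2)[OF f] in auto)
  qed
qed (use mellin_onD(1)[OF f] in measurable)

text \<open>Isolates the dependence on x as a power of x times an integral with kernel exp(-x/u),
  which can be differentiated.\<close>

lemma mconv_gamma_weight_eq: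
  assumes f: "mellin_on A f F" and x: "x > 0"
  shows "mconv f (gamma_weight a) x = x powr a * (\<integral>u. f u * u powr (- a - 1) * exp (- (x / u)) \<partial>lborel)"
proof -
  have "mconv f (gamma_weight a) x = (\<integral>u. f u * gamma_weight a (x / u) / u \<partial>lborel)"
    by (rule mconv_eq) (rule mellin_onD(2)[OF f])
  also have "\<dots> = (\<integral>u. x powr a * (f u * u powr (- a - 1) * exp (- (x / u))) \<partial>lborel)"
  proof (rule Bochner_Integration.integral_cong[OF refl])
    fix u
    show "f u * gamma_weight a (x / u) / u = x powr a * (f u * u powr (- a - 1) * exp (- (x / u)))"
    proof (cases "u > 0")
      case True
      have "u powr (- a - 1) = 1 / (u powr a * u)"
        using True powr_add[of u a 1] powr_minus_divide[of u "a + 1"] by simp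
      then show ?thesis
        using True x by (simp add: gamma_weight_def powr_divide)
    qed (use mellin_onD(2)[OF f] in auto)
  qed
  also have "\<dots> = x powr a * (\<integral>u. f u * u powr (- a - 1) * exp (- (x / u)) \<partial>lborel)"
    by simp
  finally show ?thesis .
qed

text \<open>The derivative of exp(-x/u) brings down 1/u, which amounts to replacing a by a + 1 in
  the integral; the other term differentiates x^a.\<close>

lemma has_real_derivative_mconv_gamma_weight:
  assumes f: "mellin_on A f F" and x: "x > 0"
  shows "(mconv f (gamma_weight a) has_real_derivative
     (a * mconv f (gamma_weight a) x - mconv f (gamma_weight (a + 1)) x) / x) (at x)"
proof -
  define L where "L a x = (\<integral>u. f u * u powr (- a - 1) * exp (- (x / u)) \<partial>lborel)" for a x
  have shift: "f u * u powr (- a - 1) / u ^ i = f u * u powr (- a - 1 - real i)" for u a i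
  proof (cases "u > 0")
    case True
    then show ?thesis by (simp add: powr_diff powr_realpow)
  qed (use mellin_onD(2)[OF f] in auto)
  have "(L a has_real_derivative - L (a + 1) x) (at x)"
  proof -
    have "f u * u powr (- a - 1) / u = f u * u powr (- (a + 1) - 1)" for u
      using shift[of u a 1] by (simp add: algebra_simps)
    then have "- L (a + 1) x = - (\<integral>u. f u * u powr (- a - 1) / u * exp (- (x / u)) \<partial>lborel)"
      unfolding L_def by simp
    then show ?thesis
      unfolding L_def
      by (simp only:) (rule has_real_derivative_exp_kernel,
        use mellin_onD(2)[OF f] mellin_on_integrable_exp[OF f] x in \<open>auto simp: shift\<close>)
  qed
  then have "((\<lambda>x. x powr a * L a x) has_real_derivative
      (a * x powr (a - 1) * L a x + x powr a * (- L (a + 1) x))) (at x)"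
    using x by (auto intro!: derivative_eq_intros)
  moreover have M: "mconv f (gamma_weight c) x = x powr c * L c x" if "x > 0" for c x
    unfolding L_def by (rule mconv_gamma_weight_eq[OF f that])
  have "a * x powr (a - 1) * L a x + x powr a * (- L (a + 1) x) =
     (a * mconv f (gamma_weight a) x - mconv f (gamma_weight (a + 1)) x) / x"
    unfolding M[OF x] using x by (simp add: powr_diff powr_add field_simps)
  ultimately have "((\<lambda>x. x powr a * L a x) has_real_derivative
     (a * mconv f (gamma_weight a) x - mconv f (gamma_weight (a + 1)) x) / x) (at x)"
    by simp
  then show ?thesis
    by (rule has_field_derivative_transform_within_open[of _ _ _ "{0<..}"])
       (use x M in auto)
qed

text \<open>Closed under \<open>-x d/dx\<close>, since this operator maps \<open>gamma_weight a\<close> to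
  \<open>gamma_weight (a + 1) - a \<cdot> gamma_weight a\<close> and commutes with convolution.\<close>

inductive gamma_conv_span ::
  "real \<Rightarrow> (real \<Rightarrow> real) \<Rightarrow> (complex \<Rightarrow> complex) \<Rightarrow> (real \<Rightarrow> real) \<Rightarrow> (complex \<Rightarrow> complex) \<Rightarrow> bool"
  for A f F where
  base: "- a \<le> A \<Longrightarrow> gamma_conv_span A f F (mconv f (gamma_weight a)) (\<lambda>z. F z * Gamma (z + of_real a))"
| add: "gamma_conv_span A f F g G \<Longrightarrow> gamma_conv_span A f F h H \<Longrightarrow>
    gamma_conv_span A f F (\<lambda>x. g x + h x) (\<lambda>z. G z + H z)"
| cmult: "gamma_conv_span A f F g G \<Longrightarrow> gamma_conv_span A f F (\<lambda>x. c * g x) (\<lambda>z. of_real c * G z)"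

lemma gamma_conv_span_mellin_on:
  assumes "gamma_conv_span A f F g G" "mellin_on A f F"
  shows "mellin_on A g G"
  using assms by induction
    (auto intro: mellin_on_mconv mellin_on_gamma_weight mellin_on_add mellin_on_cmult)

text \<open>With h = -x g' the transform is multiplied by z. For the generators this is the
  functional equation in the form Gamma(z + a + 1) - a Gamma(z + a) = z Gamma(z + a); sums and
  multiples follow by linearity.\<close>

lemma gamma_conv_span_deriv:
  assumes "gamma_conv_span A f F g G" "mellin_on A f F"
  shows "\<exists>h H. gamma_conv_span A f F h H \<and>
    (\<forall>x>0. (g has_real_derivative - (h x / x)) (at x)) \<and> (\<forall>z. Re z > A \<longrightarrow> H z = z * G z)"
  using assms
proof induction
  case (base a)
  let ?h = "\<lambda>x. mconv f (gamma_weight (a + 1)) x + (- a) * mconv f (gamma_weight a) x"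
  let ?H = "\<lambda>z. F z * Gamma (z + of_real (a + 1)) + of_real (- a) * (F z * Gamma (z + of_real a))"
  have "gamma_conv_span A f F ?h ?H"
    using base by (intro gamma_conv_span.intros) auto
  moreover have "(mconv f (gamma_weight a) has_real_derivative - (?h x / x)) (at x)" if "x > 0" for x
  proof -
    have "(a * mconv f (gamma_weight a) x - mconv f (gamma_weight (a + 1)) x) / x = - (?h x / x)"
      unfolding minus_divide_left by simp
    then show ?thesis
      using has_real_derivative_mconv_gamma_weight[OF \<open>mellin_on A f F\<close> that, of a] by (simp only:)
  qed
  moreover have "?H z = z * (F z * Gamma (z + of_real a))" if "Re z > A" for z
  proof -
    have "z + of_real a \<notin> \<int>\<^sub>\<le>\<^sub>0"
      using that base by (intro notin_nonpos_Ints_of_Re_pos) simp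
    from Gamma_plus1[OF this] show ?thesis by (simp add: algebra_simps)
  qed
  ultimately show ?case by blast
next
  case (add g G h H)
  then obtain g' G' h' H' where
    g': "gamma_conv_span A f F g' G'" "\<forall>x>0. (g has_real_derivative - (g' x / x)) (at x)"
      "\<forall>z. Re z > A \<longrightarrow> G' z = z * G z" and
    h': "gamma_conv_span A f F h' H'" "\<forall>x>0. (h has_real_derivative - (h' x / x)) (at x)"
      "\<forall>z. Re z > A \<longrightarrow> H' z = z * H z"
    by blast
  have "((\<lambda>x. g x + h x) has_real_derivative - ((g' x + h' x) / x)) (at x)" if "x > 0" for x
    using DERIV_add[of g "- (g' x / x)" x UNIV h "- (h' x / x)"] g'(2) h'(2) that
    by (simp add: add_divide_distrib)
  with gamma_conv_span.add[OF g'(1) h'(1)] g'(3) h'(3) show ?case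
    by (intro exI[of _ "\<lambda>x. g' x + h' x"] exI[of _ "\<lambda>z. G' z + H' z"]) (simp add: distrib_left)
next
  case (cmult g G c)
  then obtain g' G' where
    g': "gamma_conv_span A f F g' G'" "\<forall>x>0. (g has_real_derivative - (g' x / x)) (at x)"
      "\<forall>z. Re z > A \<longrightarrow> G' z = z * G z"
    by blast
  have "((\<lambda>x. c * g x) has_real_derivative - (c * g' x / x)) (at x)" if "x > 0" for x
    using DERIV_cmult[of g "- (g' x / x)" x UNIV c] g'(2) that by simp
  with gamma_conv_span.cmult[OF g'(1), of c] g'(3) show ?case
    by (intro exI[of _ "\<lambda>x. c * g' x"] exI[of _ "\<lambda>z. of_real c * G' z"]) simp
qed

lemma gamma_conv_span_continuous_on:
  assumes "gamma_conv_span A f F g G" "mellin_on A f F"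
  shows "continuous_on {0<..} g"
proof -
  obtain h H where "\<forall>x>0. (g has_real_derivative - (h x / x)) (at x)"
    using gamma_conv_span_deriv[OF assms] by blast
  then have "isCont g x" if "x > 0" for x
    using that DERIV_isCont by blast
  then show ?thesis
    by (intro continuous_at_imp_continuous_on) auto
qed

lemma gamma_conv_span_iterate:
  assumes "mellin_on A f F" "- a \<le> A"
  shows "\<exists>g G. gamma_conv_span A f F g G \<and>
    (\<forall>x>0. ((\<lambda>f x. - x * deriv f x) ^^ m) (mconv f (gamma_weight a)) x = g x) \<and>
    (\<forall>z. Re z > A \<longrightarrow> G z = z ^ m * (F z * Gamma (z + of_real a)))"
proof (induction m)
  case 0
  show ?case
    by (intro exI conjI, rule gamma_conv_span.base[OF assms(2)]) auto
next
  case (Suc m)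
  then obtain g G where g: "gamma_conv_span A f F g G"
    "\<And>x. x > 0 \<Longrightarrow> ((\<lambda>f x. - x * deriv f x) ^^ m) (mconv f (gamma_weight a)) x = g x"
    "\<And>z. Re z > A \<Longrightarrow> G z = z ^ m * (F z * Gamma (z + of_real a))" by blast
  obtain h H where h: "gamma_conv_span A f F h H"
    "\<And>x. x > 0 \<Longrightarrow> (g has_real_derivative - (h x / x)) (at x)"
    "\<And>z. Re z > A \<Longrightarrow> H z = z * G z"
    using gamma_conv_span_deriv[OF g(1) assms(1)] by blast
  have "((\<lambda>f x. - x * deriv f x) ^^ Suc m) (mconv f (gamma_weight a)) x = h x" if x: "x > 0" for x
  proof -
    \<comment> \<open>The iterate is known to equal g only for positive arguments; as this half-line
      is open, that determines \<open>deriv\<close> at x.\<close>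
    have "(((\<lambda>f x. - x * deriv f x) ^^ m) (mconv f (gamma_weight a)) has_real_derivative - (h x / x)) (at x)"
      by (rule has_field_derivative_transform_within_open[OF h(2)[OF x], of "{0<..}"])
         (use x g(2) in auto)
    from DERIV_imp_deriv[OF this] show ?thesis using x by simp
  qed
  with h g show ?case
    by (intro exI[of _ h] exI[of _ H]) auto
qed

section \<open>The weights and the decomposition of the Rodrigues function\<close>

text \<open>Components and rows are real, so the linear algebra stays over the reals; this is the
  bridge to the complex transform variable.\<close>

definition ceval :: "real poly \<Rightarrow> complex \<Rightarrow> complex" where
  "ceval p z = poly (map_poly of_real p) z"

lemma ceval_0 [simp]: "ceval 0 z = 0"
  by (simp add: ceval_def)

lemma ceval_pCons [simp]: "ceval (pCons c p) z = of_real c + z * ceval p z"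
  by (simp add: ceval_def map_poly_pCons)

lemma ceval_1 [simp]: "ceval 1 z = 1"
  by (simp add: one_pCons)

lemma ceval_add: "ceval (p + q) z = ceval p z + ceval q z"
proof -
  have "map_poly complex_of_real (p + q) = map_poly of_real p + map_poly of_real q"
    by (rule poly_eqI) (simp add: coeff_map_poly)
  then show ?thesis by (simp add: ceval_def)
qed

lemma ceval_smult: "ceval (smult c p) z = of_real c * ceval p z"
proof -
  have "map_poly complex_of_real (smult c p) = smult (of_real c) (map_poly of_real p)"
    by (rule poly_eqI) (simp add: coeff_map_poly)
  then show ?thesis by (simp add: ceval_def)
qed

lemma ceval_mult: "ceval (p * q) z = ceval p z * ceval q z"
  by (induction p) (simp_all add: ceval_add ceval_smult algebra_simps)

lemma ceval_power: "ceval (p ^ k) z = ceval p z ^ k"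
  by (induction k) (simp_all add: ceval_mult)

lemma ceval_sum: "ceval (\<Sum>x\<in>X. f x) z = (\<Sum>x\<in>X. ceval (f x) z)"
  by (induction X rule: infinite_finite_induct) (simp_all add: ceval_add)

lemma ceval_prod: "ceval (\<Prod>x\<in>X. f x) z = (\<Prod>x\<in>X. ceval (f x) z)"
  by (induction X rule: infinite_finite_induct) (simp_all add: ceval_mult)

lemma ceval_of_real: "ceval p (of_real x) = of_real (poly p x)"
  by (induction p) simp_all

lemma mconv_list_snoc: "ws \<noteq> [] \<Longrightarrow> mconv_list (ws @ [w]) = mconv (mconv_list ws) w"
  by (cases ws) simp_all

lemma mellin_on_mconv_list:
  assumes "ps \<noteq> []" "\<And>f F. (f, F) \<in> set ps \<Longrightarrow> mellin_on A f F"
  shows "mellin_on A (mconv_list (map fst ps)) (\<lambda>z. \<Prod>p\<leftarrow>ps. snd p z)"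
  using assms
proof (induction ps rule: rev_induct)
  case (snoc p ps)
  show ?case
  proof (cases ps)
    case Nil
    then show ?thesis using snoc.prems(2)[of "fst p" "snd p"] by simp
  next
    case (Cons q qs)
    have "mconv_list (map fst (ps @ [p])) = mconv (mconv_list (map fst ps)) (fst p)"
      using Cons by (simp add: mconv_list_snoc)
    moreover have "mellin_on A (mconv_list (map fst ps)) (\<lambda>z. \<Prod>p\<leftarrow>ps. snd p z)"
      by (rule snoc.IH) (use Cons snoc.prems(2) in auto)
    moreover have "mellin_on A (fst p) (snd p)"
      using snoc.prems(2)[of "fst p" "snd p"] by simp
    ultimately show ?thesis
      using mellin_on_mconv by simp
  qed
qed simp

definition weight_mellin ::
  "nat \<Rightarrow> nat \<Rightarrow> (nat \<Rightarrow> real) \<Rightarrow> (nat \<Rightarrow> real) \<Rightarrow> complex \<Rightarrow> complex" where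
  "weight_mellin r s a b z =
     (\<Prod>\<nu>=1..r+s. Gamma (z + of_real (a \<nu>))) / (\<Prod>h=1..r. Gamma (z + of_real (b h)))"

text \<open>The last gamma weight is split off to carry the derivatives. With s \<ge> 2 another
  gamma weight remains, so even for r = 0 the rest is not the empty list, on which
  \<open>mconv_list\<close> has a dummy value.\<close>

lemma weight0_split:
  assumes s: "s \<ge> 2" and A: "\<And>\<nu>. \<nu> \<in> {1..r+s} \<Longrightarrow> - a \<nu> \<le> A"
    and ab: "\<And>h. h \<in> {1..r} \<Longrightarrow> a h < b h"
  shows "\<exists>f F. weight0 r s a b = mconv f (gamma_weight (a (r + s))) \<and> mellin_on A f F \<and>
    (\<forall>z. F z * Gamma (z + of_real (a (r + s))) = weight_mellin r s a b z)"
proof -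
  define J where "J = map (\<lambda>h. (jacobi_weight (a h) (b h), \<lambda>z :: complex. Gamma (z + of_real (a h)) / Gamma (z + of_real (b h))))
     [1..<Suc r]"
  define G where "G = map (\<lambda>j. (gamma_weight (a (r + j)), \<lambda>z :: complex. Gamma (z + of_real (a (r + j))))) [1..<s]"
  define f where "f = mconv_list (map fst (J @ G))"
  define F where "F z = (\<Prod>p\<leftarrow>J @ G. snd p z)" for z :: complex
  have "[1..<Suc s] = [1..<s] @ [s]" using s by simp
  then have "weight0 r s a b = mconv_list (map fst (J @ G) @ [gamma_weight (a (r + s))])"
    unfolding weight0_def J_def G_def by (simp add: comp_def del: upt_Suc)
  also have "\<dots> = mconv f (gamma_weight (a (r + s)))"
    unfolding f_def using s by (intro mconv_list_snoc) (auto simp: G_def)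
  finally have "weight0 r s a b = mconv f (gamma_weight (a (r + s)))" .
  moreover have "mellin_on A f F"
    unfolding f_def F_def
  proof (rule mellin_on_mconv_list)
    show "J @ G \<noteq> []" using s by (auto simp: G_def)
    fix g M assume "(g, M) \<in> set (J @ G)"
    then show "mellin_on A g M"
      by (auto simp: J_def G_def intro!: mellin_on_jacobi_weight mellin_on_gamma_weight A ab)
  qed
  moreover have "F z * Gamma (z + of_real (a (r + s))) = weight_mellin r s a b z" for z
  proof -
    have interval: "(\<Prod>x\<leftarrow>[i..<j]. g x) = (\<Prod>x\<in>{i..<j}. g x)" for i j and g :: "nat \<Rightarrow> complex"
      using prod.distinct_set_conv_list[of "[i..<j]" g] by simp
    have "(\<Prod>p\<leftarrow>J. snd p z) = (\<Prod>h=1..r. Gamma (z + of_real (a h))) / (\<Prod>h=1..r. Gamma (z + of_real (b h)))"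
      unfolding J_def by (simp add: comp_def interval atLeastLessThanSuc_atLeastAtMost prod_dividef del: upt_Suc)
    moreover have "(\<Prod>p\<leftarrow>G. snd p z) = (\<Prod>j\<in>{1..<s}. Gamma (z + of_real (a (r + j))))"
      unfolding G_def by (simp add: comp_def interval)
    moreover have "(\<Prod>\<nu>=1..r+s. Gamma (z + of_real (a \<nu>))) =
      (\<Prod>h=1..r. Gamma (z + of_real (a h))) * (\<Prod>j=1..s. Gamma (z + of_real (a (r + j))))"
    proof -
      have "(\<Prod>\<nu>=1..r+s. Gamma (z + of_real (a \<nu>))) =
        (\<Prod>h=1..r. Gamma (z + of_real (a h))) * (\<Prod>j=r+1..r+s. Gamma (z + of_real (a j)))"
        by (rule prod.ub_add_nat) simp
      also have "(\<Prod>j=r+1..r+s. Gamma (z + of_real (a j))) = (\<Prod>j=1..s. Gamma (z + of_real (a (r + j))))"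
        using prod.shift_bounds_cl_nat_ivl[of "\<lambda>j. Gamma (z + of_real (a j))" 1 r s]
        by (simp add: add.commute)
      finally show ?thesis .
    qed
    moreover have "(\<Prod>j=1..s. Gamma (z + of_real (a (r + j)))) =
       (\<Prod>j\<in>{1..<s}. Gamma (z + of_real (a (r + j)))) * Gamma (z + of_real (a (r + s)))"
    proof -
      have "{1..s} = insert s {1..<s}" using s by auto
      then show ?thesis by (simp add: mult.commute)
    qed
    ultimately show ?thesis
      unfolding F_def weight_mellin_def by simp
  qed
  ultimately show ?thesis by blast
qed

text \<open>The function g stands in for the weight: it vanishes on the nonpositive axis by
  \<open>mellin_on\<close>, and agreement is established for x > 0.\<close>

lemma weight_v_mellin:
  assumes s: "s \<ge> 2" and A: "\<And>\<nu>. \<nu> \<in> {1..r+s} \<Longrightarrow> - a \<nu> \<le> A"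
    and ab: "\<And>h. h \<in> {1..r} \<Longrightarrow> a h < b h"
  shows "\<exists>g. mellin_on A g (\<lambda>z. z ^ (l - 1) * weight_mellin r s a b z) \<and>
     continuous_on {0<..} g \<and> (\<forall>x>0. weight_v r s a b l x = g x)"
proof -
  obtain f F where f: "weight0 r s a b = mconv f (gamma_weight (a (r + s)))" "mellin_on A f F"
    "\<And>z. F z * Gamma (z + of_real (a (r + s))) = weight_mellin r s a b z"
    using weight0_split[of s r a A b, OF s A ab] by blast
  have "- a (r + s) \<le> A" using A s by simp
  from gamma_conv_span_iterate[OF f(2) this, of "l - 1"]
  obtain g G where g: "gamma_conv_span A f F g G"
    "\<And>x. x > 0 \<Longrightarrow> ((\<lambda>f x. - x * deriv f x) ^^ (l - 1)) (mconv f (gamma_weight (a (r + s)))) x = g x"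
    "\<And>z. Re z > A \<Longrightarrow> G z = z ^ (l - 1) * (F z * Gamma (z + of_real (a (r + s))))" by blast
  have "mellin_on A g (\<lambda>z. z ^ (l - 1) * weight_mellin r s a b z)"
    by (rule mellin_on_cong[OF gamma_conv_span_mellin_on[OF g(1) f(2)]]) (simp add: g(3) f(3))
  moreover have "continuous_on {0<..} g"
    using gamma_conv_span_continuous_on[OF g(1) f(2)] .
  moreover have "\<forall>x>0. weight_v r s a b l x = g x"
    unfolding weight_v_def f(1) using g(2) by simp
  ultimately show ?thesis by blast
qed

lemma weight_w_mellin:
  assumes s: "s \<ge> 2" and A: "\<And>\<nu>. \<nu> \<in> {1..r+s} \<Longrightarrow> - a \<nu> \<le> A"
    and ab: "\<And>h. h \<in> {1..r} \<Longrightarrow> a h < b h" and h: "h \<in> {1..r}"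
  shows "\<exists>g. mellin_on A g (\<lambda>z. weight_mellin r s a b z / (z + of_real (b h))) \<and>
     continuous_on {0<..} g \<and> (\<forall>x>0. weight_w r s a b h x = g x)"
proof -
  define b' where "b' = b(h := b h + 1)"
  have "a j < b' j" if "j \<in> {1..r}" for j
    using ab[OF that] unfolding b'_def by (cases "j = h") auto
  \<comment> \<open>With l = 1 no derivative is applied, so this is the base weight for the raised
    parameter.\<close>
  from weight_v_mellin[of s r a A b' 1, OF s A this]
  obtain g where g: "mellin_on A g (\<lambda>z. weight_mellin r s a b' z)"
    "continuous_on {0<..} g" "\<forall>x>0. weight_v r s a b' 1 x = g x"
    by auto
  have shift: "weight_mellin r s a b' z = weight_mellin r s a b z / (z + of_real (b h))" if "Re z > A" for z
  proof -
    have "Re (z + of_real (b h)) > 0"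
      using that A[of h] ab[OF h] h by simp
    then have "Gamma (z + of_real (b' h)) = (z + of_real (b h)) * Gamma (z + of_real (b h))"
      using Gamma_plus1[of "z + of_real (b h)"] notin_nonpos_Ints_of_Re_pos by (simp add: b'_def algebra_simps)
    moreover have "(\<Prod>j\<in>{1..r} - {h}. Gamma (z + of_real (b' j))) = (\<Prod>j\<in>{1..r} - {h}. Gamma (z + of_real (b j)))"
      by (rule prod.cong) (auto simp: b'_def)
    ultimately have "(\<Prod>j=1..r. Gamma (z + of_real (b' j))) =
       (z + of_real (b h)) * (\<Prod>j=1..r. Gamma (z + of_real (b j)))"
      using h by (simp only: prod.remove[of "{1..r}" h] finite_atLeastAtMost mult.assoc)
    then show ?thesis
      unfolding weight_mellin_def by simp
  qed
  have "mellin_on A g (\<lambda>z. weight_mellin r s a b z / (z + of_real (b h)))"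
    by (rule mellin_on_cong[OF g(1)]) (rule shift)
  moreover have "weight_v r s a b' 1 = weight_w r s a b h"
    by (simp add: weight_v_def weight_w_def b'_def)
  ultimately show ?thesis
    using g(2,3) by (intro exI[of _ g]) simp
qed

lemma ceval_shift_poly: "ceval (shift_poly c i j) z = (\<Prod>u\<in>{i..<j}. z + of_real c + of_nat u)"
  unfolding shift_poly_def ceval_prod by (rule prod.cong) (auto simp: algebra_simps)

lemma pochhammer_eq_ceval: "pochhammer (z + of_real c) k = ceval (shift_poly c 0 k) z"
  unfolding ceval_shift_poly pochhammer_prod ..

lemma ceval_shift_poly_split:
  assumes "k \<le> m"
  shows "ceval (shift_poly c 0 m) z = ceval (shift_poly c 0 k) z * ceval (shift_poly c k m) z"
  unfolding shift_poly_def ceval_mult[symmetric]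
  using prod.atLeastLessThan_concat[of 0 k m "\<lambda>u. [:c + real u, 1:]"] assms by simp

lemma ceval_shift_poly_nonzero:
  assumes "Re z + c > 0"
  shows "ceval (shift_poly c i j) z \<noteq> 0"
proof -
  have "z + of_real c + of_nat u \<noteq> 0" for u
  proof
    assume "z + of_real c + of_nat u = 0"
    then have "Re (z + of_real c + of_nat u) = 0" by simp
    then show False using assms by simp
  qed
  then show ?thesis by (simp add: ceval_shift_poly)
qed

lemma Gamma_shift:
  assumes "Re z + c > 0"
  shows "Gamma (z + of_nat k + of_real c) = Gamma (z + of_real c) * ceval (shift_poly c 0 k) z"
proof -
  have "z + of_real c \<notin> \<int>\<^sub>\<le>\<^sub>0"
    using assms by (intro notin_nonpos_Ints_of_Re_pos) simp
  then have "Gamma (z + of_real c) \<noteq> 0"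
    and "pochhammer (z + of_real c) k = Gamma (z + of_real c + of_nat k) / Gamma (z + of_real c)"
    by (auto simp: Gamma_nonzero pochhammer_Gamma)
  then show ?thesis
    by (simp add: pochhammer_eq_ceval[symmetric] add_ac)
qed

fun slot_weight ::
  "nat \<Rightarrow> nat \<Rightarrow> (nat \<Rightarrow> real) \<Rightarrow> (nat \<Rightarrow> real) \<Rightarrow> slot \<Rightarrow> real \<Rightarrow> real" where
  "slot_weight r s a b (Inl (h, k)) x = x ^ k * weight_w r s a b h x"
| "slot_weight r s a b (Inr (l, k)) x = x ^ k * weight_v r s a b l x"

text \<open>The Gamma functions in the denominator are shifted by the full n_h. Relative to this
  factor every slot has a polynomial transform, because its own shifts k or k + 1 never exceed
  n_h.\<close>

definition rodrigues_mellin ::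
  "nat \<Rightarrow> nat \<Rightarrow> (nat \<Rightarrow> real) \<Rightarrow> (nat \<Rightarrow> real) \<Rightarrow> (nat \<Rightarrow> nat) \<Rightarrow> complex \<Rightarrow> complex" where
  "rodrigues_mellin r s a b n z =
     (\<Prod>\<nu>=1..r+s. Gamma (z + of_real (a \<nu>))) / (\<Prod>h=1..r. Gamma (z + of_real (b h) + of_nat (n h)))"

context
  fixes r s :: nat and a b :: "nat \<Rightarrow> real" and A :: real
  assumes s: "s \<ge> 2" and A: "\<And>\<nu>. \<nu> \<in> {1..r+s} \<Longrightarrow> - a \<nu> \<le> A"
    and ab: "\<And>h. h \<in> {1..r} \<Longrightarrow> a h < b h"
begin

lemma Re_plus_a_pos: "Re z > A \<Longrightarrow> \<nu> \<in> {1..r+s} \<Longrightarrow> Re z + a \<nu> > 0"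
  using A[of \<nu>] by linarith

lemma Re_plus_b_pos: "Re z > A \<Longrightarrow> h \<in> {1..r} \<Longrightarrow> Re z + b h > 0"
  using A[of h] ab[of h] by force

lemma rodrigues_mellin_nonzero:
  assumes "Re z > A"
  shows "rodrigues_mellin r s a b n z \<noteq> 0"
proof -
  have "Gamma (z + of_real (a \<nu>)) \<noteq> 0" if "\<nu> \<in> {1..r+s}" for \<nu>
    using Re_plus_a_pos[OF assms that] by (intro Gamma_nonzero notin_nonpos_Ints_of_Re_pos) simp
  moreover have "Gamma (z + of_real (b h) + of_nat (n h)) \<noteq> 0" if "h \<in> {1..r}" for h
    using Re_plus_b_pos[OF assms that]
    by (intro Gamma_nonzero notin_nonpos_Ints_of_Re_pos) simp
  ultimately show ?thesis
    unfolding rodrigues_mellin_def by (simp add: prod_zero_iff del: One_nat_def)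
qed

text \<open>Shifting z by k produces (z + a_\<nu>)_k in the numerator. In the denominator the shift
  stops at k, and the factors from k to n_j - 1 compensate for the larger shift n_j in the common
  factor; this uses k \<le> n_j.\<close>

lemma weight_mellin_shift:
  assumes z: "Re z > A" and kn: "\<forall>j\<in>{1..r}. k \<le> n j"
  shows "weight_mellin r s a b (z + of_nat k) =
    rodrigues_mellin r s a b n z * (\<Prod>\<nu>=1..r+s. ceval (shift_poly (a \<nu>) 0 k) z) *
      (\<Prod>j=1..r. ceval (shift_poly (b j) k (n j)) z)"
proof -
  have "(\<Prod>\<nu>=1..r+s. Gamma (z + of_nat k + of_real (a \<nu>))) =
    (\<Prod>\<nu>=1..r+s. Gamma (z + of_real (a \<nu>)) * ceval (shift_poly (a \<nu>) 0 k) z)"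
    by (rule prod.cong[OF refl]) (rule Gamma_shift[OF Re_plus_a_pos[OF z]])
  moreover have "(\<Prod>j=1..r. Gamma (z + of_real (b j) + of_nat (n j))) =
    (\<Prod>j=1..r. Gamma (z + of_nat k + of_real (b j)) * ceval (shift_poly (b j) k (n j)) z)"
  proof (rule prod.cong[OF refl])
    fix j assume j: "j \<in> {1..r}"
    have "Gamma (z + of_nat (n j) + of_real (b j)) = Gamma (z + of_real (b j)) * ceval (shift_poly (b j) 0 (n j)) z"
      by (rule Gamma_shift[OF Re_plus_b_pos[OF z j]])
    also have "\<dots> = Gamma (z + of_nat k + of_real (b j)) * ceval (shift_poly (b j) k (n j)) z"
      using kn j by (simp add: Gamma_shift[OF Re_plus_b_pos[OF z j]] ceval_shift_poly_split)
    finally show "Gamma (z + of_real (b j) + of_nat (n j)) =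
      Gamma (z + of_nat k + of_real (b j)) * ceval (shift_poly (b j) k (n j)) z"
      by (simp add: add_ac)
  qed
  moreover have "(\<Prod>j=1..r. ceval (shift_poly (b j) k (n j)) z) \<noteq> 0"
    using ceval_shift_poly_nonzero[OF Re_plus_b_pos[OF z]] by (simp add: prod_zero_iff del: One_nat_def)
  ultimately show ?thesis
    unfolding weight_mellin_def rodrigues_mellin_def by (simp add: prod.distrib del: One_nat_def)
qed

lemma slot_weight_mellin:
  assumes adm: "laguerre_admissible r s n \<eta>" and i: "i \<in> slots r s n \<eta>"
  shows "\<exists>g. mellin_on A g (\<lambda>z. rodrigues_mellin r s a b n z * ceval (mellin_row r s a b n i) z) \<and>
     continuous_on {0<..} g \<and> (\<forall>x>0. slot_weight r s a b i x = g x)"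
proof (cases i)
  case (Inl q)
  obtain h k where q: "q = (h, k)" by force
  have "s > 0" using s by simp
  note hk = admissible_Inl[OF adm \<open>s > 0\<close>, of h k, OF i[unfolded Inl q]]
  obtain g where g: "mellin_on A g (\<lambda>z. weight_mellin r s a b z / (z + of_real (b h)))"
     "continuous_on {0<..} g" "\<forall>x>0. weight_w r s a b h x = g x"
    using weight_w_mellin[of s r a A b h, OF s A ab hk(1)] by blast
  have "mellin_on A (\<lambda>x. x ^ k * g x) (\<lambda>z. rodrigues_mellin r s a b n z * ceval (mellin_row r s a b n i) z)"
  proof (rule mellin_on_cong[OF mellin_on_power[OF g(1)]])
    fix z assume z: "Re z > A"
    define t where "t = z + of_nat k + of_real (b h)"
    have "Re t > 0" using Re_plus_b_pos[OF z hk(1)] by (simp add: t_def)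
    then have t: "t \<noteq> 0" by auto
    \<comment> \<open>Raising b_h by one divides the transform by t. This cancels the factor u = k,
      present since k < n_h, and explains \<open>Suc k\<close> in the row of w_h.\<close>
    have split: "ceval (shift_poly (b h) k (n h)) z = t * ceval (shift_poly (b h) (Suc k) (n h)) z"
      unfolding shift_poly_split[OF hk(2)] ceval_mult by (simp add: t_def algebra_simps)
    have "(\<Prod>j=1..r. ceval (shift_poly (b j) k (n j)) z) =
       t * (\<Prod>j=1..r. ceval (shift_poly (b j) (if j = h then Suc k else k) (n j)) z)"
    proof -
      have "(\<Prod>j\<in>{1..r} - {h}. ceval (shift_poly (b j) (if j = h then Suc k else k) (n j)) z) =
        (\<Prod>j\<in>{1..r} - {h}. ceval (shift_poly (b j) k (n j)) z)"
        by (rule prod.cong) auto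
      then show ?thesis
        using hk(1) split by (simp add: prod.remove[of "{1..r}" h] del: One_nat_def)
    qed
    then show "weight_mellin r s a b (z + of_nat k) / (z + of_nat k + of_real (b h)) =
       rodrigues_mellin r s a b n z * ceval (mellin_row r s a b n i) z"
      unfolding weight_mellin_shift[OF z hk(3)] Inl q mellin_row.simps ceval_mult ceval_prod
      using t by (simp add: t_def[symmetric] del: One_nat_def)
  qed
  moreover have "continuous_on {0<..} (\<lambda>x. x ^ k * g x)"
    by (intro continuous_intros g(2))
  ultimately show ?thesis
    using g(3) Inl q by (intro exI[of _ "\<lambda>x. x ^ k * g x"]) auto
next
  case (Inr q)
  obtain l k where q: "q = (l, k)" by force
  have "s > 0" using s by simp
  note lk = admissible_Inr[OF adm \<open>s > 0\<close>, of l k, OF i[unfolded Inr q]]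
  obtain g where g: "mellin_on A g (\<lambda>z. z ^ (l - 1) * weight_mellin r s a b z)"
     "continuous_on {0<..} g" "\<forall>x>0. weight_v r s a b l x = g x"
    using weight_v_mellin[of s r a A b l, OF s A ab] by blast
  have "mellin_on A (\<lambda>x. x ^ k * g x) (\<lambda>z. rodrigues_mellin r s a b n z * ceval (mellin_row r s a b n i) z)"
  proof (rule mellin_on_cong[OF mellin_on_power[OF g(1)]])
    fix z assume z: "Re z > A"
    have "ceval [:real k, 1:] z = z + of_nat k" by simp
    then show "(z + of_nat k) ^ (l - 1) * weight_mellin r s a b (z + of_nat k) =
       rodrigues_mellin r s a b n z * ceval (mellin_row r s a b n i) z"
      unfolding weight_mellin_shift[OF z lk(3)] Inr q mellin_row.simps ceval_mult ceval_prod ceval_power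
      by (simp only: mult_ac)
  qed
  moreover have "continuous_on {0<..} (\<lambda>x. x ^ k * g x)"
    by (intro continuous_intros g(2))
  ultimately show ?thesis
    using g(3) Inr q by (intro exI[of _ "\<lambda>x. x ^ k * g x"]) auto
qed

end

section \<open>Existence and uniqueness of the components\<close>

definition rodrigues_poly :: "nat \<Rightarrow> (nat \<Rightarrow> real) \<Rightarrow> (nat \<Rightarrow> nat) \<Rightarrow> real poly" where
  "rodrigues_poly p \<beta> m = (\<Prod>i=1..p. \<Prod>u<m i. [:\<beta> i + 1 + real u, - 1:])"

lemma ceval_rodrigues_poly:
  "ceval (rodrigues_poly p \<beta> m) z = (\<Prod>i=1..p. pochhammer (of_real (\<beta> i) + 1 - z) (m i))"
  unfolding rodrigues_poly_def ceval_prod pochhammer_prod lessThan_atLeast0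
  by (intro prod.cong) auto

lemma degree_rodrigues_poly: "degree (rodrigues_poly p \<beta> m) = (\<Sum>i=1..p. m i)"
  unfolding rodrigues_poly_def by (simp add: degree_prod_eq_sum_degree)

lemma abs_lead_coeff_rodrigues_poly: "\<bar>lead_coeff (rodrigues_poly p \<beta> m)\<bar> = 1"
  unfolding rodrigues_poly_def lead_coeff_prod by (simp add: abs_prod)

definition slot_components ::
  "nat \<Rightarrow> nat \<Rightarrow> (nat \<Rightarrow> nat) \<Rightarrow> (nat \<Rightarrow> nat) \<Rightarrow> (slot \<Rightarrow> real) \<Rightarrow> (nat \<Rightarrow> real poly) \<times> (nat \<Rightarrow> real poly)" where
  "slot_components r s n \<eta> x =
     ((\<lambda>h. if h \<in> {1..r} then \<Sum>k<n h. monom (x (Inl (h, k))) k else 0),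
      (\<lambda>l. if l \<in> {1..s} then \<Sum>k<\<eta> l. monom (x (Inr (l, k))) k else 0))"

lemma coeff_sum_monom: "coeff (\<Sum>k<m. monom (c k) k) j = (if j < m then c j else 0)"
  by (simp add: coeff_sum)

lemma deg_less_iff: "deg_less P m \<longleftrightarrow> (\<forall>j\<ge>m. coeff P j = 0)"
proof
  assume "\<forall>j\<ge>m. coeff P j = 0"
  then show "deg_less P m"
    unfolding deg_less_def by (metis leading_coeff_0_iff not_le)
next
  assume "deg_less P m"
  then show "\<forall>j\<ge>m. coeff P j = 0"
    unfolding deg_less_def by (auto intro: coeff_eq_0)
qed

lemma Inl_in_slots_iff: "Inl (h, k) \<in> slots r s n \<eta> \<longleftrightarrow> h \<in> {1..r} \<and> k < n h"
  and Inr_in_slots_iff: "Inr (l, k) \<in> slots r s n \<eta> \<longleftrightarrow> l \<in> {1..s} \<and> k < \<eta> l"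
  by (auto simp: slots_def)

lemma slot_components_cong:
  assumes "\<And>i. i \<in> slots r s n \<eta> \<Longrightarrow> x i = y i"
  shows "slot_components r s n \<eta> x = slot_components r s n \<eta> y"
proof -
  have "x (Inl (h, k)) = y (Inl (h, k))" if "h \<in> {1..r}" "k < n h" for h k
    using assms[of "Inl (h, k)"] that by (simp add: Inl_in_slots_iff)
  moreover have "x (Inr (l, k)) = y (Inr (l, k))" if "l \<in> {1..s}" "k < \<eta> l" for l k
    using assms[of "Inr (l, k)"] that by (simp add: Inr_in_slots_iff)
  ultimately show ?thesis
    unfolding slot_components_def
    by (intro arg_cong2[of _ _ _ _ Pair] ext if_cong sum.cong refl) simp_all
qed

lemma slot_components_sum:
  "(\<Sum>h=1..r. poly (fst (slot_components r s n \<eta> x) h) t * weight_w r s a b h t) +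
   (\<Sum>l=1..s. poly (snd (slot_components r s n \<eta> x) l) t * weight_v r s a b l t) =
   (\<Sum>i\<in>slots r s n \<eta>. x i * slot_weight r s a b i t)"
proof -
  have "(\<Sum>h=1..r. poly (fst (slot_components r s n \<eta> x) h) t * weight_w r s a b h t) =
     (\<Sum>h=1..r. \<Sum>k<n h. x (Inl (h, k)) * slot_weight r s a b (Inl (h, k)) t)"
    by (rule sum.cong[OF refl])
       (simp add: slot_components_def poly_sum poly_monom sum_distrib_right mult.assoc)
  moreover have "(\<Sum>l=1..s. poly (snd (slot_components r s n \<eta> x) l) t * weight_v r s a b l t) =
     (\<Sum>l=1..s. \<Sum>k<\<eta> l. x (Inr (l, k)) * slot_weight r s a b (Inr (l, k)) t)"
    by (rule sum.cong[OF refl])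
       (simp add: slot_components_def poly_sum poly_monom sum_distrib_right mult.assoc)
  ultimately show ?thesis
    unfolding sum_slots by (simp only:)
qed

lemma is_components_slot_components_iff:
  "is_components r s a b n \<eta> f (slot_components r s n \<eta> x) \<longleftrightarrow>
     (\<forall>t>0. f t = (\<Sum>i\<in>slots r s n \<eta>. x i * slot_weight r s a b i t))"
  unfolding slot_components_sum[symmetric]
  by (auto simp: is_components_def slot_components_def deg_less_iff coeff_sum_monom split: if_splits)

text \<open>Degree bounds and the zero convention outside the index ranges say exactly that the pair
  is determined by its slot coefficients, so uniqueness can be checked on those.\<close>

lemma is_componentsE:
  assumes "is_components r s a b n \<eta> f C"
  obtains x where "C = slot_components r s n \<eta> x"
proof -
  obtain B D where C: "C = (B, D)" by force
  let ?x = "\<lambda>i. case i of Inl (h, k) \<Rightarrow> coeff (B h) k | Inr (l, k) \<Rightarrow> coeff (D l) k"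
  have "B h = fst (slot_components r s n \<eta> ?x) h" for h
    using assms C by (intro poly_eqI)
      (auto simp: is_components_def slot_components_def deg_less_iff coeff_sum_monom)
  moreover have "D l = snd (slot_components r s n \<eta> ?x) l" for l
    using assms C by (intro poly_eqI)
      (auto simp: is_components_def slot_components_def deg_less_iff coeff_sum_monom)
  ultimately have "C = slot_components r s n \<eta> ?x"
    unfolding C by (intro prod_eqI ext) simp_all
  then show thesis by (rule that)
qed

text \<open>For uniqueness, equal functions have equal transforms, the nonvanishing Gamma factor
  cancels, and the rows are independent. The coefficients x are exposed because the growth estimate
  compares leading coefficients in the same polynomial identity.\<close>

theorem rodrigues_components_system:
  assumes s: "s \<ge> 2" and ab: "\<And>h. h \<in> {1..r} \<Longrightarrow> a h < b h"
    and adm: "laguerre_admissible r s n \<eta>" and c: "c_index r s a b n \<noteq> 0"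
    and m: "(\<Sum>i=1..p. m i) < (\<Sum>h=1..r. n h) + (\<Sum>l=1..s. \<eta> l)"
    and f_def: "f = rodrigues_function p r s a b \<beta> n m"
  shows "\<exists>x. rodrigues_poly p \<beta> m = (\<Sum>i\<in>slots r s n \<eta>. smult (x i) (mellin_row r s a b n i)) \<and>
     (\<exists>!C. is_components r s a b n \<eta> f C) \<and>
     rodrigues_components r s a b n \<eta> f = slot_components r s n \<eta> x"
proof -
  \<comment> \<open>The smallest A for which Re z > A avoids the poles of all Gamma factors; this is
    the half-plane in the definition of the Rodrigues function.\<close>
  define A where "A = Max ((\<lambda>\<nu>. - a \<nu>) ` {1..r+s})"
  have A_iff: "(\<forall>\<nu>\<in>{1..r+s}. Re z > - a \<nu>) \<longleftrightarrow> Re z > A" for z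
    unfolding A_def using s by (subst Max_less_iff) auto
  have A: "- a \<nu> \<le> A" if "\<nu> \<in> {1..r+s}" for \<nu>
    unfolding A_def using that by (intro Max_ge) auto
  define Q where "Q = rodrigues_mellin r s a b n"
  obtain x where x: "rodrigues_poly p \<beta> m = (\<Sum>i\<in>slots r s n \<eta>. smult (x i) (mellin_row r s a b n i))"
    using mellin_row_expansion[OF adm _ c, of "rodrigues_poly p \<beta> m"] m s
    by (auto simp: degree_rodrigues_poly)
  have "\<forall>i\<in>slots r s n \<eta>. \<exists>g. mellin_on A g (\<lambda>z. Q z * ceval (mellin_row r s a b n i) z) \<and>
     continuous_on {0<..} g \<and> (\<forall>t>0. slot_weight r s a b i t = g t)"
    using slot_weight_mellin[of s r a A b n \<eta>, OF s A ab adm] unfolding Q_def by blast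
  from bchoice[OF this] obtain g where
    "\<forall>i\<in>slots r s n \<eta>. mellin_on A (g i) (\<lambda>z. Q z * ceval (mellin_row r s a b n i) z) \<and>
       continuous_on {0<..} (g i) \<and> (\<forall>t>0. slot_weight r s a b i t = g i t)" ..
  then have g:
    "\<And>i. i \<in> slots r s n \<eta> \<Longrightarrow> mellin_on A (g i) (\<lambda>z. Q z * ceval (mellin_row r s a b n i) z)"
    "\<And>i. i \<in> slots r s n \<eta> \<Longrightarrow> continuous_on {0<..} (g i)"
    "\<And>i t. i \<in> slots r s n \<eta> \<Longrightarrow> t > 0 \<Longrightarrow> slot_weight r s a b i t = g i t"
    by simp_all
  define comb where "comb y t = (\<Sum>i\<in>slots r s n \<eta>. y i * g i t)" for y t
  define P where "P y = (\<Sum>i\<in>slots r s n \<eta>. smult (y i) (mellin_row r s a b n i))" for y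
  have comb_weight: "comb y t = (\<Sum>i\<in>slots r s n \<eta>. y i * slot_weight r s a b i t)" if "t > 0" for y t
    unfolding comb_def using g(3) that by (intro sum.cong) auto
  have comb_mellin: "mellin_on A (comb y) (\<lambda>z. Q z * ceval (P y) z)" for y
  proof -
    have "mellin_on A (comb y) (\<lambda>z. \<Sum>i\<in>slots r s n \<eta>. of_real (y i) * (Q z * ceval (mellin_row r s a b n i) z))"
      unfolding comb_def by (intro mellin_on_sum mellin_on_cmult g(1))
    then show ?thesis
      by (rule mellin_on_cong) (simp add: P_def ceval_sum ceval_smult sum_distrib_left mult_ac)
  qed
  have comb_cont: "continuous_on {0<..} (comb y)" for y
    unfolding comb_def by (intro continuous_intros g(2))
  have T: "(\<Prod>\<nu>=1..r+s. Gamma (z + of_real (a \<nu>)))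
            / (\<Prod>h=1..r. Gamma (z + of_real (b h) + of_nat (n h)))
            * (\<Prod>i=1..p. pochhammer (of_real (\<beta> i) + 1 - z) (m i)) = Q z * ceval (P x) z" for z
    unfolding Q_def rodrigues_mellin_def P_def x[symmetric] ceval_rodrigues_poly ..
  have f: "f = comb x"
    unfolding f_def rodrigues_function_def T A_iff
  proof (rule the_equality)
    show "continuous_on {0<..} (comb x) \<and> (\<forall>t\<le>0. comb x t = 0) \<and>
        (\<forall>z. Re z > A \<longrightarrow> has_mellin (comb x) z (Q z * ceval (P x) z))"
      using comb_cont comb_mellin[of x] unfolding mellin_on_def by auto
    fix g assume g: "continuous_on {0<..} g \<and> (\<forall>t\<le>0. g t = 0) \<and>
        (\<forall>z. Re z > A \<longrightarrow> has_mellin g z (Q z * ceval (P x) z))"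
    \<comment> \<open>A competitor in the definite description is assumed continuous on the open
      half-line and zero elsewhere; this makes it Borel measurable, as \<open>mellin_on\<close>
      requires.\<close>
    have "g = (\<lambda>t. indicator {0<..} t *\<^sub>R g t)"
      using g by (auto simp: fun_eq_iff indicator_def)
    also have "\<dots> \<in> borel_measurable borel"
      using g by (intro borel_measurable_continuous_on_indicator) auto
    finally have "mellin_on A g (\<lambda>z. Q z * ceval (P x) z)"
      using g unfolding mellin_on_def by auto
    then have "mellin_on A (\<lambda>t. g t + (- 1) * comb x t) (\<lambda>z. Q z * ceval (P x) z + of_real (- 1) * (Q z * ceval (P x) z))"
      by (intro mellin_on_add mellin_on_cmult comb_mellin)
    then have "mellin_on A (\<lambda>t. g t + (- 1) * comb x t) (\<lambda>_. 0)"
      by simp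
    from mellin_injective[OF this] have "g t = comb x t" if "t > 0" for t
      using g comb_cont that by (auto intro!: continuous_intros)
    moreover have "g t = comb x t" if "t \<le> 0" for t
      using g mellin_onD(2)[OF comb_mellin] that by simp
    ultimately show "g = comb x"
      by (metis ext not_le)
  qed
  have ex: "is_components r s a b n \<eta> f (slot_components r s n \<eta> x)"
    unfolding is_components_slot_components_iff f using comb_weight by blast
  have uniq: "C = slot_components r s n \<eta> x" if C: "is_components r s a b n \<eta> f C" for C
  proof -
    obtain y where y: "C = slot_components r s n \<eta> y"
      using is_componentsE[OF C] by blast
    have "comb x t = comb y t" for t
    proof (cases "t > 0")
      case True
      then show ?thesis
        using C comb_weight[OF True, of y] unfolding y is_components_slot_components_iff f by simp
    next
      case False
      then show ?thesis using mellin_onD(2)[OF comb_mellin] by simp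
    qed
    then have xy: "comb x = comb y" by blast
    \<comment> \<open>Real arguments suffice: polynomials that agree on a half-line
      coincide.\<close>
    have "poly (P x) \<zeta> = poly (P y) \<zeta>" if "\<zeta> > A" for \<zeta>
    proof -
      have \<zeta>: "Re (complex_of_real \<zeta>) > A" using that by simp
      have "Q (of_real \<zeta>) * ceval (P x) (of_real \<zeta>) = Q (of_real \<zeta>) * ceval (P y) (of_real \<zeta>)"
        using mellin_onD(3)[OF comb_mellin[of x] \<zeta>] mellin_onD(3)[OF comb_mellin[of y] \<zeta>]
        unfolding xy by (rule has_bochner_integral_eq)
      moreover have "Q (of_real \<zeta>) \<noteq> 0"
        unfolding Q_def by (rule rodrigues_mellin_nonzero[of s r a A b, OF s A ab \<zeta>])
      ultimately show ?thesis by (simp add: ceval_of_real)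
    qed
    then have "{A<..} \<subseteq> {\<zeta>. poly (P x - P y) \<zeta> = 0}" by auto
    then have "infinite {\<zeta>. poly (P x - P y) \<zeta> = 0}"
      using infinite_Ioi infinite_super by blast
    then have "P x - P y = 0"
      using poly_roots_finite by blast
    then have "(\<Sum>i\<in>slots r s n \<eta>. smult (x i - y i) (mellin_row r s a b n i)) = 0"
      unfolding P_def by (simp add: smult_diff_left sum_subtractf)
    from mellin_row_independent[OF c _ this] have "x i = y i" if "i \<in> slots r s n \<eta>" for i
      using that s by force
    then show ?thesis
      unfolding y by (intro slot_components_cong) simp
  qed
  have "\<exists>!C. is_components r s a b n \<eta> f C"
    using ex uniq by blast
  moreover have "rodrigues_components r s a b n \<eta> f = slot_components r s n \<eta> x"
    unfolding rodrigues_components_def using ex uniq by (intro the_equality)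
  ultimately show ?thesis
    using x by blast
qed

section \<open>Growth of the scaled coefficients\<close>

lemma degree_monic_hermite: "degree (monic_hermite k) = k"
  and coeff_monic_hermite_self: "coeff (monic_hermite k) k = 1"
proof -
  have c: "coeff (monic_hermite k) j = (if j \<le> k then (if even (k - j)
      then fact k * (- 1 / 4) ^ ((k - j) div 2) / (fact j * fact ((k - j) div 2)) else 0) else 0)" for j
    unfolding monic_hermite_def by (simp add: coeff_sum)
  show "coeff (monic_hermite k) k = 1" unfolding c by simp
  then show "degree (monic_hermite k) = k"
    by (intro antisym degree_le le_degree) (auto simp: c)
qed

lemma monic_basis_expansion:
  fixes H :: "nat \<Rightarrow> real poly"
  assumes H: "\<And>k. degree (H k) = k" "\<And>k. coeff (H k) k = 1"
  shows "degree P < N \<Longrightarrow> \<exists>c. (\<forall>k\<ge>N. c k = 0) \<and> P = (\<Sum>k<N. smult (c k) (H k))"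
proof (induction N arbitrary: P)
  case (Suc N)
  define P' where "P' = P - smult (coeff P N) (H N)"
  have P': "coeff P' j = 0" if "j \<ge> N" for j
    using that H Suc.prems by (cases "j = N") (auto simp: P'_def coeff_eq_0)
  show ?case
  proof (cases "P' = 0")
    case True
    then show ?thesis
      by (intro exI[of _ "\<lambda>k. if k = N then coeff P N else 0"])
         (auto simp: P'_def if_distrib[of "\<lambda>c. smult c _"] cong: if_cong)
  next
    case False
    then have "degree P' < N"
      using P' by (metis leading_coeff_0_iff not_le)
    from Suc.IH[OF this] obtain c where c: "\<forall>k\<ge>N. c k = 0" "P' = (\<Sum>k<N. smult (c k) (H k))"
      by blast
    have "P = P' + smult (coeff P N) (H N)" by (simp add: P'_def)
    then show ?thesis
      using c by (intro exI[of _ "c(N := coeff P N)"]) auto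
  qed
qed simp

lemma monic_basis_independent:
  fixes H :: "nat \<Rightarrow> real poly"
  assumes H: "\<And>k. degree (H k) = k" "\<And>k. coeff (H k) k = 1"
  shows "(\<Sum>k<N. smult (c k) (H k)) = 0 \<Longrightarrow> k < N \<Longrightarrow> c k = 0"
proof (induction N)
  case (Suc N)
  have "coeff (\<Sum>k<N. smult (c k) (H k)) N = 0"
    by (auto simp: coeff_sum H coeff_eq_0 intro!: sum.neutral)
  then have "c N = 0"
    using arg_cong[OF Suc.prems(1), of "\<lambda>p. coeff p N"] H by simp
  then show ?case
    using Suc by (cases "k = N") auto
qed simp

text \<open>Passing to another monic basis does not change the leading coefficient. Allowing
  \<open>degree P < k\<close> covers a vanishing coefficient, where both sides are 0.\<close>

lemma hermite_coeff_top:
  assumes "degree P \<le> k"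
  shows "hermite_coeff P k = coeff P k"
proof -
  note H = degree_monic_hermite coeff_monic_hermite_self
  obtain c where c: "\<forall>k\<ge>Suc (degree P). c k = 0" "P = (\<Sum>k<Suc (degree P). smult (c k) (monic_hermite k))"
    using monic_basis_expansion[OF H, of P "Suc (degree P)"] by auto
  have "hermite_coeff P = c"
    unfolding hermite_coeff_def
  proof (rule the_equality)
    show "(\<forall>k>degree P. c k = 0) \<and> P = (\<Sum>k\<le>degree P. smult (c k) (monic_hermite k))"
      using c by (auto simp: lessThan_Suc_atMost)
    fix c' assume c': "(\<forall>k>degree P. c' k = 0) \<and> P = (\<Sum>k\<le>degree P. smult (c' k) (monic_hermite k))"
    have "(\<Sum>k<Suc (degree P). smult (c' k - c k) (monic_hermite k)) = 0"
      using c c' by (simp only: smult_diff_left sum_subtractf lessThan_Suc_atMost)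
    from monic_basis_independent[OF H this] have "c' k = c k" if "k \<le> degree P" for k
      using that by fastforce
    moreover have "c' k = c k" if "k > degree P" for k
      using c c' that by auto
    ultimately show "c' = c"
      by (metis ext not_le)
  qed
  moreover have "c k = coeff P k"
  proof (cases "k = degree P")
    case True
    have "coeff P k = (\<Sum>j<Suc k. c j * coeff (monic_hermite j) k)"
      using c(2) True by (metis (no_types, lifting) coeff_smult coeff_sum sum.cong)
    also have "\<dots> = c k"
      using H by (simp add: coeff_eq_0)
    finally show ?thesis by simp
  next
    case False
    then show ?thesis using assms c by (simp add: coeff_eq_0)
  qed
  ultimately show ?thesis by simp
qed

lemma coeff_pcompose_linear_top:
  fixes P :: "real poly"
  assumes "degree P \<le> k"
  shows "degree (pcompose P [:c, d:]) \<le> k" "coeff (pcompose P [:c, d:]) k = coeff P k * d ^ k"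
proof -
  have "degree (pcompose P [:c, d:]) \<le> degree P"
    using degree_pcompose_le[of P "[:c, d:]"] by (simp split: if_splits)
  then show *: "degree (pcompose P [:c, d:]) \<le> k" using assms by simp
  show "coeff (pcompose P [:c, d:]) k = coeff P k * d ^ k"
    using assms
  proof (induction P arbitrary: k)
    case (pCons e P)
    show ?case
    proof (cases "P = 0")
      case True
      then show ?thesis by (cases k) (auto simp: pcompose_pCons)
    next
      case False
      then obtain k' where k': "k = Suc k'" "degree P \<le> k'"
        using pCons.prems by (cases k) auto
      have "degree (pcompose P [:c, d:]) \<le> k'"
        using degree_pcompose_le[of P "[:c, d:]"] k'(2) by (simp split: if_splits)
      then have "coeff (pcompose P [:c, d:]) k = 0"
        using k' by (intro coeff_eq_0) simp
      then show ?thesis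
        using pCons.IH[OF k'(2)] k' by (simp add: pcompose_pCons)
    qed
  qed simp
qed

text \<open>One half of the equivalence of norms in finite dimension. The triangle inequality bounds
  \<N> by a weighted sum of coordinates, hence \<N> is continuous and has a positive minimum on the
  compact boundary of the unit cube.\<close>

lemma norm_dominates_coordinates:
  fixes \<N> :: "('i \<Rightarrow> real) \<Rightarrow> real"
  assumes I: "finite I" and norm: "is_norm_on I \<N>"
  shows "\<exists>C>0. \<forall>v i. (\<forall>j. j \<notin> I \<longrightarrow> v j = 0) \<longrightarrow> \<bar>v i\<bar> \<le> C * \<N> v"
proof -
  define V where "V = {v :: 'i \<Rightarrow> real. \<forall>i. i \<notin> I \<longrightarrow> v i = 0}"
  have nonneg: "0 \<le> \<N> v" and zero: "\<N> v = 0 \<longleftrightarrow> v = (\<lambda>_. 0)"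
    and scale: "\<N> (\<lambda>i. c * v i) = \<bar>c\<bar> * \<N> v" if "v \<in> V" for v c
    using norm that unfolding is_norm_on_def V_def Let_def by blast+
  have tri: "\<N> (\<lambda>i. v i + w i) \<le> \<N> v + \<N> w" if "v \<in> V" "w \<in> V" for v w
    using norm that unfolding is_norm_on_def V_def Let_def by blast
  define e where "e i = (\<lambda>j. if j = i then 1 else (0::real))" for i :: 'i
  have e: "e i \<in> V" if "i \<in> I" for i using that by (auto simp: V_def e_def)
  have bound: "\<N> v \<le> (\<Sum>i\<in>I. \<bar>v i\<bar> * \<N> (e i))" if "v \<in> V" for v
  proof -
    have "J \<subseteq> I \<Longrightarrow> (\<lambda>j. if j \<in> J then v j else 0) \<in> V \<and>
       \<N> (\<lambda>j. if j \<in> J then v j else 0) \<le> (\<Sum>i\<in>J. \<bar>v i\<bar> * \<N> (e i))" if "finite J" for J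
      using that
    proof (induction J)
      case empty
      then show ?case using zero[of "\<lambda>_. 0"] by (auto simp: V_def)
    next
      case (insert i J)
      have split: "(\<lambda>j. if j \<in> insert i J then v j else 0) =
          (\<lambda>j. (if j \<in> J then v j else 0) + v i * e i j)"
        using insert by (auto simp: e_def fun_eq_iff)
      have 1: "(\<lambda>j. v i * e i j) \<in> V" using e[of i] insert by (auto simp: V_def)
      have "\<N> (\<lambda>j. (if j \<in> J then v j else 0) + v i * e i j)
         \<le> \<N> (\<lambda>j. if j \<in> J then v j else 0) + \<bar>v i\<bar> * \<N> (e i)"
        using tri[OF _ 1, of "\<lambda>j. if j \<in> J then v j else 0"] insert scale[OF e[of i], of "v i"] by auto
      then show ?case
        unfolding split using insert 1 by (auto simp: V_def)
    qed
    moreover have "(\<lambda>j. if j \<in> I then v j else 0) = v"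
      using that by (auto simp: V_def fun_eq_iff)
    ultimately show ?thesis
      using I by (metis order_refl)
  qed
  have cont: "continuous_on V \<N>"
  proof -
    have le: "\<N> v - \<N> w \<le> (\<Sum>i\<in>I. \<bar>v i - w i\<bar> * \<N> (e i))" if "v \<in> V" "w \<in> V" for v w
    proof -
      have "(\<lambda>i. v i - w i) \<in> V" using that by (auto simp: V_def)
      from tri[OF this that(2)] bound[OF this] show ?thesis by simp
    qed
    have "(\<N> \<longlongrightarrow> \<N> v) (at v within V)" if v: "v \<in> V" for v
    proof (rule LIM_zero_cancel, rule Lim_null_comparison)
      show "\<forall>\<^sub>F w in at v within V. norm (\<N> w - \<N> v) \<le> (\<Sum>i\<in>I. \<bar>w i - v i\<bar> * \<N> (e i))"
        unfolding eventually_at_filter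
      proof (rule always_eventually, intro allI impI)
        fix w assume "w \<in> V"
        then show "norm (\<N> w - \<N> v) \<le> (\<Sum>i\<in>I. \<bar>w i - v i\<bar> * \<N> (e i))"
          using le[of w v] le[of v w] v by (simp add: abs_le_iff abs_minus_commute)
      qed
      have "((\<lambda>w. w i) \<longlongrightarrow> v i) (at v within V)" for i
        using continuous_on_product_coordinates[of i] continuous_on_subset[of UNIV _ V] v
        unfolding continuous_on_def by blast
      then have "((\<lambda>w. \<Sum>i\<in>I. \<bar>w i - v i\<bar> * \<N> (e i)) \<longlongrightarrow> (\<Sum>i\<in>I. \<bar>v i - v i\<bar> * \<N> (e i))) (at v within V)"
        by (intro tendsto_intros)
      then show "((\<lambda>w. \<Sum>i\<in>I. \<bar>w i - v i\<bar> * \<N> (e i)) \<longlongrightarrow> 0) (at v within V)"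
        by simp
    qed
    then show ?thesis unfolding continuous_on_def by blast
  qed
  \<comment> \<open>Two opposite faces of the unit cube in the coordinates I. The index type may be
    infinite, so compactness is taken in the product topology.\<close>
  define K where "K i = PiE UNIV (\<lambda>j. if j = i then {-1, 1} else if j \<in> I then {-1..1} else {0::real})" for i
  have K: "\<exists>c>0. \<forall>v\<in>K i. c \<le> \<N> v" if i: "i \<in> I" for i
  proof -
    have KV: "K i \<subseteq> V"
    proof
      fix v assume v: "v \<in> K i"
      show "v \<in> V"
        unfolding V_def
      proof (intro CollectI allI impI)
        fix j assume "j \<notin> I"
        with i have "j \<noteq> i" by auto
        with v \<open>j \<notin> I\<close> show "v j = 0" unfolding K_def by (auto dest: PiE_mem[of _ _ _ j])
      qed
    qed
    have "compactin (product_topology (\<lambda>_. euclidean) UNIV) (K i)"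
      unfolding K_def by (subst compactin_PiE) (auto simp: compactin_euclidean_iff)
    then have "compact (K i)"
      by (simp add: euclidean_product_topology compactin_euclidean_iff)
    moreover have "K i \<noteq> {}"
    proof -
      have "e i \<in> K i" by (auto simp: K_def e_def)
      then show ?thesis by blast
    qed
    ultimately obtain v where v: "v \<in> K i" "\<forall>w\<in>K i. \<N> v \<le> \<N> w"
      using continuous_attains_inf[of "K i" \<N>] continuous_on_subset[OF cont KV] by blast
    have "v i \<in> {-1, 1}" using v(1) unfolding K_def by (auto dest: PiE_mem[of _ _ _ i])
    then have "v \<noteq> (\<lambda>_. 0)" by auto
    then have "\<N> v > 0" using nonneg[of v] zero[of v] v(1) KV by force
    with v(2) show ?thesis by blast
  qed
  then obtain c where c: "\<And>i. i \<in> I \<Longrightarrow> c i > 0" "\<And>i v. i \<in> I \<Longrightarrow> v \<in> K i \<Longrightarrow> c i \<le> \<N> v"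
    by metis
  \<comment> \<open>The sum dominates each 1 / c_i, and the summand 1 keeps C positive even for
    empty I.\<close>
  define C where "C = 1 + (\<Sum>i\<in>I. 1 / c i)"
  have C: "C > 0" "\<And>i. i \<in> I \<Longrightarrow> 1 / c i \<le> C"
  proof -
    have "(\<Sum>i\<in>I. 1 / c i) \<ge> 0" using c by (intro sum_nonneg) (auto simp: less_imp_le)
    then show "C > 0" unfolding C_def by linarith
    fix i assume "i \<in> I"
    then have "1 / c i \<le> (\<Sum>i\<in>I. 1 / c i)"
      using c I by (intro member_le_sum) (auto simp: less_imp_le)
    then show "1 / c i \<le> C" unfolding C_def by linarith
  qed
  have "\<bar>v i\<bar> \<le> C * \<N> v" if v: "v \<in> V" for v i
  proof (cases "v i = 0 \<or> I = {}")
    case True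
    then show ?thesis using nonneg[OF v] C v by (auto simp: V_def)
  next
    case False
    \<comment> \<open>Division by a coordinate of largest modulus moves v onto one of these
      faces.\<close>
    have "Max ((\<lambda>j. \<bar>v j\<bar>) ` I) \<in> (\<lambda>j. \<bar>v j\<bar>) ` I"
      using I False by (intro Max_in) auto
    then obtain k where k: "k \<in> I" "Max ((\<lambda>j. \<bar>v j\<bar>) ` I) = \<bar>v k\<bar>"
      by auto
    have kmax: "\<bar>v j\<bar> \<le> \<bar>v k\<bar>" if "j \<in> I" for j
      unfolding k(2)[symmetric] using I that by (intro Max_ge) auto
    have "i \<in> I" using False v by (auto simp: V_def)
    then have le: "\<bar>v i\<bar> \<le> \<bar>v k\<bar>" and vk: "\<bar>v k\<bar> > 0"
      using kmax[of i] False by auto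
    have "(\<lambda>j. (1 / v k) * v j) \<in> K k"
      unfolding K_def
    proof (rule PiE_I)
      fix j
      have "\<bar>v j\<bar> / \<bar>v k\<bar> \<le> 1" if "j \<in> I"
        using kmax[OF that] vk by simp
      then have "\<bar>v j / v k\<bar> \<le> 1" if "j \<in> I" using that by simp
      then have "v j / v k \<in> {-1..1}" if "j \<in> I"
        using that unfolding atLeastAtMost_iff abs_le_iff by force
      then show "(1 / v k) * v j \<in> (if j = k then {-1, 1} else if j \<in> I then {-1..1} else {0})"
        using vk v by (simp add: V_def)
    qed simp
    from c(2)[OF k(1) this] have "c k \<le> \<N> v / \<bar>v k\<bar>"
      unfolding scale[OF v] by simp
    then have "\<bar>v k\<bar> \<le> 1 / c k * \<N> v"
      using vk c(1)[OF k(1)] by (simp add: field_simps)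
    also have "\<dots> \<le> C * \<N> v"
      using C(2)[OF k(1)] nonneg[OF v] by (rule mult_right_mono)
    finally show ?thesis using le by simp
  qed
  then show ?thesis
    using C(1) unfolding V_def by blast
qed

text \<open>A top slot holds a leading coefficient, so the substitution and the Hermite basis only
  multiply it by (\<tau>^s \<epsilon>)^k; lower slots would mix with higher ones. As k \<ge> 1 and G
  \<ge> 1, G^k may be replaced by G.\<close>

lemma coeff_vector_top_slot:
  assumes adm: "laguerre_admissible r s n \<eta>" and s: "s > 0" and R: "R = (\<Sum>l=1..s. \<eta> l)" "R > s"
    and i: "i \<in> slots r s n \<eta>" and top: "top_slot s \<eta> i"
    and \<tau>: "\<tau> > 0" and G: "G = \<tau> ^ s * eps s \<tau> ^ (s + 1)" "G \<ge> 1"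
    and K: "K \<ge> 1" "\<And>h. h \<in> {1..r} \<Longrightarrow> b h + 1 > 0 \<and> eps s \<tau> * (b h + 1) \<le> K"
  shows "G * \<bar>x i\<bar> \<le> K * \<bar>coeff_vector r s n \<eta> \<tau> b (slot_components r s n \<eta> x) i\<bar>"
proof -
  define \<epsilon> where "\<epsilon> = eps s \<tau>"
  define v where "v = coeff_vector r s n \<eta> \<tau> b (slot_components r s n \<eta> x) i"
  have \<epsilon>: "\<epsilon> > 0" using s \<tau> by (simp add: \<epsilon>_def eps_def)
  have G_power: "G \<le> G ^ k" if "k \<ge> 1" for k
    using power_increasing[of 1 k G] that G(2) by simp
  have G_split: "\<epsilon> ^ (s * k) * (\<tau> ^ s * \<epsilon>) ^ k = G ^ k" for k
    unfolding G(1) \<epsilon>_def[symmetric] by (simp add: power_mult_distrib power_add power_mult[symmetric] mult_ac)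
  have eval: "hermite_coeff (smult c (pcompose (\<Sum>j<m. monom (y j) j) (x_poly s \<tau>))) k
      = c * (y k * (\<tau> ^ s * \<epsilon>) ^ k)" if "m = k + 1" for c y m k
  proof -
    have "degree (\<Sum>j<m. monom (y j) j) \<le> k"
      using that by (intro degree_le) (simp add: coeff_sum_monom)
    note top = coeff_pcompose_linear_top[OF this, of "\<tau> ^ s" "\<tau> ^ s * \<epsilon>"]
    then have "hermite_coeff (smult c (pcompose (\<Sum>j<m. monom (y j) j) (x_poly s \<tau>))) k
      = coeff (smult c (pcompose (\<Sum>j<m. monom (y j) j) (x_poly s \<tau>))) k"
      unfolding x_poly_def \<epsilon>_def by (intro hermite_coeff_top order_trans[OF degree_smult_le])
    then show ?thesis
      using top(2) that by (simp add: x_poly_def \<epsilon>_def[symmetric] coeff_sum_monom)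
  qed
  show ?thesis
  proof (cases i)
    case (Inl q)
    obtain h k where q: "q = (h, k)" by force
    have h: "h \<in> {1..r}" using i Inl q by (simp add: Inl_in_slots_iff)
    have k: "k \<ge> 1" "n h = k + 1"
      using top_slot_Inl[OF adm s, of h k] i top R unfolding Inl q by simp_all
    have sk: "R = s * k" using top unfolding top_slot_def[OF adm s] Inl q R(1) by simp
    have "v = hermite_coeff (scaled_B s R \<tau> b (fst (slot_components r s n \<eta> x)) h) k"
      using i unfolding v_def coeff_vector_def Inl q Let_def R(1) by simp
    also have "\<dots> = (\<epsilon> ^ (R - 1) / (b h + 1)) * (x i * (\<tau> ^ s * \<epsilon>) ^ k)"
      unfolding scaled_B_def using eval[OF k(2), of _ "\<lambda>k. x (Inl (h, k))"] h
      by (simp add: slot_components_def \<epsilon>_def Inl q)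
    \<comment> \<open>The factor \<epsilon> (b_h + 1) cancels the normalising denominator and
      supplies the power of \<epsilon> by which R - 1 falls short of s k.\<close>
    also have "\<dots> * (\<epsilon> * (b h + 1)) = x i * (\<epsilon> ^ (R - 1) * \<epsilon>) * (\<tau> ^ s * \<epsilon>) ^ k"
      using K(2)[OF h] by simp
    also have "\<epsilon> ^ (R - 1) * \<epsilon> = \<epsilon> ^ R"
      using R(2) by (intro power_minus_mult) linarith
    also have "x i * \<epsilon> ^ R * (\<tau> ^ s * \<epsilon>) ^ k = x i * G ^ k"
      unfolding sk G_split[of k, symmetric] by (simp only: mult.assoc)
    finally have eq: "v * (\<epsilon> * (b h + 1)) = x i * G ^ k" .
    have "G * \<bar>x i\<bar> \<le> G ^ k * \<bar>x i\<bar>"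
      using G_power[OF k(1)] by (rule mult_right_mono) simp
    also have "\<dots> = \<bar>v\<bar> * (\<epsilon> * (b h + 1))"
      using arg_cong[OF eq, of abs] G(2) K(2)[OF h] \<epsilon> by (simp add: abs_mult mult.commute)
    also have "\<dots> \<le> \<bar>v\<bar> * K"
      using K(2)[OF h] by (intro mult_left_mono) (auto simp: \<epsilon>_def)
    finally show ?thesis unfolding v_def by (simp add: mult.commute)
  next
    case (Inr q)
    obtain l k where q: "q = (l, k)" by force
    have l: "l \<in> {1..s}" using i Inr q by (simp add: Inr_in_slots_iff)
    have k: "k \<ge> 1" "\<eta> l = k + 1"
      using top_slot_Inr[OF adm s, of l k] i top R unfolding Inr q by simp_all
    have sk: "R = s * k + l" using top unfolding top_slot_def[OF adm s] Inr q R(1) by simp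
    have "v = hermite_coeff (scaled_D s R \<tau> (snd (slot_components r s n \<eta> x)) l) k"
      using i unfolding v_def coeff_vector_def Inr q Let_def R(1) by simp
    also have "\<dots> = ((- 1) ^ (l - 1) * \<epsilon> ^ (R - l)) * (x i * (\<tau> ^ s * \<epsilon>) ^ k)"
      unfolding scaled_D_def using eval[OF k(2), of _ "\<lambda>k. x (Inr (l, k))"] l
      by (simp add: slot_components_def \<epsilon>_def Inr q)
    \<comment> \<open>Here R - l is already s k, so no power of \<epsilon> is missing.\<close>
    also have "\<dots> = (- 1) ^ (l - 1) * (x i * (\<epsilon> ^ (s * k) * (\<tau> ^ s * \<epsilon>) ^ k))"
      unfolding sk by (simp add: mult_ac)
    also have "\<epsilon> ^ (s * k) * (\<tau> ^ s * \<epsilon>) ^ k = G ^ k"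
      by (rule G_split)
    finally have "\<bar>v\<bar> = G ^ k * \<bar>x i\<bar>"
      using G(2) by (simp add: abs_mult power_abs mult.commute)
    moreover have "G * \<bar>x i\<bar> \<le> G ^ k * \<bar>x i\<bar>"
      using G_power[OF k(1)] by (rule mult_right_mono) simp
    moreover have "\<bar>v\<bar> \<le> K * \<bar>v\<bar>"
      using K(1) mult_right_mono[of 1 K "\<bar>v\<bar>"] by simp
    ultimately show ?thesis unfolding v_def by linarith
  qed
qed

text \<open>A bound at one fixed \<tau>. Passing to absolute values over all slots makes
  cancellation between top slots harmless.\<close>

lemma coeff_vector_lower_bound:
  assumes adm: "laguerre_admissible r s n \<eta>" and s: "s > 0" and R: "(\<Sum>l=1..s. \<eta> l) > s"
    and m: "(\<Sum>i=1..p. m i) + 1 = (\<Sum>h=1..r. n h) + (\<Sum>l=1..s. \<eta> l)"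
    and x: "rodrigues_poly p \<beta> m = (\<Sum>i\<in>slots r s n \<eta>. smult (x i) (mellin_row r s a b n i))"
    and \<tau>: "\<tau> > 0" and G: "G = \<tau> ^ s * eps s \<tau> ^ (s + 1)" "G \<ge> 1"
    and K: "K \<ge> 1" "\<And>h. h \<in> {1..r} \<Longrightarrow> b h + 1 > 0 \<and> eps s \<tau> * (b h + 1) \<le> K"
  shows "G \<le> K * (\<Sum>i\<in>slots r s n \<eta>. \<bar>coeff_vector r s n \<eta> \<tau> b (slot_components r s n \<eta> x) i\<bar>)"
proof -
  define v where "v = coeff_vector r s n \<eta> \<tau> b (slot_components r s n \<eta> x)"
  define M where "M = (\<Sum>h=1..r. n h) + (\<Sum>l=1..s. \<eta> l) - 1"
  have M: "degree (rodrigues_poly p \<beta> m) = M"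
    using m by (simp add: degree_rodrigues_poly M_def)
  have "1 = \<bar>coeff (rodrigues_poly p \<beta> m) M\<bar>"
    using abs_lead_coeff_rodrigues_poly[of p \<beta> m] unfolding M by simp
  also have "coeff (rodrigues_poly p \<beta> m) M = (\<Sum>i\<in>slots r s n \<eta>. x i * (if top_slot s \<eta> i then 1 else 0))"
    unfolding x coeff_sum coeff_smult M_def
    by (rule sum.cong[OF refl]) (simp only: coeff_mellin_row_top[OF adm s])
  also have "\<bar>\<dots>\<bar> \<le> (\<Sum>i\<in>slots r s n \<eta>. \<bar>x i * (if top_slot s \<eta> i then 1 else 0)\<bar>)"
    by (rule sum_abs)
  finally have "G * 1 \<le> G * (\<Sum>i\<in>slots r s n \<eta>. \<bar>x i * (if top_slot s \<eta> i then 1 else 0)\<bar>)"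
    using G(2) by (intro mult_left_mono) auto
  also have "\<dots> \<le> (\<Sum>i\<in>slots r s n \<eta>. K * \<bar>v i\<bar>)"
    unfolding sum_distrib_left
  proof (rule sum_mono)
    fix i assume i: "i \<in> slots r s n \<eta>"
    show "G * \<bar>x i * (if top_slot s \<eta> i then 1 else 0)\<bar> \<le> K * \<bar>v i\<bar>"
    proof (cases "top_slot s \<eta> i")
      case True
      then show ?thesis
        using coeff_vector_top_slot[OF adm s refl R i True \<tau> G K, where x = x] unfolding v_def by simp
    qed (use K(1) in simp)
  qed
  finally show ?thesis unfolding v_def by (simp add: sum_distrib_left)
qed

text \<open>Since (\<tau> \<epsilon>)^2 = 2 s \<tau> and \<tau> \<epsilon>^2 = 2 s, the scale equals
  2 s (\<tau> \<epsilon>)^(s-1) with \<tau> \<epsilon> \<ge> sqrt \<tau> \<ge> 1. The exponent s - 1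
  \<ge> 1 leaves at least one factor sqrt \<tau>.\<close>

lemma scale_tendsto_infinity:
  assumes "s \<ge> 2"
  shows "\<forall>\<^sub>F \<tau> in at_top. sqrt \<tau> \<ge> 1 \<and> sqrt \<tau> \<le> \<tau> ^ s * eps s \<tau> ^ (s + 1)"
  using eventually_ge_at_top[of 1]
proof eventually_elim
  fix \<tau> :: real assume \<tau>: "\<tau> \<ge> 1"
  define \<epsilon> where "\<epsilon> = eps s \<tau>"
  have sq: "\<epsilon>\<^sup>2 = 2 * real s / \<tau>" using \<tau> by (simp add: \<epsilon>_def eps_def)
  have "\<tau> * \<epsilon> = sqrt (2 * real s * \<tau>)"
  proof (rule real_sqrt_unique[symmetric])
    show "(\<tau> * \<epsilon>)\<^sup>2 = 2 * real s * \<tau>"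
      unfolding power_mult_distrib sq using \<tau> by (simp add: power2_eq_square)
  qed (use \<tau> in \<open>simp add: \<epsilon>_def eps_def\<close>)
  moreover have "1 * \<tau> \<le> 2 * real s * \<tau>"
    using assms \<tau> by (intro mult_right_mono) auto
  ultimately have le: "sqrt \<tau> \<le> \<tau> * \<epsilon>" by simp
  have 1: "sqrt \<tau> \<ge> 1" using \<tau> by simp
  then have "1 \<le> \<tau> * \<epsilon>" using le by (rule order_trans)
  obtain t where t: "s = Suc (Suc t)" using assms by (metis add_2_eq_Suc le_Suc_ex)
  have "sqrt \<tau> * 1 \<le> (\<tau> * \<epsilon>) ^ Suc t * (2 * real s)"
  proof (rule mult_mono)
    have "(\<tau> * \<epsilon>) ^ 1 \<le> (\<tau> * \<epsilon>) ^ Suc t"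
      using \<open>1 \<le> \<tau> * \<epsilon>\<close> by (intro power_increasing) auto
    then show "sqrt \<tau> \<le> (\<tau> * \<epsilon>) ^ Suc t" using le by simp
  qed (use \<open>1 \<le> \<tau> * \<epsilon>\<close> assms \<tau> in auto)
  also have "\<dots> = (\<tau> * \<epsilon>) ^ Suc t * (\<tau> * \<epsilon>\<^sup>2)"
    using sq \<tau> by simp
  also have "\<dots> = \<tau> ^ s * \<epsilon> ^ (s + 1)"
    unfolding t by (simp add: power_mult_distrib power2_eq_square)
  finally show "sqrt \<tau> \<ge> 1 \<and> sqrt \<tau> \<le> \<tau> ^ s * eps s \<tau> ^ (s + 1)"
    using 1 by (simp add: \<epsilon>_def)
qed

lemma eps_tendsto_0: "(eps s \<longlongrightarrow> 0) at_top"
proof -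
  have "((\<lambda>\<tau>. sqrt (2 * real s / \<tau>)) \<longlongrightarrow> sqrt 0) at_top"
    by (intro tendsto_real_sqrt tendsto_divide_0[OF tendsto_const] filterlim_at_top_imp_at_infinity filterlim_ident)
  then show ?thesis unfolding eps_def[abs_def] by simp
qed


theorem propositionA6:
  fixes p r s :: nat
    and a b \<beta> :: "real \<Rightarrow> nat \<Rightarrow> real"
    and a_hat \<rho> d \<xi> :: "nat \<Rightarrow> real"
    and n \<eta> m :: "nat \<Rightarrow> nat"
  assumes "p \<ge> 1" and "s \<ge> 2"
    and "\<forall>\<^sub>F \<tau> in at_top. (\<forall>\<nu>\<in>{1..r+s}. a \<tau> \<nu> > -1) \<and> (\<forall>h\<in>{1..r}. b \<tau> h > a \<tau> h)"
    and "\<forall>j\<in>{1..s}. (\<lambda>\<tau>. a \<tau> (r + j) + 1 - (\<tau> + sqrt (2 * \<tau>) * a_hat j)) \<in> O[at_top](\<lambda>_. 1)"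
    and "\<forall>h\<in>{1..r}. \<rho> h > 0 \<and> ((\<lambda>\<tau>. eps s \<tau> * (a \<tau> h + 1)) \<longlongrightarrow> \<rho> h) at_top"
    and "\<forall>h\<in>{1..r}. d h \<ge> 0 \<and> ((\<lambda>\<tau>. b \<tau> h - a \<tau> h) \<longlongrightarrow> d h) at_top"
    and "\<forall>i\<in>{1..p}. ((\<lambda>\<tau>. eps s \<tau> * \<beta> \<tau> i) \<longlongrightarrow> \<xi> i) at_top"
    and "inj_on \<xi> {1..p}"
    and "\<forall>i\<in>{1..p}. \<forall>h\<in>{1..r}. \<xi> i + \<rho> h > 0"
    and "laguerre_admissible r s n \<eta>"
    and "int (\<Sum>i=1..p. m i) = int ((\<Sum>h=1..r. n h) + (\<Sum>l=1..s. \<eta> l)) - 1"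
    and "(\<Sum>l=1..s. \<eta> l) > s"
    and "\<forall>\<^sub>F \<tau> in at_top. c_index r s (a \<tau>) (b \<tau>) n \<noteq> 0"
  shows "let F = (\<lambda>\<tau>. rodrigues_function p r s (a \<tau>) (b \<tau>) (\<beta> \<tau>) n m) in
    (\<forall>\<^sub>F \<tau> in at_top. \<exists>!C. is_components r s (a \<tau>) (b \<tau>) n \<eta> (F \<tau>) C) \<and>
    (\<forall>\<N>. is_norm_on (slots r s n \<eta>) \<N> \<longrightarrow>
       filterlim (\<lambda>\<tau>. \<N> (coeff_vector r s n \<eta> \<tau> (b \<tau>)
                            (rodrigues_components r s (a \<tau>) (b \<tau>) n \<eta> (F \<tau>)))) at_top at_top)"
proof -
  define f where "f \<tau> = rodrigues_function p r s (a \<tau>) (b \<tau>) (\<beta> \<tau>) n m" for \<tau>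
  define R where "R = (\<Sum>l=1..s. \<eta> l)"
  define N where "N = (\<Sum>h=1..r. n h) + R"
  have m: "(\<Sum>i=1..p. m i) + 1 = N"
    using assms(11) unfolding N_def R_def by linarith
  have s: "s > 0" using assms(2) by simp
  note adm = assms(10)
  let ?C = "\<lambda>\<tau>. rodrigues_components r s (a \<tau>) (b \<tau>) n \<eta> (f \<tau>)"
  have system: "\<forall>\<^sub>F \<tau> in at_top. \<exists>x.
      rodrigues_poly p (\<beta> \<tau>) m = (\<Sum>i\<in>slots r s n \<eta>. smult (x i) (mellin_row r s (a \<tau>) (b \<tau>) n i)) \<and>
      (\<exists>!C. is_components r s (a \<tau>) (b \<tau>) n \<eta> (f \<tau>) C) \<and> ?C \<tau> = slot_components r s n \<eta> x"
    using assms(3) assms(13)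
  proof eventually_elim
    case (elim \<tau>)
    show ?case
      by (rule rodrigues_components_system[OF assms(2) _ adm elim(2)])
         (use elim(1) m in \<open>auto simp: f_def N_def R_def\<close>)
  qed
  have b_lim: "((\<lambda>\<tau>. eps s \<tau> * (b \<tau> h + 1)) \<longlongrightarrow> \<rho> h) at_top" if "h \<in> {1..r}" for h
  proof -
    \<comment> \<open>b_h + 1 is (a_h + 1) + (b_h - a_h), and \<epsilon> tending to 0 removes the
      convergent difference, so \<rho>_h is also the limit for b_h.\<close>
    have "((\<lambda>\<tau>. eps s \<tau> * (a \<tau> h + 1) + eps s \<tau> * (b \<tau> h - a \<tau> h)) \<longlongrightarrow> \<rho> h + 0 * d h) at_top"
      using assms(5,6) that eps_tendsto_0[of s] by (intro tendsto_add tendsto_mult) auto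
    then show ?thesis by (simp add: algebra_simps)
  qed
  \<comment> \<open>The margin 2 puts K strictly above every limit \<rho>_h and keeps K \<ge> 1 also
    for r = 0.\<close>
  define K where "K = 2 + (\<Sum>h=1..r. \<bar>\<rho> h\<bar>)"
  have K: "K \<ge> 1" unfolding K_def using sum_nonneg[of "{1..r}" "\<lambda>h. \<bar>\<rho> h\<bar>"] by simp
  have "\<forall>\<^sub>F \<tau> in at_top. eps s \<tau> * (b \<tau> h + 1) \<le> K" if "h \<in> {1..r}" for h
  proof -
    have "\<bar>\<rho> h\<bar> \<le> (\<Sum>h=1..r. \<bar>\<rho> h\<bar>)"
      using that by (intro member_le_sum) auto
    then have "\<rho> h < K" unfolding K_def by linarith
    with b_lim[OF that]
    have "\<forall>\<^sub>F \<tau> in at_top. eps s \<tau> * (b \<tau> h + 1) < K"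
      by (rule order_tendstoD)
    then show ?thesis by eventually_elim simp
  qed
  then have Kb: "\<forall>\<^sub>F \<tau> in at_top. \<forall>h\<in>{1..r}. eps s \<tau> * (b \<tau> h + 1) \<le> K"
    by (intro eventually_ball_finite) auto
  have "filterlim (\<lambda>\<tau>. \<N> (coeff_vector r s n \<eta> \<tau> (b \<tau>) (?C \<tau>))) at_top at_top"
    if norm: "is_norm_on (slots r s n \<eta>) \<N>" for \<N>
  proof -
    obtain c where c: "c > 0"
      and dom: "\<And>v i. (\<forall>j. j \<notin> slots r s n \<eta> \<longrightarrow> v j = 0) \<Longrightarrow> \<bar>v i\<bar> \<le> c * \<N> v"
      using norm_dominates_coordinates[OF finite_slots norm] by blast
    \<comment> \<open>There are N slots and each coordinate is at most c times the norm, so the sum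
      of their moduli is at most N c times the norm.\<close>
    define k where "k = K * (real N * c)"
    have "N > 0" using assms(12) by (simp add: N_def R_def)
    then have k: "k > 0" using K c by (simp add: k_def)
    have "\<forall>\<^sub>F \<tau> in at_top. (1 / k) * sqrt \<tau> \<le> \<N> (coeff_vector r s n \<eta> \<tau> (b \<tau>) (?C \<tau>))"
      using system Kb assms(3) scale_tendsto_infinity[OF assms(2)]
    proof eventually_elim
      case (elim \<tau>)
      define v where "v = coeff_vector r s n \<eta> \<tau> (b \<tau>) (?C \<tau>)"
      obtain x where x: "rodrigues_poly p (\<beta> \<tau>) m = (\<Sum>i\<in>slots r s n \<eta>. smult (x i) (mellin_row r s (a \<tau>) (b \<tau>) n i))"
        "?C \<tau> = slot_components r s n \<eta> x"
        using elim(1) by blast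
      have bK: "b \<tau> h + 1 > 0 \<and> eps s \<tau> * (b \<tau> h + 1) \<le> K" if "h \<in> {1..r}" for h
        using elim(2,3) that by force
      have \<tau>: "\<tau> > 0"
        using elim(4) by (metis less_le_trans real_sqrt_gt_0_iff zero_less_one)
      have G1: "\<tau> ^ s * eps s \<tau> ^ (s + 1) \<ge> 1" using elim(4) by linarith
      have "sqrt \<tau> \<le> \<tau> ^ s * eps s \<tau> ^ (s + 1)" using elim(4) by simp
      also have "\<dots> \<le> K * (\<Sum>i\<in>slots r s n \<eta>. \<bar>v i\<bar>)"
        unfolding v_def x(2)
        by (rule coeff_vector_lower_bound[OF adm s assms(12) m[unfolded N_def R_def] x(1) \<tau> refl G1 K bK])
      also have "\<dots> \<le> K * (\<Sum>i\<in>slots r s n \<eta>. c * \<N> v)"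
      proof (intro mult_left_mono sum_mono)
        show "\<bar>v i\<bar> \<le> c * \<N> v" for i
          by (rule dom) (simp add: v_def coeff_vector_def)
      qed (use K in simp)
      also have "\<dots> = k * \<N> v"
        by (simp add: card_slots k_def N_def R_def)
      finally show ?case
        using k unfolding v_def by (simp add: field_simps)
    qed
    moreover have "filterlim (\<lambda>\<tau>. (1 / k) * sqrt \<tau>) at_top at_top"
      using k by (intro filterlim_tendsto_pos_mult_at_top[OF tendsto_const] sqrt_at_top) simp
    ultimately show ?thesis
      by (rule filterlim_at_top_mono[rotated])
  qed
  moreover have "\<forall>\<^sub>F \<tau> in at_top. \<exists>!C. is_components r s (a \<tau>) (b \<tau>) n \<eta> (f \<tau>) C"
    using system by eventually_elim blast
  ultimately show ?thesis
    unfolding Let_def f_def by blast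
qed

end
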